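(* Let $J$ be a complex Jordan matrix, and let $\lambda'_1,\dots,\lambda'_M$ and $n_1,\dots,n_M$ be the associated sequences described in the context. Let $q_i^j$ ($n_i\times n_j$ matrices) and $p_j^i$ ($n_j\times n_i$ matrices), $1\le j<i\le M$, be blocks of independent complex variables. Let $Q$ be the block lower-triangular matrix with diagonal blocks $I_{n_1},\dots,I_{n_M}$ and with block $q_i^j$ in position $(i,j)$ for $i>j$; let $[Q]_k$ denote its lower diagonal corner consisting of the last $k$ block rows and the last $k$ block columns. Put $\vec p_k=(p_k^{k+1},p_k^{k+2},\dots,p_k^{M})$. Let $\rho$ be the block upper-triangular matrix with diagonal blocks $\lambda'_1I_{n_1},\dots,\lambda'_MI_{n_M}$ and with blocks $\rho_k^{l}$ in position $(k,l)$, $l>k$, where the block rows $\vec\rho_k=(\rho_k^{k+1},\dots,\rho_k^{M})$ are $$\vec\rho_k:=\vec p_k\,[Q]_{M-k},\qquad k=1,\dots,M-1 .$$ Then the matrix $$A=Q\rho Q^{-1}$$ provides a canonical parameterization of the orbit $\mathcal O(J)\ni A$ by the couples of matrix elements $(p_j^i)_{st},\ (q_i^j)_{ts}$, $1\le s\le n_j$, $1\le t\le n_i$, $1\le j<i\le M$.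
   Context: $\mathcal O(J)=\{gJg^{-1}: g\in\mathrm{GL}(N,\mathbb{C})\}$, with the Lie–Poisson–Kirillov–Kostant form: for $\xi_1,\xi_2$ tangent at $A=gJg^{-1}$ to curves $A_i(t)=g_i(t)Jg_i(t)^{-1}$, $g_1(0)=g_2(0)=g$, $$\omega_{\mathcal O(J)}(\xi_1,\xi_2)=\operatorname{tr} J[g^{-1}\dot g_1,g^{-1}\dot g_2]=\operatorname{tr}(\dot g_1g^{-1})\dot A_2 .$$ The sequence $\lambda'_1,\dots,\lambda'_M$: a list, in any order, of the eigenvalues of $J$ in which each eigenvalue $\lambda'$ is written $r_{\lambda'}$ times, where $r_{\lambda'}$ is the length of the longest Jordan chain of $J$ for $\lambda'$. The number $n_k$ is the number of Jordan chains of $J$ for the eigenvalue $\lambda'_k$ whose length is not smaller than the number of members equal to $\lambda'_k$ in the subsequence $\lambda'_1,\dots,\lambda'_k$. (Thus $n_1+\dots+n_M=N$.) "Canonical parameterization" means: the map $(p,q)\mapsto A=Q\rho Q^{-1}$, restricted to the Zariski-open set of values of the parameters for which $A$ lies in $\mathcal O(J)$ (the remaining parameter values, forming a proper closed set, correspond to points of an enlargement of the orbit), is a birational map to $\mathcal O(J)$, and the couples of matrix elements are Darboux coordinates, i.e. canonically conjugate: with the convention $\omega_{\mathcal O(J)}(\xi_1,\xi_2)=\operatorname{tr} J[g^{-1}\dot g_1,g^{-1}\dot g_2]=\operatorname{tr}(\dot g_1g^{-1})\dot A_2$ for $\omega_{\mathcal O(J)}$, $$\omega_{\mathcal O(J)}=\sum_{1\le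 j<i\le M}\ \sum_{s=1}^{n_j}\sum_{t=1}^{n_i} d(q_i^j)_{ts}\wedge d(p_j^i)_{st},$$ where $(\alpha\wedge\beta)(X,Y)=\alpha(X)\beta(Y)-\alpha(Y)\beta(X)$. *)

theory Defs
  imports
    Complex_Main
    "HOL-Library.FuncSet"
    "Jordan_Normal_Form.Spectral_Radius"
    "Jordan_Normal_Form.Gauss_Jordan_Elimination"
begin

section \<open>Polynomial functions, Zariski topology, birational maps\<close>

text \<open>
  A (quasi-affine) variety is handled as a set \<open>X\<close> of points together with a set \<open>C\<close> of
  coordinate functions.  Since the ground field is infinite, polynomials in the coordinates may be
  identified with polynomial functions.
\<close>

inductive_set poly_funs :: "('a \<Rightarrow> complex) set \<Rightarrow> ('a \<Rightarrow> complex) set"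
  for C :: "('a \<Rightarrow> complex) set" where
  const: "(\<lambda>_. z) \<in> poly_funs C"
| coord: "c \<in> C \<Longrightarrow> c \<in> poly_funs C"
| add: "f \<in> poly_funs C \<Longrightarrow> g \<in> poly_funs C \<Longrightarrow> (\<lambda>x. f x + g x) \<in> poly_funs C"
| mult: "f \<in> poly_funs C \<Longrightarrow> g \<in> poly_funs C \<Longrightarrow> (\<lambda>x. f x * g x) \<in> poly_funs C"

definition zariski_open :: "('a \<Rightarrow> complex) set \<Rightarrow> 'a set \<Rightarrow> 'a set \<Rightarrow> bool" where
  "zariski_open C X U \<longleftrightarrow> (\<exists>S \<subseteq> poly_funs C. U = {x \<in> X. \<exists>f\<in>S. f x \<noteq> 0})"

definition zariski_dense :: "('a \<Rightarrow> complex) set \<Rightarrow> 'a set \<Rightarrow> 'a set \<Rightarrow> bool" where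
  "zariski_dense C X D \<longleftrightarrow> (\<forall>W. zariski_open C X W \<and> W \<noteq> {} \<longrightarrow> W \<inter> D \<noteq> {})"

definition regular_on :: "('a \<Rightarrow> complex) set \<Rightarrow> 'a set \<Rightarrow> ('a \<Rightarrow> complex) \<Rightarrow> bool" where
  "regular_on C X h \<longleftrightarrow>
     (\<forall>x\<in>X. \<exists>W. zariski_open C X W \<and> x \<in> W \<and>
        (\<exists>a\<in>poly_funs C. \<exists>b\<in>poly_funs C. \<forall>y\<in>W. b y \<noteq> 0 \<and> h y = a y / b y))"

definition regular_map ::
  "('a \<Rightarrow> complex) set \<Rightarrow> 'a set \<Rightarrow> ('b \<Rightarrow> complex) set \<Rightarrow> 'b set \<Rightarrow> ('a \<Rightarrow> 'b) \<Rightarrow> bool" where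
  "regular_map C X D Y f \<longleftrightarrow> f ` X \<subseteq> Y \<and> (\<forall>c\<in>D. regular_on C X (\<lambda>x. c (f x)))"

text \<open>
  A regular map that restricts to an isomorphism between dense open subsets.  Density (instead of
  mere non-emptiness) makes the notion appropriate without presupposing irreducibility.
\<close>

definition birational_map ::
  "('a \<Rightarrow> complex) set \<Rightarrow> 'a set \<Rightarrow> ('b \<Rightarrow> complex) set \<Rightarrow> 'b set \<Rightarrow> ('a \<Rightarrow> 'b) \<Rightarrow> bool" where
  "birational_map C X D Y f \<longleftrightarrow>
     regular_map C X D Y f \<and>
     (\<exists>X' Y' g.
        zariski_open C X X' \<and> zariski_dense C X X' \<and>
        zariski_open D Y Y' \<and> zariski_dense D Y Y' \<and>
        regular_map C X' D Y' f \<and> regular_map D Y' C X' g \<and>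
        (\<forall>x\<in>X'. g (f x) = x) \<and> (\<forall>y\<in>Y'. f (g y) = y))"

definition entry_coords :: "nat \<Rightarrow> (complex mat \<Rightarrow> complex) set" where
  "entry_coords n = {(\<lambda>A. A $$ (a, b)) | a b. a < n \<and> b < n}"


section \<open>The orbit and its Lie--Poisson--Kirillov--Kostant form\<close>

definition GL :: "nat \<Rightarrow> complex mat set" where
  "GL n = {g \<in> carrier_mat n n. invertible_mat g}"

text \<open>Meaningful for invertible matrices only.\<close>

abbreviation minv :: "complex mat \<Rightarrow> complex mat" where
  "minv A \<equiv> the (mat_inverse A)"

definition conj_by :: "complex mat \<Rightarrow> complex mat \<Rightarrow> complex mat" where
  "conj_by g J = g * J * minv g"

definition orbit :: "complex mat \<Rightarrow> complex mat set" where
  "orbit J = {conj_by g J | g. g \<in> GL (dim_row J)}"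

definition mat_trace :: "complex mat \<Rightarrow> complex" where
  "mat_trace A = (\<Sum>i<dim_row A. A $$ (i, i))"

definition commutator :: "complex mat \<Rightarrow> complex mat \<Rightarrow> complex mat" where
  "commutator X Y = X * Y - Y * X"

definition has_mat_deriv0 :: "nat \<Rightarrow> (complex \<Rightarrow> complex mat) \<Rightarrow> complex mat \<Rightarrow> bool" where
  "has_mat_deriv0 n F D \<longleftrightarrow> D \<in> carrier_mat n n \<and>
     (\<forall>a<n. \<forall>b<n. ((\<lambda>t. F t $$ (a, b)) has_field_derivative D $$ (a, b)) (at 0))"

text \<open>
  \<open>orbit_curve J A g g' \<xi>\<close>: the curve \<open>g\<close> in the general linear group is defined near 0, has
  velocity \<open>g'\<close> at 0, and \<open>g(t) J g(t)\<^sup>-\<^sup>1\<close> passes through \<open>A\<close> at 0 with velocity \<open>\<xi>\<close>.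
\<close>

definition orbit_curve ::
  "complex mat \<Rightarrow> complex mat \<Rightarrow> (complex \<Rightarrow> complex mat) \<Rightarrow> complex mat \<Rightarrow> complex mat \<Rightarrow> bool" where
  "orbit_curve J A g g' \<xi> \<longleftrightarrow>
     (\<forall>\<^sub>F t in nhds 0. g t \<in> GL (dim_row J)) \<and>
     has_mat_deriv0 (dim_row J) g g' \<and>
     conj_by (g 0) J = A \<and>
     has_mat_deriv0 (dim_row J) (\<lambda>t. conj_by (g t) J) \<xi>"

text \<open>
  \<open>kks_form J A \<xi>\<^sub>1 \<xi>\<^sub>2 w\<close>: the form at \<open>A\<close>, evaluated on \<open>\<xi>\<^sub>1\<close>, \<open>\<xi>\<^sub>2\<close>, admits the value \<open>w\<close>.
  This is a relation because a priori the value depends on the curves chosen.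
\<close>

definition kks_form ::
  "complex mat \<Rightarrow> complex mat \<Rightarrow> complex mat \<Rightarrow> complex mat \<Rightarrow> complex \<Rightarrow> bool" where
  "kks_form J A \<xi>1 \<xi>2 w \<longleftrightarrow>
     (\<exists>g1 g1' g2 g2'.
        orbit_curve J A g1 g1' \<xi>1 \<and> orbit_curve J A g2 g2' \<xi>2 \<and> g1 0 = g2 0 \<and>
        w = mat_trace (J * commutator (minv (g1 0) * g1') (minv (g1 0) * g2')))"


section \<open>The sequences attached to a Jordan matrix\<close>

text \<open>
  The Jordan matrix \<open>jordan_matrix n_as\<close> has one Jordan chain of length \<open>m\<close> for the eigenvalue
  \<open>\<mu>\<close> for each member \<open>(m, \<mu>)\<close> of \<open>n_as\<close>.
\<close>

definition chain_lengths :: "(nat \<times> complex) list \<Rightarrow> complex \<Rightarrow> nat list" where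
  "chain_lengths n_as \<mu> = map fst (filter (\<lambda>b. snd b = \<mu>) n_as)"

definition eigenvalue_sequence :: "(nat \<times> complex) list \<Rightarrow> complex list \<Rightarrow> bool" where
  "eigenvalue_sequence n_as lam \<longleftrightarrow>
     set lam = spectrum (jordan_matrix n_as) \<and>
     (\<forall>\<mu>\<in>set lam. count_list lam \<mu> = Max (set (chain_lengths n_as \<mu>)))"

definition chain_counts :: "(nat \<times> complex) list \<Rightarrow> complex list \<Rightarrow> nat list" where
  "chain_counts n_as lam =
     map (\<lambda>k. length (filter (\<lambda>m. count_list (take (Suc k) lam) (lam ! k) \<le> m)
                      (chain_lengths n_as (lam ! k))))
       [0..<length lam]"


section \<open>The parameterization\<close>

text \<open>
  Blocks are numbered from 0, and \<open>ns ! k\<close> is the size of the \<open>k\<close>-th one.  A block matrix with row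
  sizes \<open>rs\<close> and column sizes \<open>cs\<close> is assembled from its blocks \<open>B k l\<close>.
\<close>

definition block_offset :: "nat list \<Rightarrow> nat \<Rightarrow> nat" where
  "block_offset ns k = sum_list (take k ns)"

definition block_of :: "nat list \<Rightarrow> nat \<Rightarrow> nat" where
  "block_of ns a = (LEAST k. a < block_offset ns (Suc k))"

definition block_mat ::
  "nat list \<Rightarrow> nat list \<Rightarrow> (nat \<Rightarrow> nat \<Rightarrow> complex mat) \<Rightarrow> complex mat" where
  "block_mat rs cs B = mat (sum_list rs) (sum_list cs)
     (\<lambda>(a, b). B (block_of rs a) (block_of cs b) $$
        (a - block_offset rs (block_of rs a), b - block_offset cs (block_of cs b)))"

text \<open>The last \<open>m\<close> block rows and block columns.\<close>

definition lower_corner :: "nat list \<Rightarrow> complex mat \<Rightarrow> nat \<Rightarrow> complex mat" where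
  "lower_corner ns A m = (let d = block_offset ns (length ns - m) in
     mat (dim_row A - d) (dim_col A - d) (\<lambda>(a, b). A $$ (d + a, d + b)))"

text \<open>
  A point \<open>(p, q)\<close> consists of the blocks \<open>p (j, i)\<close>, standing for $p_j^i$, and \<open>q (i, j)\<close>,
  standing for $q_i^j$, for \<open>j < i\<close>: the index pair is the block position.
\<close>

type_synonym params = "(nat \<times> nat \<Rightarrow> complex mat) \<times> (nat \<times> nat \<Rightarrow> complex mat)"

definition upper_pos :: "nat list \<Rightarrow> (nat \<times> nat) set" where
  "upper_pos ns = {(j, i). j < i \<and> i < length ns}"

definition lower_pos :: "nat list \<Rightarrow> (nat \<times> nat) set" where
  "lower_pos ns = {(i, j). j < i \<and> i < length ns}"

definition param_space :: "nat list \<Rightarrow> params set" where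
  "param_space ns =
     (\<Pi>\<^sub>E (j, i) \<in> upper_pos ns. carrier_mat (ns ! j) (ns ! i)) \<times>
     (\<Pi>\<^sub>E (i, j) \<in> lower_pos ns. carrier_mat (ns ! i) (ns ! j))"

definition p_coord :: "nat \<Rightarrow> nat \<Rightarrow> nat \<Rightarrow> nat \<Rightarrow> params \<Rightarrow> complex" where
  "p_coord j i s t x = fst x (j, i) $$ (s, t)"

definition q_coord :: "nat \<Rightarrow> nat \<Rightarrow> nat \<Rightarrow> nat \<Rightarrow> params \<Rightarrow> complex" where
  "q_coord i j t s x = snd x (i, j) $$ (t, s)"

definition param_coords :: "nat list \<Rightarrow> (params \<Rightarrow> complex) set" where
  "param_coords ns =
     {p_coord j i s t | j i s t. j < i \<and> i < length ns \<and> s < ns ! j \<and> t < ns ! i} \<union>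
     {q_coord i j t s | j i s t. j < i \<and> i < length ns \<and> s < ns ! j \<and> t < ns ! i}"

definition Q_mat :: "nat list \<Rightarrow> params \<Rightarrow> complex mat" where
  "Q_mat ns x = block_mat ns ns (\<lambda>i j.
     if i = j then 1\<^sub>m (ns ! i)
     else if j < i then snd x (i, j)
     else 0\<^sub>m (ns ! i) (ns ! j))"

definition p_row :: "nat list \<Rightarrow> params \<Rightarrow> nat \<Rightarrow> complex mat" where
  "p_row ns x k = block_mat [ns ! k] (drop (Suc k) ns) (\<lambda>_ l. fst x (k, Suc k + l))"

definition rho_row :: "nat list \<Rightarrow> params \<Rightarrow> nat \<Rightarrow> complex mat" where
  "rho_row ns x k = p_row ns x k * lower_corner ns (Q_mat ns x) (length ns - Suc k)"

definition rho_block :: "nat list \<Rightarrow> params \<Rightarrow> nat \<Rightarrow> nat \<Rightarrow> complex mat" where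
  "rho_block ns x k l = mat (ns ! k) (ns ! l)
     (\<lambda>(s, t). rho_row ns x k $$ (s, block_offset (drop (Suc k) ns) (l - Suc k) + t))"

definition rho_mat :: "nat list \<Rightarrow> complex list \<Rightarrow> params \<Rightarrow> complex mat" where
  "rho_mat ns lam x = block_mat ns ns (\<lambda>k l.
     if k = l then (lam ! k) \<cdot>\<^sub>m 1\<^sub>m (ns ! k)
     else if k < l then rho_block ns x k l
     else 0\<^sub>m (ns ! k) (ns ! l))"

definition param_map :: "nat list \<Rightarrow> complex list \<Rightarrow> params \<Rightarrow> complex mat" where
  "param_map ns lam x = conj_by (Q_mat ns x) (rho_mat ns lam x)"


section \<open>Darboux coordinates\<close>

text \<open>The line \<open>x + t X\<close>; tangent vectors of the parameter space are its elements again.\<close>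

definition param_line :: "nat list \<Rightarrow> params \<Rightarrow> params \<Rightarrow> complex \<Rightarrow> params" where
  "param_line ns x X t =
     (restrict (\<lambda>e. fst x e + t \<cdot>\<^sub>m fst X e) (upper_pos ns),
      restrict (\<lambda>e. snd x e + t \<cdot>\<^sub>m snd X e) (lower_pos ns))"

definition wedge :: "('v \<Rightarrow> complex) \<Rightarrow> ('v \<Rightarrow> complex) \<Rightarrow> 'v \<Rightarrow> 'v \<Rightarrow> complex" where
  "wedge \<alpha> \<beta> X Y = \<alpha> X * \<beta> Y - \<alpha> Y * \<beta> X"

text \<open>The coordinates are linear, so they coincide with their differentials.\<close>

definition canonical_form :: "nat list \<Rightarrow> params \<Rightarrow> params \<Rightarrow> complex" where
  "canonical_form ns X Y =
     (\<Sum>i<length ns. \<Sum>j<i. \<Sum>s<ns ! j. \<Sum>t<ns ! i.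
        wedge (q_coord i j t s) (p_coord j i s t) X Y)"

text \<open>
  The pullback of the form of \<open>orbit J\<close> along \<open>\<Phi>\<close> is the canonical form on \<open>U\<close>; here \<open>\<xi>\<close> and
  \<open>\<eta>\<close> are the images of \<open>X\<close> and \<open>Y\<close> under the differential of \<open>\<Phi>\<close> at \<open>x\<close>.  The equivalence
  says that these vectors are tangent to the orbit, that the value of the form on them does not
  depend on the choice of curves, and what this value is.
\<close>

definition darboux_on :: "complex mat \<Rightarrow> nat list \<Rightarrow> (params \<Rightarrow> complex mat) \<Rightarrow> params set \<Rightarrow> bool" where
  "darboux_on J ns \<Phi> U \<longleftrightarrow>
     (\<forall>x\<in>U. \<forall>X\<in>param_space ns. \<forall>Y\<in>param_space ns. \<exists>\<xi> \<eta>.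
        has_mat_deriv0 (dim_row J) (\<lambda>t. \<Phi> (param_line ns x X t)) \<xi> \<and>
        has_mat_deriv0 (dim_row J) (\<lambda>t. \<Phi> (param_line ns x Y t)) \<eta> \<and>
        (\<forall>w. kks_form J (\<Phi> x) \<xi> \<eta> w \<longleftrightarrow> w = canonical_form ns X Y))"

end

theory Submission
  imports Defs
begin

text \<open>
  Since \<open>\<rho> = Lam + SU (P Q)\<close>, where \<open>P\<close> is the matrix of all blocks \<open>p\<close> and \<open>SU\<close> takes the strictly upper
  block part, the pair \<open>(Q, \<rho>)\<close> is an equivalent set of coordinates.  A block triangular \<open>\<rho>\<close> with
  diagonal \<open>\<lambda>'\<^sub>1, \<dots>, \<lambda>'\<^sub>M\<close> lies in the orbit iff the kernel of \<open>(\<rho> - \<lambda>'\<^sub>1) \<dots> (\<rho> - \<lambda>'\<^sub>k)\<close> is the span of the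
  first \<open>k\<close> blocks for every \<open>k\<close>, which is an open condition.  For \<open>A = Q \<rho> Q\<^sup>-\<^sup>1\<close> the kernels of
  \<open>(A - \<lambda>'\<^sub>1) \<dots> (A - \<lambda>'\<^sub>k)\<close> therefore form a flag in the big cell opposite to the standard flag, and \<open>Q\<close> is
  recovered from this flag by Cramer's rule.  Conversely every point of the orbit with such a flag,
  a dense open set, is reached.  The symplectic form is evaluated on commutators as
  \<open>\<omega>([Z, A], [W, A]) = tr (A [Z, W])\<close>; conjugation by \<open>Q\<close> reduces it to traces of products of \<open>P\<close>, \<open>dP\<close>
  and \<open>Q\<^sup>-\<^sup>1 dQ\<close>.
\<close>

section \<open>Stable range for complex matrices\<close>

text \<open>That the kernels decide membership in the orbit hides the main obstacle: two triangular
  matrices with the same diagonal sequence, whose kernels form the standard flag, must be shown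
  conjugate. The conjugating matrix is extended by one block row at a time; each extension is a
  completion problem for injective block columns, and stable range 1 of the matrix ring is what
  solves it. The linearised problem, solving \<open>[Y, \<rho>] = N\<close> for strictly upper
  \<open>N\<close>, needs only left inverses of the same block columns and supplies the tangent
  vectors for the symplectic form. In the algebra, blocks of unequal sizes are not separate
  matrices: everything stays in one ring of square matrices, blocks are corners cut out by diagonal
  idempotents, and a statement about a kernel is phrased as existence of a left inverse on such a
  corner. Dimension counts thereby turn into the fact that one-sided inverses of square matrices are
  two-sided. Density of the big cell rests on irreducibility of the orbit, inherited from the
  general linear group.\<close>

declare index_mult_mat(1) [simp del]

locale square = fixes n :: nat
begin

abbreviation R :: "complex mat set" where "R \<equiv> carrier_mat n n"
abbreviation I :: "complex mat" where "I \<equiv> 1\<^sub>m n"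
abbreviation Z :: "complex mat" where "Z \<equiv> 0\<^sub>m n n"

lemma closed [simp]:
  "A \<in> R \<Longrightarrow> B \<in> R \<Longrightarrow> A * B \<in> R" "A \<in> R \<Longrightarrow> B \<in> R \<Longrightarrow> A + B \<in> R"
  "A \<in> R \<Longrightarrow> B \<in> R \<Longrightarrow> A - B \<in> R" "A \<in> R \<Longrightarrow> - A \<in> R" "A \<in> R \<Longrightarrow> c \<cdot>\<^sub>m A \<in> R" "I \<in> R" "Z \<in> R"
  by auto

lemma mult_assoc: "A \<in> R \<Longrightarrow> B \<in> R \<Longrightarrow> C \<in> R \<Longrightarrow> A * B * C = A * (B * C)"
  by (rule assoc_mult_mat)

text \<open>A relation \<open>A * B = D\<close> does not match inside a product nested to the right,
  the normal form produced by \<open>mult_assoc\<close>; this variant carries the trailing factor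
  \<open>C\<close> along, and its instances are the computation rules of the later ring
  calculations.\<close>

lemma assoc_eq: "A * B = D \<Longrightarrow> A \<in> R \<Longrightarrow> B \<in> R \<Longrightarrow> C \<in> R \<Longrightarrow> A * (B * C) = D * C"
  by (metis mult_assoc)

lemma distribs:
  "A \<in> R \<Longrightarrow> B \<in> R \<Longrightarrow> C \<in> R \<Longrightarrow> (A + B) * C = A * C + B * C"
  "A \<in> R \<Longrightarrow> B \<in> R \<Longrightarrow> C \<in> R \<Longrightarrow> C * (A + B) = C * A + C * B"
  "A \<in> R \<Longrightarrow> B \<in> R \<Longrightarrow> C \<in> R \<Longrightarrow> (A - B) * C = A * C - B * C"
  "A \<in> R \<Longrightarrow> B \<in> R \<Longrightarrow> C \<in> R \<Longrightarrow> C * (A - B) = C * A - C * B"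
  "A \<in> R \<Longrightarrow> C \<in> R \<Longrightarrow> (c \<cdot>\<^sub>m A) * C = c \<cdot>\<^sub>m (A * C)"
  "A \<in> R \<Longrightarrow> C \<in> R \<Longrightarrow> C * (c \<cdot>\<^sub>m A) = c \<cdot>\<^sub>m (C * A)"
  by (auto simp: add_mult_distrib_mat mult_add_distrib_mat minus_mult_distrib_mat mult_minus_distrib_mat
      mult_smult_distrib mult_smult_assoc_mat)

lemma units [simp]: "A \<in> R \<Longrightarrow> I * A = A" "A \<in> R \<Longrightarrow> A * I = A"
  "A \<in> R \<Longrightarrow> Z * A = Z" "A \<in> R \<Longrightarrow> A * Z = Z" "A \<in> R \<Longrightarrow> A + Z = A" "A \<in> R \<Longrightarrow> Z + A = A"
  "A \<in> R \<Longrightarrow> A - Z = A" "A \<in> R \<Longrightarrow> A - A = Z" "c \<cdot>\<^sub>m Z = Z"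
  by auto

lemma add_eqI:
  assumes "A \<in> R" "B \<in> R" "\<And>i j. i < n \<Longrightarrow> j < n \<Longrightarrow> A $$ (i,j) = B $$ (i,j)"
  shows "A = B"
  using assms by (intro eq_matI) auto

lemma entries:
  "A \<in> R \<Longrightarrow> B \<in> R \<Longrightarrow> i < n \<Longrightarrow> j < n \<Longrightarrow> (A + B) $$ (i,j) = A $$ (i,j) + B $$ (i,j)"
  "A \<in> R \<Longrightarrow> B \<in> R \<Longrightarrow> i < n \<Longrightarrow> j < n \<Longrightarrow> (A - B) $$ (i,j) = A $$ (i,j) - B $$ (i,j)"
  "A \<in> R \<Longrightarrow> i < n \<Longrightarrow> j < n \<Longrightarrow> (c \<cdot>\<^sub>m A) $$ (i,j) = c * A $$ (i,j)"
  "i < n \<Longrightarrow> j < n \<Longrightarrow> Z $$ (i,j) = 0"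
  by auto

lemma cancels [simp]:
  "A \<in> R \<Longrightarrow> B \<in> R \<Longrightarrow> A + (B - A) = B" "A \<in> R \<Longrightarrow> B \<in> R \<Longrightarrow> A - (A - B) = B"
  "A \<in> R \<Longrightarrow> B \<in> R \<Longrightarrow> A + B - B = A" "A \<in> R \<Longrightarrow> B \<in> R \<Longrightarrow> A - B + B = A"
  by (auto intro!: add_eqI simp: entries)

lemma eq_diffI: "A + B = C \<Longrightarrow> A \<in> R \<Longrightarrow> B \<in> R \<Longrightarrow> A = C - B"
  by (auto intro!: add_eqI simp: entries)

lemmas ring_simps = mult_assoc distribs

definition unit_pair :: "complex mat \<Rightarrow> complex mat \<Rightarrow> bool" where
  "unit_pair u v \<longleftrightarrow> u \<in> R \<and> v \<in> R \<and> u * v = I \<and> v * u = I"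

lemma right_inverse_unit: "u \<in> R \<Longrightarrow> v \<in> R \<Longrightarrow> u * v = I \<Longrightarrow> unit_pair u v"
  unfolding unit_pair_def using mat_mult_left_right_inverse by blast

lemma unit_pair_mult:
  assumes "unit_pair u u'" "unit_pair v v'" shows "unit_pair (u * v) (v' * u')"
proof -
  have [simp]: "u \<in> R" "v \<in> R" "u' \<in> R" "v' \<in> R" "u * u' = I" "v * v' = I"
    using assms by (auto simp: unit_pair_def)
  show ?thesis by (rule right_inverse_unit) (simp_all add: mult_assoc assoc_eq[of v v' I])
qed

text \<open>Von Neumann regularity with an invertible quasi-inverse \<open>u\<close>. It encodes a
  rank normal form, since \<open>u * A\<close> is then an idempotent.\<close>

definition unit_regular :: "complex mat \<Rightarrow> bool" where
  "unit_regular A \<longleftrightarrow> (\<exists>u v. unit_pair u v \<and> A * u * A = A)"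

text \<open>Row and column operations are harmless: a quasi-inverse \<open>u\<close> of
  \<open>p * A * k\<close> yields the quasi-inverse \<open>k * u * p\<close> of
  \<open>A\<close>.\<close>

lemma unit_regular_equiv:
  assumes "unit_pair p p'" "unit_pair k k'" "unit_regular (p * A * k)" "A \<in> R"
  shows "unit_regular A"
proof -
  obtain u v where uv: "unit_pair u v" and eq: "p * A * k * u * (p * A * k) = p * A * k"
    using assms(3) by (auto simp: unit_regular_def)
  have [simp]: "p \<in> R" "p' \<in> R" "k \<in> R" "k' \<in> R" "A \<in> R" "u \<in> R" "v \<in> R"
    and pk: "p' * p = I" "k * k' = I"
    using assms uv by (auto simp: unit_pair_def)
  have "A * (k * u * p) * A = p' * (p * A * k * u * (p * A * k)) * k'"
    by (simp add: mult_assoc pk assoc_eq[OF pk(1)] assoc_eq[OF pk(2)])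
  also have "\<dots> = A"
    unfolding eq by (simp add: mult_assoc pk assoc_eq[OF pk(1)] assoc_eq[OF pk(2)])
  finally have "A * (k * u * p) * A = A" .
  moreover have "unit_pair (k * u * p) (p' * (v * k'))"
    using unit_pair_mult[OF unit_pair_mult[OF assms(2) uv] assms(1)] .
  ultimately show ?thesis unfolding unit_regular_def by blast
qed

end

lemma mat_1_1: "(A :: 'a mat) \<in> carrier_mat 1 1 \<Longrightarrow> A = mat 1 1 (\<lambda>_. A $$ (0,0))"
  by (rule eq_matI) auto

lemma uminus_add_eq_minus_mat:
  "X \<in> carrier_mat a b \<Longrightarrow> Y \<in> carrier_mat a b \<Longrightarrow> - X + Y = Y - (X :: complex mat)"
  by (rule eq_matI) auto

text \<open>Gaussian elimination as an induction on the size: two swaps bring a nonzero entry to the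
  corner, block transvections clear its row and column, and what remains is the Schur complement
  \<open>d'\<close>, which the induction hypothesis covers.\<close>

theorem square_unit_regular:
  "A \<in> carrier_mat n n \<Longrightarrow> square.unit_regular n A"
proof (induction n arbitrary: A)
  case 0
  interpret square 0 .
  show ?case unfolding unit_regular_def unit_pair_def
    by (intro exI[of _ "1\<^sub>m 0"]) (use 0 in auto)
next
  case (Suc m)
  interpret S: square "Suc m" .
  interpret m: square m .
  note block_mult = mult_four_block_mat[where ?nr1.0=1 and ?nr2.0=m and ?n1.0=1 and ?n2.0=m
      and ?nc1.0=1 and ?nc2.0=m]
  show ?case
  proof (cases "A = 0\<^sub>m (Suc m) (Suc m)")
    case True
    show ?thesis unfolding S.unit_regular_def S.unit_pair_def
      by (intro exI[of _ "1\<^sub>m (Suc m)"]) (use Suc(2) True in auto)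
  next
    case False
    then obtain i j where ij: "i < Suc m" "j < Suc m" "A $$ (i,j) \<noteq> 0"
      using Suc(2) by (metis carrier_matD eq_matI index_zero_mat)
    define s where "s k = (swaprows_mat (Suc m) 0 k :: complex mat)" for k
    have sR: "s k \<in> S.R" for k by (simp add: s_def)
    have su: "S.unit_pair (s k) (s k)" if "k < Suc m" for k
      using that by (auto simp: S.unit_pair_def s_def swaprows_mat_inv)
    define B where "B = s i * A * s j"
    have BR: "B \<in> S.R" using Suc(2) sR by (auto simp: B_def)
    have "B = swapcols 0 j (swaprows 0 i A)"
      unfolding B_def s_def using Suc(2) ij
      by (simp add: swaprows_mat[of A "Suc m" "Suc m"] swapcols_mat[of _ "Suc m" "Suc m"])
    then have B0: "B $$ (0,0) \<noteq> 0" using ij Suc(2) by auto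
    obtain a b c d where sp: "split_block B 1 1 = (a,b,c,d)" by (metis prod_cases4)
    have blk: "a \<in> carrier_mat 1 1" "b \<in> carrier_mat 1 m" "c \<in> carrier_mat m 1" "d \<in> carrier_mat m m"
      and B: "B = four_block_mat a b c d"
      using split_block[OF sp, of m m] BR by auto
    define \<alpha> where "\<alpha> = B $$ (0,0)"
    have a: "a = mat 1 1 (\<lambda>_. \<alpha>)"
      using mat_1_1[OF blk(1)] blk unfolding \<alpha>_def B by (auto simp: four_block_mat_def)
    define e where "e = mat 1 1 (\<lambda>_. inverse \<alpha>)"
    have eC: "e \<in> carrier_mat 1 1" by (simp add: e_def)
    have ae: "a * e = 1\<^sub>m 1" "e * a = 1\<^sub>m 1"
      using B0 by (auto intro!: eq_matI simp: a e_def index_mult_mat(1) scalar_prod_def \<alpha>_def)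
    define d' where "d' = d - c * e * b"
    have d'R: "d' \<in> carrier_mat m m" using blk eC by (auto simp: d'_def intro!: minus_carrier_mat)
    define l where "l x = four_block_mat (1\<^sub>m 1) (0\<^sub>m 1 m) x (1\<^sub>m m)" for x :: "complex mat"
    define r where "r x = four_block_mat (1\<^sub>m 1) x (0\<^sub>m m 1) (1\<^sub>m m)" for x :: "complex mat"
    have lR: "l x \<in> S.R" "r x \<in> S.R" for x unfolding l_def r_def by auto
    have lu: "S.unit_pair (l x) (l (- x))" if "x \<in> carrier_mat m 1" for x
    proof (rule S.right_inverse_unit[OF lR(1) lR(1)])
      show "l x * l (- x) = 1\<^sub>m (Suc m)" unfolding l_def
        by (subst block_mult)
          (use that in \<open>auto simp: add_uminus_minus_mat uminus_l_inv_mat intro!: eq_matI simp del: index_mult_mat(1)\<close>)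
    qed
    have ru: "S.unit_pair (r x) (r (- x))" if "x \<in> carrier_mat 1 m" for x
    proof (rule S.right_inverse_unit[OF lR(2) lR(2)])
      show "r x * r (- x) = 1\<^sub>m (Suc m)" unfolding r_def
        by (subst block_mult)
          (use that in \<open>auto simp: add_uminus_minus_mat uminus_l_inv_mat intro!: eq_matI simp del: index_mult_mat(1)\<close>)
    qed
    obtain u v where uv: "m.unit_pair u v" and d'u: "d' * u * d' = d'"
      using Suc(1)[OF d'R] by (auto simp: m.unit_regular_def)
    have uvR: "u \<in> carrier_mat m m" "v \<in> carrier_mat m m" "u * v = 1\<^sub>m m" "v * u = 1\<^sub>m m"
      using uv by (auto simp: m.unit_pair_def)
    define C where "C = four_block_mat a (0\<^sub>m 1 m) (0\<^sub>m m 1) d'"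
    have CR: "C \<in> S.R" using blk d'R by (auto simp: C_def)
    have C: "l (- (c * e)) * B * r (- (e * b)) = C"
    proof -
      have ce: "c * e \<in> carrier_mat m 1" "e * b \<in> carrier_mat 1 m" using blk eC by auto
      have 1: "c * e * a = c" "a * (e * b) = b"
        unfolding assoc_mult_mat[OF blk(3) eC blk(1)] assoc_mult_mat[OF blk(1) eC blk(2), symmetric] ae
        using blk by simp_all
      have neg: "- (c * e) * a = - (c * e * a)" "- (c * e) * b = - (c * e * b)" "a * - (e * b) = - (a * (e * b))"
        by (rule uminus_mult_left_mat uminus_mult_right_mat, use blk eC in simp)+
      have ceb: "c * e * b \<in> carrier_mat m m" by (rule mult_carrier_mat[OF ce(1) blk(2)])
      have "- (c * e * b) + d = d'"
        unfolding d'_def by (rule uminus_add_eq_minus_mat[OF ceb blk(4)])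
      then have 2: "- (c * e) * a + 1\<^sub>m m * c = 0\<^sub>m m 1" "- (c * e) * b + 1\<^sub>m m * d = d'"
        unfolding neg 1 using blk by simp_all
      have 3: "a * - (e * b) + b * 1\<^sub>m m = 0\<^sub>m 1 m"
        unfolding neg 1 using blk by simp
      have z: "0\<^sub>m m 1 * - (e * b) = 0\<^sub>m m m"
        by (rule left_mult_zero_mat[of _ _ m]) (use ce in simp)
      have "l (- (c * e)) * B = four_block_mat (1\<^sub>m 1 * a + 0\<^sub>m 1 m * c) (1\<^sub>m 1 * b + 0\<^sub>m 1 m * d)
          (- (c * e) * a + 1\<^sub>m m * c) (- (c * e) * b + 1\<^sub>m m * d)"
        unfolding l_def B
        by (rule block_mult)
          (use blk ce in auto)
      also have "\<dots> = four_block_mat a b (0\<^sub>m m 1) d'"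
        unfolding 2 using blk by simp
      finally have "l (- (c * e)) * B = four_block_mat a b (0\<^sub>m m 1) d'" .
      moreover have "four_block_mat a b (0\<^sub>m m 1) d' * r (- (e * b)) =
          four_block_mat (a * 1\<^sub>m 1 + b * 0\<^sub>m m 1) (a * - (e * b) + b * 1\<^sub>m m)
            (0\<^sub>m m 1 * 1\<^sub>m 1 + d' * 0\<^sub>m m 1) (0\<^sub>m m 1 * - (e * b) + d' * 1\<^sub>m m)"
        unfolding r_def
        by (rule block_mult)
          (use blk ce d'R in auto)
      moreover have "\<dots> = C"
        unfolding 3 C_def z using blk d'R by simp
      ultimately show ?thesis by (simp only:)
    qed
    have regC: "S.unit_regular C" unfolding S.unit_regular_def
    proof (intro exI conjI)
      \<comment> \<open>The two diagonal blocks are treated separately: \<open>e\<close> inverts the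
        pivot, \<open>u\<close> comes from the induction hypothesis.\<close>
      let ?u = "four_block_mat e (0\<^sub>m 1 m) (0\<^sub>m m 1) u"
      have "?u * four_block_mat a (0\<^sub>m 1 m) (0\<^sub>m m 1) v = four_block_mat (e * a + 0\<^sub>m 1 m * 0\<^sub>m m 1) (e * 0\<^sub>m 1 m + 0\<^sub>m 1 m * v)
          (0\<^sub>m m 1 * a + u * 0\<^sub>m m 1) (0\<^sub>m m 1 * 0\<^sub>m 1 m + u * v)"
        by (rule block_mult)
          (use blk eC uvR d'R in auto)
      also have "\<dots> = 1\<^sub>m (Suc m)" using blk eC uvR ae by simp
      finally have uv1: "?u * four_block_mat a (0\<^sub>m 1 m) (0\<^sub>m m 1) v = 1\<^sub>m (Suc m)" .
      show "S.unit_pair ?u (four_block_mat a (0\<^sub>m 1 m) (0\<^sub>m m 1) v)"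
        by (rule S.right_inverse_unit[OF _ _ uv1]) (use blk eC uvR in auto)
      have "C * ?u = four_block_mat (a * e + 0\<^sub>m 1 m * 0\<^sub>m m 1) (a * 0\<^sub>m 1 m + 0\<^sub>m 1 m * u)
          (0\<^sub>m m 1 * e + d' * 0\<^sub>m m 1) (0\<^sub>m m 1 * 0\<^sub>m 1 m + d' * u)"
        unfolding C_def by (rule block_mult)
          (use blk eC uvR d'R in auto)
      also have "\<dots> = four_block_mat (1\<^sub>m 1) (0\<^sub>m 1 m) (0\<^sub>m m 1) (d' * u)"
        using blk eC uvR ae d'R by simp
      finally have Cu: "C * ?u = four_block_mat (1\<^sub>m 1) (0\<^sub>m 1 m) (0\<^sub>m m 1) (d' * u)" .
      have "C * ?u * C = four_block_mat (1\<^sub>m 1 * a + 0\<^sub>m 1 m * 0\<^sub>m m 1) (1\<^sub>m 1 * 0\<^sub>m 1 m + 0\<^sub>m 1 m * d')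
          (0\<^sub>m m 1 * a + (d' * u) * 0\<^sub>m m 1) (0\<^sub>m m 1 * 0\<^sub>m 1 m + (d' * u) * d')"
        unfolding Cu unfolding C_def by (rule block_mult)
          (use blk eC uvR d'R in auto)
      also have "\<dots> = C"
        unfolding C_def using blk eC uvR d'R d'u by simp
      finally show "C * ?u * C = C" .
    qed
    have "S.unit_regular B"
    proof (rule S.unit_regular_equiv[OF lu ru _ BR])
      show "- (c * e) \<in> carrier_mat m 1" "- (e * b) \<in> carrier_mat 1 m" using blk eC by auto
      show "S.unit_regular (l (- (c * e)) * B * r (- (e * b)))" using regC by (simp only: C)
    qed
    then show ?thesis
      unfolding B_def by (rule S.unit_regular_equiv[OF su[OF ij(1)] su[OF ij(2)] _ Suc(2)])
  qed
qed

context square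
begin

text \<open>Unit regularity implies stable range 1: with \<open>a = a v a\<close> and \<open>f = 1 - v a\<close> one has \<open>b f = f\<close>, so
  \<open>v a + f b = 1 + f b v a\<close>, whose last summand squares to zero.\<close>

lemma stable_range:
  assumes [simp]: "x \<in> R" "a \<in> R" "b \<in> R" and xab: "x * a + b = I"
  obtains y w where "y \<in> R" "unit_pair (a + y * b) w"
proof -
  obtain v v' where vv: "unit_pair v v'" and ava: "a * v * a = a"
    using square_unit_regular[of a n] by (auto simp: unit_regular_def)
  have [simp]: "v \<in> R" "v' \<in> R" and v: "v * v' = I" "v' * v = I" using vv by (auto simp: unit_pair_def)
  have ava': "a * (v * a) = a" using ava by (simp add: mult_assoc)
  define e where "e = v * a"
  define f where "f = I - e"
  have [simp]: "e \<in> R" "f \<in> R" by (simp_all add: e_def f_def)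
  have b: "b = I - x * a" unfolding xab[symmetric] by (rule add_eqI) (simp_all add: entries)
  have ee: "e * e = e" by (simp add: e_def mult_assoc ava')
  have ef: "e * f = Z" "f * e = Z" "f * f = f" by (simp_all add: f_def ring_simps ee)
  have af: "a * f = Z" by (simp add: f_def e_def ring_simps ava')
  have bf: "b * f = f" by (simp add: b ring_simps af)
  define N where "N = f * b * e"
  have [simp]: "N \<in> R" by (simp add: N_def)
  have NN: "N * N = Z" by (simp add: N_def mult_assoc assoc_eq[OF ef(1)])
  have "f * b = f * b * (e + f)"
    using cancels(1)[of e I] by (simp add: f_def[symmetric])
  also have "\<dots> = N + f" by (simp add: N_def ring_simps bf ef)
  finally have fb: "f * b = N + f" .
  \<comment> \<open>Multiplying \<open>v * a + f * b\<close> by \<open>v'\<close> restores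
    \<open>a\<close>, because \<open>v' * v = I\<close>; the element sought is thus
    \<open>y = v' * f\<close>.\<close>
  have "a + v' * f * b = v' * (I + N)"
  proof -
    have "I + N = e + f * b"
      unfolding fb by (simp add: f_def) (rule add_eqI, simp_all add: entries)
    then have "v' * (I + N) = v' * (e + f * b)" by simp
    also have "\<dots> = a + v' * f * b" by (simp add: e_def ring_simps assoc_eq[OF v(2)])
    finally show ?thesis by simp
  qed
  moreover have "unit_pair (I + N) (I - N)"
    by (rule right_inverse_unit) (simp_all add: ring_simps NN)
  ultimately have "unit_pair (a + (v' * f) * b) ((I - N) * v)"
    using unit_pair_mult[of v' v] vv by (auto simp: unit_pair_def)
  then show ?thesis using that[of "v' * f"] by simp
qed

text \<open>In block notation: if the columns \<open>(r, z)\<close> and \<open>(r', z)\<close> are both injective, then some invertible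
  \<open>(G, H; 0, 1)\<close> maps the second to the first.  Replacing \<open>L1'\<close> by \<open>f L1'\<close> with \<open>f = E - u z\<close>,
  \<open>z u z = z\<close>, makes \<open>z L1' = 0\<close>; then \<open>r L1'\<close> and \<open>S - r' L1'\<close> are comaximal and stable range yields \<open>G\<close>.\<close>

lemma corner_completion:
  assumes R [simp]: "S \<in> R" "E \<in> R" "r \<in> R" "r' \<in> R" "z \<in> R" "L1 \<in> R" "L2 \<in> R" "L1' \<in> R" "L2' \<in> R"
    and S: "S * S = S" and r: "S * r = r" "r * E = r" and r': "S * r' = r'" "r' * E = r'"
    and z: "E * z = z" "z * E = z"
    and L: "L1 * r + L2 * z = E" and L': "L1' * r' + L2' * z = E"
  obtains G W H where "G \<in> R" "W \<in> R" "H \<in> R" "G * W = S" "W * G = S" "S * G = G" "G * S = G"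
    "S * W = W" "W * S = W" "S * H = H" "H * E = H" "G * r' + H * z = r"
proof -
  obtain u u' where u: "unit_pair u u'" and zuz: "z * u * z = z"
    using square_unit_regular[of z n] by (auto simp: unit_regular_def)
  have [simp]: "u \<in> R" using u by (auto simp: unit_pair_def)
  have zuz': "z * (u * z) = z" using zuz by (simp add: mult_assoc)
  define f where "f = E - u * z"
  have [simp]: "f \<in> R" by (simp add: f_def)
  have EE: "E * E = E"
  proof -
    have "E = L1 * (r * E) + L2 * (z * E)" by (simp only: r z L)
    also have "\<dots> = (L1 * r + L2 * z) * E" by (simp add: ring_simps)
    finally have "E * E = E" by (simp only: L)
    then show ?thesis .
  qed
  then have fE: "f * E = f" by (simp add: f_def ring_simps z)
  have zf: "z * f = Z" by (simp add: f_def ring_simps z zuz')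
  \<comment> \<open>\<open>k\<close> and \<open>m\<close> are the adjusted pair in place of
    \<open>L1'\<close> and \<open>L2'\<close>: still a left inverse of the second column, now with
    \<open>z * k = Z\<close>.\<close>
  define k where "k = f * L1' * S"
  define m where "m = f * L2' + u"
  have [simp]: "k \<in> R" "m \<in> R" by (simp_all add: k_def m_def)
  have kr': "k * r' = E - m * z"
  proof -
    have "k * r' + m * z = f * (L1' * r' + L2' * z) + u * z"
      by (simp add: k_def m_def ring_simps r' assoc_eq[OF r'(1)], rule add_eqI, simp_all add: entries)
    also have "\<dots> = E" unfolding L' fE unfolding f_def by (rule add_eqI) (simp_all add: entries)
    finally show ?thesis by (rule eq_diffI) simp_all
  qed
  have zk: "z * k = Z" by (simp add: k_def mult_assoc assoc_eq[OF zf])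
  have kS: "k * S = k" by (simp add: k_def mult_assoc S)
  define G0 where "G0 = r * k"
  define b where "b = S - r' * k"
  \<comment> \<open>Comaximality is wanted in the corner cut out by \<open>S\<close>, while stable
    range is available for full matrices; the summand \<open>I - S\<close> fills up the complement
    of the corner.\<close>
  define x where "x = r' * L1 * S + (I - S)"
  have [simp]: "G0 \<in> R" "b \<in> R" "x \<in> R" by (simp_all add: G0_def b_def x_def)
  have G0S: "S * G0 = G0" "G0 * S = G0" by (simp_all add: G0_def mult_assoc assoc_eq[OF r(1)] kS)
  have bS: "S * b = b" "b * S = b" by (simp_all add: b_def ring_simps assoc_eq[OF r'(1)] S kS)
  have Lr: "L1 * r = E - L2 * z" unfolding L[symmetric] by (rule add_eqI) (simp_all add: entries)
  have "x * (G0 + (I - S)) = r' * (L1 * r) * k + (I - S)"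
    by (simp add: x_def G0_def ring_simps S assoc_eq[OF S] assoc_eq[OF r(1)], rule add_eqI, simp_all add: entries)
  also have "r' * (L1 * r) * k = r' * k"
    unfolding Lr by (simp add: ring_simps zk assoc_eq[OF r'(2)])
  finally have "x * (G0 + (I - S)) + b = I"
    unfolding b_def by (simp, intro add_eqI) (simp_all add: entries)
  then obtain y w where y [simp]: "y \<in> R" and w: "unit_pair (G0 + (I - S) + y * b) w"
    by (rule stable_range[rotated 3]) auto
  have [simp]: "w \<in> R" and ww: "(G0 + (I - S) + y * b) * w = I" using w by (auto simp: unit_pair_def)
  define G where "G = G0 + S * y * b"
  define W where "W = S * w * S"
  \<comment> \<open>\<open>kr'\<close> expresses both \<open>G0 * r'\<close> and
    \<open>b * r'\<close> through \<open>m * z\<close>; \<open>H\<close> compensates the terms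
    containing \<open>m * z\<close>, so that \<open>G * r' + H * z\<close> comes out as
    \<open>r\<close>.\<close>
  define H where "H = (r - S * y * r') * m * E"
  have [simp]: "G \<in> R" "W \<in> R" "H \<in> R" by (simp_all add: G_def W_def H_def)
  have GS: "S * G = G" "G * S = G"
    by (simp_all add: G_def ring_simps G0S bS assoc_eq[OF S])
  have WS: "S * W = W" "W * S = W" by (simp_all add: W_def mult_assoc S assoc_eq[OF S])
  have "G * w = S * ((G0 + (I - S) + y * b) * w)"
    by (simp add: G_def ring_simps assoc_eq[OF S] assoc_eq[OF G0S(1)])
  then have Gw: "G * w = S" by (simp add: ww)
  have GW: "G * W = S" by (simp add: W_def mult_assoc assoc_eq[OF GS(2)] assoc_eq[OF Gw] S)
  \<comment> \<open>\<open>G * W = S\<close> is one-sided so far. Adding \<open>I - S\<close> to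
    both factors gives full matrices, for which a right inverse is also a left inverse.\<close>
  have "unit_pair (G + (I - S)) (W + (I - S))"
    by (rule right_inverse_unit)
       (simp_all add: ring_simps GW GS WS S, rule add_eqI, simp_all add: entries)
  then have "(W + (I - S)) * (G + (I - S)) = I" by (simp add: unit_pair_def)
  then have "S * ((W + (I - S)) * (G + (I - S))) = S" by simp
  then have WG: "W * G = S" by (simp add: ring_simps GS WS S assoc_eq[OF WS(1)])
  have br': "b * r' = r' * (m * z)"
    by (simp add: b_def ring_simps kr' r')
  have "G0 * r' = r - r * (m * z)" by (simp add: G0_def ring_simps kr' r)
  then have "G * r' + H * z = r"
    by (simp add: G_def H_def ring_simps z br') (rule add_eqI, simp_all add: entries)
  moreover have "S * H = H" "H * E = H"
    by (simp_all add: H_def ring_simps EE assoc_eq[OF S] assoc_eq[OF r(1)])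
  ultimately show ?thesis using that[of G W H] GS WS GW WG by simp
qed

end

section \<open>Block triangular matrices and flags\<close>

context square
begin

definition proj :: "(nat \<Rightarrow> bool) \<Rightarrow> complex mat" where
  "proj P = mat n n (\<lambda>(a, b). if a = b \<and> P a then 1 else 0)"

lemma proj_closed [simp]: "proj P \<in> R" by (simp add: proj_def)

lemma proj_entry: "a < n \<Longrightarrow> b < n \<Longrightarrow> proj P $$ (a, b) = (if a = b \<and> P a then 1 else 0)"
  by (simp add: proj_def)

lemma mult_entry: "A \<in> R \<Longrightarrow> B \<in> R \<Longrightarrow> a < n \<Longrightarrow> b < n \<Longrightarrow> (A * B) $$ (a, b) = (\<Sum>c<n. A $$ (a, c) * B $$ (c, b))"
  by (auto simp: index_mult_mat(1) scalar_prod_def lessThan_atLeast0 intro!: sum.cong)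

lemma proj_mult_entry:
  assumes "A \<in> R" "a < n" "b < n"
  shows "(proj P * A) $$ (a, b) = (if P a then A $$ (a, b) else 0)"
    and "(A * proj P) $$ (a, b) = (if P b then A $$ (a, b) else 0)"
proof -
  have "(proj P * A) $$ (a, b) = (\<Sum>c<n. if c = a then if P a then A $$ (a, b) else 0 else 0)"
    unfolding mult_entry[OF proj_closed assms(1-3)] mult_entry[OF assms(1) proj_closed assms(2,3)]
    by (rule sum.cong) (use assms in \<open>auto simp: proj_entry\<close>)
  then show "(proj P * A) $$ (a, b) = (if P a then A $$ (a, b) else 0)" using assms by simp
  have "(A * proj P) $$ (a, b) = (\<Sum>c<n. if c = b then if P b then A $$ (a, b) else 0 else 0)"
    unfolding mult_entry[OF proj_closed assms(1-3)] mult_entry[OF assms(1) proj_closed assms(2,3)]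
    by (rule sum.cong) (use assms in \<open>auto simp: proj_entry\<close>)
  then show "(A * proj P) $$ (a, b) = (if P b then A $$ (a, b) else 0)" using assms by simp
qed

lemma proj_mult: "proj P * proj Q = proj (\<lambda>a. P a \<and> Q a)"
  by (rule add_eqI) (auto simp: proj_mult_entry proj_entry)

lemma proj_trivial [simp]: "proj (\<lambda>a. False) = Z" "proj (\<lambda>a. True) = I"
  by (auto intro!: add_eqI simp: proj_entry)

end

section \<open>Coordinate flags and generic triangular matrices\<close>

locale flag = square n for n +
  fixes bl :: "nat \<Rightarrow> nat" and M :: nat and lam :: "nat \<Rightarrow> complex"
  assumes bl_less: "a < n \<Longrightarrow> bl a < M"
    and bl_mono: "a \<le> b \<Longrightarrow> b < n \<Longrightarrow> bl a \<le> bl b"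
begin

abbreviation D where "D k \<equiv> proj (\<lambda>a. bl a < k)"
abbreviation E where "E k \<equiv> proj (\<lambda>a. k \<le> bl a)"
abbreviation S where "S k \<equiv> proj (\<lambda>a. bl a = k)"

lemma proj_bounds: "E 0 = I" "D 0 = Z" "E M = Z" "D M = I"
  using bl_less by (auto intro!: add_eqI simp: proj_entry simp flip: not_less)

lemma DE: "D k + E k = I" "S k + E (Suc k) = E k" "D k + S k = D (Suc k)"
  by (auto intro!: add_eqI simp: proj_entry entries)

lemma DE_mult: "D k * D k = D k" "E k * E k = E k" "S k * S k = S k"
  "D k * E k = Z" "E k * D k = Z" "S k * E (Suc k) = Z" "E (Suc k) * S k = Z" "E k * S k = S k" "S k * E k = S k"
  "E k * E (Suc k) = E (Suc k)" "E (Suc k) * E k = E (Suc k)" "D k * D (Suc k) = D k" "D (Suc k) * D k = D k"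
  "S k * D k = Z" "D k * S k = Z" "D (Suc k) * S k = S k" "S k * D (Suc k) = S k"
  by (auto intro!: add_eqI simp: proj_mult proj_entry)

lemma split_left: "A \<in> R \<Longrightarrow> D k * A + E k * A = A"
  and split_right: "A \<in> R \<Longrightarrow> A * D k + A * E k = A"
  by (simp_all add: DE flip: distribs)

lemma right_E: "A \<in> R \<Longrightarrow> A * D k = Z \<Longrightarrow> A * E k = A"
  using split_right[of A k] by simp

definition sh :: "complex mat \<Rightarrow> nat \<Rightarrow> complex mat" where
  "sh A k = A - lam k \<cdot>\<^sub>m I"

lemma sh_closed [simp]: "A \<in> R \<Longrightarrow> sh A k \<in> R" by (simp add: sh_def)

lemma sh_mult: "A \<in> R \<Longrightarrow> B \<in> R \<Longrightarrow> sh A k * B = A * B - lam k \<cdot>\<^sub>m B"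
  "A \<in> R \<Longrightarrow> B \<in> R \<Longrightarrow> B * sh A k = B * A - lam k \<cdot>\<^sub>m B"
  by (simp_all add: sh_def ring_simps)

fun pp :: "complex mat \<Rightarrow> nat \<Rightarrow> complex mat" where
  "pp A 0 = I"
| "pp A (Suc k) = pp A k * sh A k"

lemma pp_closed [simp]: "A \<in> R \<Longrightarrow> pp A k \<in> R" by (induction k) auto

lemma sh_commute: "A \<in> R \<Longrightarrow> sh A j * sh A k = sh A k * sh A j"
  by (simp add: sh_def ring_simps) (rule add_eqI, simp_all add: entries algebra_simps)

lemma pp_commute:
  assumes [simp]: "A \<in> R" shows "pp A k * sh A j = sh A j * pp A k"
proof (induction k)
  case (Suc k)
  have "pp A (Suc k) * sh A j = pp A k * sh A j * sh A k"
    by (simp add: mult_assoc sh_commute[of A k j])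
  also have "\<dots> = sh A j * pp A (Suc k)" unfolding Suc by (simp add: mult_assoc)
  finally show ?case .
qed simp

lemma sh_conj:
  assumes "unit_pair u v" "A \<in> R" shows "sh (u * A * v) k = u * sh A k * v"
  using assms by (simp add: sh_def ring_simps unit_pair_def)

lemma pp_conj:
  assumes "unit_pair u v" and [simp]: "A \<in> R" shows "pp (u * A * v) k = u * pp A k * v"
proof -
  have [simp]: "u \<in> R" "v \<in> R" and uv: "u * v = I" "v * u = I" using assms by (auto simp: unit_pair_def)
  show ?thesis
  proof (induction k)
    case (Suc k)
    show ?case unfolding pp.simps Suc sh_conj[OF assms] by (simp add: mult_assoc assoc_eq[OF uv(2)])
  qed (simp add: uv)
qed

text \<open>Block upper triangular with diagonal blocks \<open>lam k\<close>: \<open>\<rho> - lam k\<close> maps the span of the blocks up to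
  \<open>k\<close> into the span of the blocks before \<open>k\<close>.\<close>

definition triangular :: "complex mat \<Rightarrow> bool" where
  "triangular \<rho> \<longleftrightarrow> \<rho> \<in> R \<and> (\<forall>k<M. E k * sh \<rho> k * D (Suc k) = Z)"

text \<open>The rectangle of rows from block \<open>k\<close> on and columns up to block
  \<open>k\<close> touches the block diagonal in block \<open>k\<close> only; over all
  \<open>k\<close> these rectangles cover everything on and below the block diagonal.\<close>

lemma triangular_iff_entries:
  "triangular \<rho> \<longleftrightarrow> \<rho> \<in> R \<and> (\<forall>a<n. \<forall>b<n. bl b \<le> bl a \<longrightarrow> \<rho> $$ (a, b) = (if a = b then lam (bl a) else 0))"
proof (cases "\<rho> \<in> R")
  case True
  have "E k * sh \<rho> k * D (Suc k) = Z \<longleftrightarrow> (\<forall>a<n. \<forall>b<n. k \<le> bl a \<and> bl b < Suc k \<longrightarrow> \<rho> $$ (a, b) = (if a = b then lam k else 0))" for k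
  proof -
    have "E k * sh \<rho> k * D (Suc k) = Z \<longleftrightarrow> (\<forall>a<n. \<forall>b<n. (E k * sh \<rho> k * D (Suc k)) $$ (a, b) = 0)"
      using True by (auto intro!: add_eqI simp: entries)
    then show ?thesis using True by (auto simp: proj_mult_entry sh_def entries)
  qed
  then have "triangular \<rho> \<longleftrightarrow> (\<forall>k<M. \<forall>a<n. \<forall>b<n. k \<le> bl a \<and> bl b < Suc k \<longrightarrow> \<rho> $$ (a, b) = (if a = b then lam k else 0))"
    using True by (simp add: triangular_def)
  also have "\<dots> \<longleftrightarrow> (\<forall>a<n. \<forall>b<n. bl b \<le> bl a \<longrightarrow> \<rho> $$ (a, b) = (if a = b then lam (bl a) else 0))"
    (is "?l = ?r")
  proof
    assume ?l
    then show ?r using bl_less by (metis less_Suc_eq_le order_refl)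
  next
    assume r: ?r
    show ?l
    proof (intro allI impI)
      fix k a b assume *: "a < n" "b < n" "k \<le> bl a \<and> bl b < Suc k"
      then have "bl b \<le> bl a" "a = b \<Longrightarrow> bl a = k" by auto
      with r * show "\<rho> $$ (a, b) = (if a = b then lam k else 0)" by metis
    qed
  qed
  finally show ?thesis by (simp only: True simp_thms)
qed (simp add: triangular_def)

lemma triangular_closed [simp]: "triangular \<rho> \<Longrightarrow> \<rho> \<in> R" by (simp add: triangular_def)

lemma triangular_shift: "triangular \<rho> \<Longrightarrow> k < M \<Longrightarrow> E k * sh \<rho> k * E (Suc k) = E k * sh \<rho> k"
  by (rule right_E) (simp_all add: triangular_def)

lemma triangular_entry: "triangular \<rho> \<Longrightarrow> a < n \<Longrightarrow> b < n \<Longrightarrow> bl b \<le> bl a \<Longrightarrow> \<rho> $$ (a, b) = (if a = b then lam (bl a) else 0)"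
  unfolding triangular_iff_entries by blast

lemma triangular_diag: assumes "triangular \<rho>" "k < M"
  shows "S k * \<rho> * S k = lam k \<cdot>\<^sub>m S k" "E (Suc k) * \<rho> * S k = Z"
  using triangular_closed[OF assms(1)] by (auto intro!: add_eqI simp: triangular_entry[OF assms(1)] proj_mult_entry proj_entry entries)

text \<open>Induction along the flag: the factor \<open>sh \<rho> k\<close> pushes the first
  \<open>Suc k\<close> blocks into the first \<open>k\<close>, which the earlier factors
  annihilate.\<close>

lemma triangular_pp: assumes "triangular \<rho>" "k \<le> M" shows "pp \<rho> k * D k = Z" "pp \<rho> k * E k = pp \<rho> k"
proof -
  have [simp]: "\<rho> \<in> R" using assms by simp
  have "k \<le> M \<Longrightarrow> pp \<rho> k * D k = Z" for k
  proof (induction k)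
    case (Suc k)
    have "pp \<rho> (Suc k) * D (Suc k) = (pp \<rho> k * D k + pp \<rho> k * E k) * sh \<rho> k * D (Suc k)"
      by (simp add: split_right)
    also have "\<dots> = pp \<rho> k * (E k * sh \<rho> k * D (Suc k))"
      using Suc by (simp add: ring_simps)
    finally show ?case using Suc(2) assms(1) by (simp add: triangular_def)
  qed (simp add: proj_bounds)
  then show "pp \<rho> k * D k = Z" using assms by simp
  then show "pp \<rho> k * E k = pp \<rho> k" by (simp add: right_E)
qed

text \<open>The kernel of \<open>pp \<rho> k\<close> is exactly the span of the first \<open>k\<close> blocks.\<close>

definition generic :: "complex mat \<Rightarrow> bool" where
  "generic \<rho> \<longleftrightarrow> triangular \<rho> \<and> (\<forall>k\<le>M. \<exists>C\<in>R. C * pp \<rho> k = E k)"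

text \<open>A left inverse of \<open>pp \<rho> (Suc k)\<close> factors through
  \<open>pp \<rho> k\<close>, which sees only the blocks from \<open>k\<close> on. Hence
  \<open>\<rho> - lam k\<close>, restricted to these rows, is injective on the blocks after
  \<open>k\<close>.\<close>

lemma generic_step: assumes "generic \<rho>" "k < M" obtains L where "L \<in> R" "L * (E k * sh \<rho> k) = E (Suc k)"
proof -
  have "Suc k \<le> M" using assms by simp
  then obtain C where C: "C \<in> R" "C * pp \<rho> (Suc k) = E (Suc k)"
    using assms(1) unfolding generic_def by blast
  have [simp]: "\<rho> \<in> R" and P: "pp \<rho> k * E k = pp \<rho> k" using assms triangular_pp[of \<rho> k] by (auto simp: generic_def)
  have "(C * pp \<rho> k) * (E k * sh \<rho> k) = C * ((pp \<rho> k * E k) * sh \<rho> k)"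
    using C by (simp add: mult_assoc)
  then have "(C * pp \<rho> k) * (E k * sh \<rho> k) = E (Suc k)" using C by (simp add: P)
  then show ?thesis using C by (intro that[of "C * pp \<rho> k"]) simp_all
qed

text \<open>Left inverses for the single factors compose to left inverses of the products, so
  genericity can be verified by inspecting one shift at a time.\<close>

lemma genericI: assumes "triangular \<rho>" and L: "\<And>k. k < M \<Longrightarrow> \<exists>L\<in>R. L * (E k * sh \<rho> k) = E (Suc k)"
  shows "generic \<rho>"
proof -
  have [simp]: "\<rho> \<in> R" using assms by simp
  have "k \<le> M \<Longrightarrow> \<exists>C\<in>R. C * pp \<rho> k = E k" for k
  proof (induction k)
    case (Suc k)
    then obtain C where C: "C \<in> R" "C * pp \<rho> k = E k" by (auto dest: Suc_leD)
    obtain L where L: "L \<in> R" "L * (E k * sh \<rho> k) = E (Suc k)" using L[of k] Suc(2) by auto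
    have "(L * C) * pp \<rho> (Suc k) = E (Suc k)"
      using C L by (simp add: mult_assoc assoc_eq[OF C(2)])
    then show ?case using C L by (intro bexI[of _ "L * C"]) simp_all
  qed (auto simp: proj_bounds intro!: bexI[of _ I])
  then show ?thesis unfolding generic_def using assms(1) by blast
qed

lemma mult_zeroI:
  assumes "X * P = X" "Q * Y = Y" "P * Q = Z" "X \<in> R" "Y \<in> R" "P \<in> R" "Q \<in> R"
  shows "X * Y = Z"
  by (subst assms(1)[symmetric], subst assms(2)[symmetric])
    (use assms(4-7) in \<open>simp add: mult_assoc assoc_eq[OF assms(3)]\<close>)

text \<open>Adding \<open>D k\<close> completes the two corner elements to full matrices, for which
  one-sided inverses are two-sided. This is the form in which dimension counts enter below.\<close>

lemma corner_inverse_commute: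
  assumes [simp]: "X \<in> R" "Y \<in> R" and X: "E k * X = X" "X * E k = X" and Y: "E k * Y = Y" "Y * E k = Y"
    and XY: "X * Y = E k"
  shows "Y * X = E k"
proof -
  have D: "D k * Y = Z" "X * D k = Z" "D k * X = Z" "Y * D k = Z"
    by (rule mult_zeroI[of _ "D k" "E k"] mult_zeroI[of _ "E k" "D k"]; simp add: X Y DE_mult; fail)+
  have "unit_pair (X + D k) (Y + D k)"
    by (rule right_inverse_unit) (simp_all add: ring_simps XY D DE_mult DE comm_add_mat[of "E k" n n "D k"])
  then have "(Y + D k) * (X + D k) = I" by (simp add: unit_pair_def)
  then have "E k * ((Y + D k) * (X + D k)) = E k" by simp
  then show ?thesis by (simp add: ring_simps D DE_mult assoc_eq[OF Y(1)] assoc_eq[OF DE_mult(5)])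
qed

text \<open>Triangularity puts the first \<open>k\<close> blocks into the kernel of
  \<open>pp \<rho> k\<close>, and similarity gives that kernel the dimension it has for
  \<open>\<rho>0\<close>, so it cannot be larger. The count takes the form of a relation
  \<open>X * Y = E k\<close> in the corner, turned around to \<open>Y * X = E k\<close>.\<close>

lemma generic_similar:
  assumes "generic \<rho>0" "triangular \<rho>" "unit_pair g g'" "\<rho> = g * \<rho>0 * g'"
  shows "generic \<rho>"
  unfolding generic_def
proof (intro conjI allI impI assms)
  fix k assume k: "k \<le> M"
  have [simp]: "\<rho>0 \<in> R" "\<rho> \<in> R" "g \<in> R" "g' \<in> R" and gg: "g * g' = I" "g' * g = I"
    using assms by (auto simp: generic_def unit_pair_def)
  obtain C where C [simp]: "C \<in> R" and CP: "C * pp \<rho>0 k = E k" using assms k by (auto simp: generic_def)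
  have P: "pp \<rho> k * E k = pp \<rho> k" and P0: "pp \<rho>0 k * E k = pp \<rho>0 k"
    using triangular_pp(2) assms k by (auto simp: generic_def)
  have pp: "pp \<rho> k = g * pp \<rho>0 k * g'" using pp_conj[OF assms(3)] by (simp add: assms(4))
  define X where "X = E k * C * g' * pp \<rho> k"
  define Y where "Y = E k * g * E k"
  have [simp]: "X \<in> R" "Y \<in> R" by (simp_all add: X_def Y_def)
  have "C * g' * pp \<rho> k * g = E k" by (simp add: pp mult_assoc gg assoc_eq[OF gg(2)] CP)
  then have "E k * C * g' * (pp \<rho> k * E k) * g * E k = E k"
    unfolding P by (simp add: mult_assoc DE_mult)
  then have "X * Y = E k" by (simp add: X_def Y_def mult_assoc assoc_eq[OF DE_mult(2)] assoc_eq[OF P])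
  then have "Y * X = E k"
    by (rule corner_inverse_commute[rotated 6])
       (simp_all add: X_def Y_def mult_assoc P DE_mult assoc_eq[OF DE_mult(2)])
  then show "\<exists>C\<in>R. C * pp \<rho> k = E k"
    by (intro bexI[of _ "Y * (E k * C * g')"]) (simp_all add: X_def mult_assoc)
qed

text \<open>The conjugating matrix is built block row by block row from the bottom; \<open>h\<close> is its part in the
  blocks from \<open>j\<close> on.\<close>

lemma generic_conjugate:
  assumes g: "generic \<rho>" and g': "generic \<rho>'"
  obtains h h' where "unit_pair h h'" "h * \<rho>' = \<rho> * h"
proof -
  have triangular: "triangular \<rho>" "triangular \<rho>'" and [simp]: "\<rho> \<in> R" "\<rho>' \<in> R" using g g' by (auto simp: generic_def)
  have "\<exists>h h'. h \<in> R \<and> h' \<in> R \<and> E j * h = h \<and> h * E j = h \<and> E j * h' = h' \<and> h' * E j = h' \<and>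
      h * h' = E j \<and> h' * h = E j \<and> h * \<rho>' = E j * \<rho> * h" if "j \<le> M" for j
    using that
  proof (induction j rule: inc_induct)
    case base
    show ?case by (intro exI[of _ Z]) (simp add: proj_bounds)
  next
    case (step j)
    then obtain h h' where [simp]: "h \<in> R" "h' \<in> R"
      and h: "E (Suc j) * h = h" "h * E (Suc j) = h" and h': "E (Suc j) * h' = h'" "h' * E (Suc j) = h'"
      and hh: "h * h' = E (Suc j)" "h' * h = E (Suc j)" and h\<rho>: "h * \<rho>' = E (Suc j) * \<rho> * h" by blast
    define T where "T = S j"
    define F where "F = E (Suc j)"
    have [simp]: "T \<in> R" "F \<in> R" by (simp_all add: T_def F_def)
    have TF: "T * T = T" "F * F = F" "T * F = Z" "F * T = Z" "E j = T + F"
      by (simp_all add: T_def F_def DE_mult DE)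
    note h = h[folded F_def] and h' = h'[folded F_def] and hh = hh[folded F_def] and h\<rho> = h\<rho>[folded F_def]
    have sE: "(T + F) * sh \<sigma> j * F = (T + F) * sh \<sigma> j" if "triangular \<sigma>" for \<sigma>
      using triangular_shift[OF that step(2)] by (simp add: TF F_def)
    have TFs: "T * sh \<sigma> j * F = T * sh \<sigma> j" "F * sh \<sigma> j * F = F * sh \<sigma> j" if "triangular \<sigma>" for \<sigma>
    proof -
      have "T * ((T + F) * sh \<sigma> j * F) = T * ((T + F) * sh \<sigma> j)" "F * ((T + F) * sh \<sigma> j * F) = F * ((T + F) * sh \<sigma> j)"
        using sE[OF that] by simp_all
      then show "T * sh \<sigma> j * F = T * sh \<sigma> j" "F * sh \<sigma> j * F = F * sh \<sigma> j"
        using triangular_closed[OF that]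
        by (simp_all add: ring_simps assoc_eq[OF TF(1)] assoc_eq[OF TF(2)] assoc_eq[OF TF(3)] assoc_eq[OF TF(4)])
    qed
    have Th: "T * h = Z" by (subst h(1)[symmetric]) (simp add: assoc_eq[OF TF(3)])
    \<comment> \<open>\<open>r\<close> and \<open>r'\<close> are block row \<open>j\<close> of the
      two shifted matrices, the first already multiplied by \<open>h\<close>; \<open>z\<close>
      consists of the rows below. The equation \<open>G * r' + H * z = r\<close> is the intertwining
      condition in block row \<open>j\<close>.\<close>
    define r where "r = T * sh \<rho> j * h"
    define r' where "r' = T * sh \<rho>' j"
    define z where "z = F * sh \<rho>' j"
    have [simp]: "r \<in> R" "r' \<in> R" "z \<in> R" by (simp_all add: r_def r'_def z_def)
    have r: "T * r = r" "r * F = r" "T * r' = r'" "r' * F = r'" "F * z = z" "z * F = z"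
      using TFs[OF triangular(2)]
      by (simp_all add: r_def r'_def z_def mult_assoc h assoc_eq[OF TF(1)] assoc_eq[OF TF(2)])
    \<comment> \<open>Through \<open>h\<close> the lower rows of the shifted \<open>\<rho>\<close>
      become a left multiple of the same \<open>z\<close>, so that both columns share their lower
      part, as \<open>corner_completion\<close> requires.\<close>
    have hz: "F * sh \<rho> j * h = h * z"
    proof -
      have "h * z = h * \<rho>' - lam j \<cdot>\<^sub>m h"
        unfolding z_def assoc_eq[OF h(2) \<open>h \<in> R\<close> \<open>F \<in> R\<close> sh_closed[OF \<open>\<rho>' \<in> R\<close>]] by (simp add: sh_mult)
      also have "\<dots> = F * (sh \<rho> j * h)" by (simp add: h\<rho> sh_mult ring_simps h)
      finally show ?thesis by (simp add: mult_assoc)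
    qed
    obtain L where L [simp]: "L \<in> R" and LE: "L * ((T + F) * sh \<rho> j) = F"
      using generic_step[OF g step(2)] by (auto simp: TF F_def)
    obtain L' where L' [simp]: "L' \<in> R" and LE': "L' * ((T + F) * sh \<rho>' j) = F"
      using generic_step[OF g' step(2)] by (auto simp: TF F_def)
    have l': "L' * r' + L' * z = F" using LE' by (simp add: r'_def z_def ring_simps)
    have "L * r + L * (h * z) = L * ((T + F) * sh \<rho> j) * h"
      unfolding hz[symmetric] by (simp add: r_def ring_simps)
    also have "\<dots> = h" by (simp add: LE h)
    finally have "h' * (L * r + L * (h * z)) = F" by (simp add: hh)
    then have l: "(h' * L) * r + (h' * L * h) * z = F" by (simp add: ring_simps)
    obtain G W H where [simp]: "G \<in> R" "W \<in> R" "H \<in> R" and GW: "G * W = T" "W * G = T" "T * G = G" "G * T = G"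
      "T * W = W" "W * T = W" "T * H = H" "H * F = H" and eq: "G * r' + H * z = r"
      by (rule corner_completion[OF _ _ _ _ _ _ _ _ _ TF(1) r l l']) simp_all
    have zero: "G * h = Z" "G * h' = Z" "W * h = Z" "W * h' = Z" "H * G = Z" "H * W = Z" "H * H = Z"
        "h * G = Z" "h * W = Z" "h * H = Z" "h' * G = Z" "h' * H = Z" "h' * W = Z" "G * F = Z" "W * F = Z"
    proof -
      show "G * h = Z" "G * h' = Z" "W * h = Z" "W * h' = Z"
        by (rule mult_zeroI[of _ T F]; simp add: GW h h' TF)+
      show "H * G = Z" "H * W = Z" "H * H = Z" "h * G = Z" "h * W = Z" "h * H = Z" "h' * G = Z" "h' * H = Z" "h' * W = Z"
        by (rule mult_zeroI[of _ F T]; simp add: GW h h' TF)+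
      show "G * F = Z" "W * F = Z"
        by (rule mult_zeroI[of _ T F]; simp add: GW TF)+
    qed
    \<comment> \<open>In block form \<open>k\<close> is (G, H; 0, h), and \<open>k'\<close> is its
      inverse (W, -W H h'; 0, h').\<close>
    define k where "k = G + H + h"
    define k' where "k' = W - W * H * h' + h'"
    have [simp]: "k \<in> R" "k' \<in> R" by (simp_all add: k_def k'_def)
    have kE: "E j * k = k" "k * E j = k" "E j * k' = k'" "k' * E j = k'"
    proof -
      have F: "F * G = Z" "F * W = Z" "F * H = Z" "T * h' = Z" "H * T = Z" "h * T = Z" "h' * T = Z"
        by ((rule mult_zeroI[of _ F T] mult_zeroI[of _ T F]; simp add: GW h h' TF; fail)+)
      show "E j * k = k" "k * E j = k" "E j * k' = k'" "k' * E j = k'"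
        by (simp_all add: k_def k'_def TF ring_simps GW zero h h' F Th assoc_eq[OF GW(5)] assoc_eq[OF F(2)])
          (rule add_eqI; simp add: entries)+
    qed
    have "k * k' = E j"
      by (simp add: k_def k'_def TF ring_simps GW zero hh assoc_eq[OF GW(1)] assoc_eq[OF GW(7)]
          assoc_eq[OF zero(6)] assoc_eq[OF zero(9)]) (rule add_eqI, simp_all add: entries)
    moreover have "k' * k = E j"
      by (simp add: k_def k'_def TF ring_simps GW zero hh) (rule add_eqI, simp_all add: entries)
    moreover have "k * \<rho>' = E j * \<rho> * k"
    proof -
      have 1: "G * r' = G * \<rho>' - lam j \<cdot>\<^sub>m G"
        unfolding r'_def assoc_eq[OF GW(4) \<open>G \<in> R\<close> \<open>T \<in> R\<close> sh_closed[OF \<open>\<rho>' \<in> R\<close>]] by (simp add: sh_mult)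
      have 2: "H * z = H * \<rho>' - lam j \<cdot>\<^sub>m H"
        unfolding z_def assoc_eq[OF GW(8) \<open>H \<in> R\<close> \<open>F \<in> R\<close> sh_closed[OF \<open>\<rho>' \<in> R\<close>]] by (simp add: sh_mult)
      have 3: "r = T * \<rho> * h" by (simp add: r_def mult_assoc sh_mult ring_simps Th)
      have T\<rho>: "T * \<rho> * X = lam j \<cdot>\<^sub>m X" "F * \<rho> * X = Z" if "T * X = X" "X \<in> R" for X
      proof -
        have "T * \<rho> * T = lam j \<cdot>\<^sub>m T" "F * \<rho> * T = Z" using triangular_diag[OF triangular(1) step(2)] by (simp_all add: T_def F_def)
        then have "T * \<rho> * T * X = lam j \<cdot>\<^sub>m X" "F * \<rho> * T * X = Z" using that by (simp_all add: ring_simps)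
        then show "T * \<rho> * X = lam j \<cdot>\<^sub>m X" "F * \<rho> * X = Z" using that by (simp_all add: mult_assoc)
      qed
      have "k * \<rho>' = G * \<rho>' + H * \<rho>' + F * \<rho> * h" by (simp add: k_def ring_simps h\<rho>)
      also have "G * \<rho>' + H * \<rho>' = r + lam j \<cdot>\<^sub>m G + lam j \<cdot>\<^sub>m H"
        unfolding eq[symmetric] 1 2 by (rule add_eqI) (simp_all add: entries)
      also have "\<dots> + F * \<rho> * h = (T + F) * \<rho> * k"
        unfolding 3 k_def using T\<rho>[OF GW(3)] T\<rho>[OF GW(7)]
        by (simp add: ring_simps) (rule add_eqI, simp_all add: entries)
      finally show ?thesis by (simp add: TF)
    qed
    ultimately show ?case using kE by (intro exI[of _ k] exI[of _ k']) simp
  qed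
  from this[of 0] show ?thesis using that unfolding unit_pair_def by (auto simp: proj_bounds)
qed

text \<open>The linearisation of \<open>generic_conjugate\<close>: bracketing with
  \<open>\<rho>\<close> maps block upper matrices, diagonal blocks included, onto all strictly upper
  ones. From the bottom upwards, the equation for block row \<open>j\<close> has the form
  \<open>T * sh \<rho> j = B\<close> with \<open>B\<close> known, and the left inverse from
  \<open>generic_step\<close> solves it.\<close>

lemma commutator_solvable:
  assumes g: "generic \<rho>" and [simp]: "N \<in> R" and N: "\<And>j. E j * N * D (Suc j) = Z"
  obtains Y where "Y \<in> R" "\<And>j. E j * Y * D j = Z" "Y * \<rho> - \<rho> * Y = N"
proof -
  have triangular: "triangular \<rho>" and [simp]: "\<rho> \<in> R" using g by (auto simp: generic_def)
  have "\<exists>Y. Y \<in> R \<and> E j * Y = Y \<and> (\<forall>i. E i * Y * D i = Z) \<and> Y * \<rho> = E j * \<rho> * Y + E j * N" if "j \<le> M" for j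
    using that
  proof (induction j rule: inc_induct)
    case base
    show ?case by (intro exI[of _ Z]) (simp add: proj_bounds)
  next
    case (step j)
    from step(3) obtain Y where [simp]: "Y \<in> R" and Y: "E (Suc j) * Y = Y" "\<And>i. E i * Y * D i = Z"
      and Y\<rho>: "Y * \<rho> = E (Suc j) * \<rho> * Y + E (Suc j) * N" by blast
    obtain L where L [simp]: "L \<in> R" and LE: "L * (E j * sh \<rho> j) = E (Suc j)"
      using generic_step[OF g step(2)] by auto
    \<comment> \<open>The right hand side for block row \<open>j\<close> once the lower rows are
      known. Its columns up to block \<open>j\<close> vanish, which is why the left inverse
      \<open>L\<close> solves the equation exactly.\<close>
    define B where "B = S j * (\<rho> * Y + N)"
    define T where "T = B * L * E j"
    have [simp]: "B \<in> R" "T \<in> R" by (simp_all add: B_def T_def)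
    have ST: "S j * B = B" "S j * T = T" by (simp_all add: T_def B_def mult_assoc assoc_eq[OF DE_mult(3)])
    have "S j * \<rho> * (Y * D (Suc j)) = S j * \<rho> * (E (Suc j) * Y * D (Suc j))"
      unfolding Y(1) by simp
    then have 1: "S j * \<rho> * (Y * D (Suc j)) = Z" by (simp add: Y(2))
    have "S j * N * D (Suc j) = S j * (E j * N * D (Suc j))" by (simp add: mult_assoc assoc_eq[OF DE_mult(9)])
    then have 2: "S j * N * D (Suc j) = Z" by (simp add: N)
    have "B * D (Suc j) = Z" using 1 2 by (simp add: B_def ring_simps)
    then have BE: "B * E (Suc j) = B" by (rule right_E[rotated]) simp
    have "T * sh \<rho> j = B" by (simp add: T_def mult_assoc LE BE)
    then have "B + lam j \<cdot>\<^sub>m T = T * \<rho> - lam j \<cdot>\<^sub>m T + lam j \<cdot>\<^sub>m T"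
      by (simp only: sh_mult \<open>T \<in> R\<close> \<open>\<rho> \<in> R\<close>)
    then have T\<rho>: "T * \<rho> = B + lam j \<cdot>\<^sub>m T" by simp
    have "S j * \<rho> * S j * T = lam j \<cdot>\<^sub>m S j * T" "E (Suc j) * \<rho> * S j * T = Z * T"
      using triangular_diag[OF triangular step(2)] by simp_all
    then have 3: "S j * (\<rho> * T) = lam j \<cdot>\<^sub>m T" "E (Suc j) * (\<rho> * T) = Z"
      by (simp_all add: ring_simps ST)
    have "S j * Y = S j * (E (Suc j) * Y)" by (simp add: Y)
    then have SY: "S j * Y = Z" by (simp add: assoc_eq[OF DE_mult(6)])
    have "E j * (Y + T) = Y + T"
    proof -
      have "E j * (E (Suc j) * Y) = E (Suc j) * Y" "E j * (S j * T) = S j * T"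
        by (simp_all add: assoc_eq[OF DE_mult(10)] assoc_eq[OF DE_mult(8)])
      then show ?thesis by (simp add: ring_simps Y ST)
    qed
    moreover have "E i * (Y + T) * D i = Z" for i
    proof (cases "i \<le> j")
      case True
      have "E j * D i = Z" using True by (auto intro!: add_eqI simp: proj_mult proj_entry)
      then have "T * D i = Z" by (simp add: T_def mult_assoc)
      then show ?thesis using Y(2)[of i] by (simp add: ring_simps)
    next
      case False
      have "E i * S j = Z" using False by (auto intro!: add_eqI simp: proj_mult proj_entry)
      then have "E i * (S j * T) = Z" by (simp add: assoc_eq)
      then show ?thesis using Y(2)[of i] by (simp add: ring_simps ST assoc_eq[of "E i" T Z])
    qed
    moreover have "(Y + T) * \<rho> = E j * \<rho> * (Y + T) + E j * N"
      unfolding DE(2)[of j, symmetric]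
      unfolding distribs(1)[OF \<open>Y \<in> R\<close> \<open>T \<in> R\<close> \<open>\<rho> \<in> R\<close>] Y\<rho> T\<rho>
      by (simp add: ring_simps 3 B_def) (rule add_eqI, simp_all add: entries)
    ultimately show ?case by (intro exI[of _ "Y + T"]) simp
  qed
  from this[of 0] obtain Y where Y: "Y \<in> R" "\<And>i. E i * Y * D i = Z" and "Y * \<rho> = E 0 * \<rho> * Y + E 0 * N"
    by blast
  then have Y\<rho>: "Y * \<rho> = \<rho> * Y + N" by (simp only: proj_bounds units \<open>\<rho> \<in> R\<close> \<open>N \<in> R\<close>)
  have "Y * \<rho> - \<rho> * Y = N"
    unfolding Y\<rho> using Y(1) by (intro add_eqI) (simp_all add: entries)
  then show ?thesis using that Y by blast
qed

end

section \<open>The flag of a Jordan matrix\<close>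

lemma block_offset_0 [simp]: "block_offset ns 0 = 0" by (simp add: block_offset_def)

lemma block_offset_Suc: "k < length ns \<Longrightarrow> block_offset ns (Suc k) = block_offset ns k + ns ! k"
  by (simp add: block_offset_def take_Suc_conv_app_nth)

lemma block_offset_length: "length ns \<le> k \<Longrightarrow> block_offset ns k = sum_list ns"
  by (simp add: block_offset_def)

lemma block_offset_mono: "i \<le> k \<Longrightarrow> block_offset ns i \<le> block_offset ns k"
proof (induction k rule: dec_induct)
  case (step k)
  then show ?case
    by (cases "k < length ns") (auto simp: block_offset_Suc block_offset_length)
qed simp

lemma block_of_bounds:
  assumes "a < sum_list ns"
  shows "block_of ns a < length ns" "block_offset ns (block_of ns a) \<le> a"
    "a < block_offset ns (Suc (block_of ns a))"
proof -
  let ?P = "\<lambda>k. a < block_offset ns (Suc k)"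
  have "ns \<noteq> []" using assms by auto
  then have P: "?P (length ns - 1)" using assms by (simp add: block_offset_length)
  show 1: "?P (block_of ns a)" unfolding block_of_def by (rule LeastI[of ?P, OF P])
  have "block_of ns a \<le> length ns - 1" unfolding block_of_def by (rule Least_le[of ?P, OF P])
  then show "block_of ns a < length ns" using \<open>ns \<noteq> []\<close> by (cases ns) auto
  show "block_offset ns (block_of ns a) \<le> a"
  proof (cases "block_of ns a")
    case (Suc k)
    then have "\<not> ?P k" unfolding block_of_def using not_less_Least[of k ?P] by simp
    then show ?thesis using Suc by simp
  qed simp
qed

lemma block_of_eqI:
  assumes "block_offset ns k \<le> a" "a < block_offset ns (Suc k)"
  shows "block_of ns a = k"
  unfolding block_of_def
proof (rule Least_equality)
  fix j assume "a < block_offset ns (Suc j)"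
  then show "k \<le> j" using assms block_offset_mono[of "Suc j" k ns] by force
qed (rule assms)

lemma block_of_offset: "k < length ns \<Longrightarrow> s < ns ! k \<Longrightarrow> block_of ns (block_offset ns k + s) = k"
  by (rule block_of_eqI) (auto simp: block_offset_Suc)

lemma offset_less: "k < length ns \<Longrightarrow> s < ns ! k \<Longrightarrow> block_offset ns k + s < sum_list ns"
  using block_offset_mono[of "Suc k" "length ns" ns] by (simp add: block_offset_Suc block_offset_length)

lemma block_of_mono: "a \<le> b \<Longrightarrow> b < sum_list ns \<Longrightarrow> block_of ns a \<le> block_of ns b"
  using block_of_bounds[of a ns] block_of_bounds[of b ns] block_offset_mono[of "Suc (block_of ns b)" "block_of ns a" ns]
  by force

lemma block_rest: "a < sum_list ns \<Longrightarrow> a - block_offset ns (block_of ns a) < ns ! block_of ns a"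
  using block_of_bounds[of a ns] by (simp add: block_offset_Suc)

lemma card_block: "k < length ns \<Longrightarrow> card {a. a < sum_list ns \<and> block_of ns a = k} = ns ! k"
proof -
  assume k: "k < length ns"
  have "{a. a < sum_list ns \<and> block_of ns a = k} = {block_offset ns k ..< block_offset ns (Suc k)}"
  proof (intro subset_antisym subsetI)
    fix a assume "a \<in> {a. a < sum_list ns \<and> block_of ns a = k}"
    then show "a \<in> {block_offset ns k ..< block_offset ns (Suc k)}" using block_of_bounds[of a ns] by auto
  next
    fix a assume a: "a \<in> {block_offset ns k ..< block_offset ns (Suc k)}"
    then have "a < sum_list ns"
      using block_offset_mono[of "Suc k" "length ns" ns] k by (simp add: block_offset_length)
    then show "a \<in> {a. a < sum_list ns \<and> block_of ns a = k}" using a block_of_eqI[of ns k a] by simp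
  qed
  then show ?thesis by (simp add: block_offset_Suc[OF k])
qed

lemma sum_blocks:
  "(\<Sum>a<sum_list ns. f a) = (\<Sum>k<length ns. \<Sum>s<ns ! k. f (block_offset ns k + s))"
proof -
  have "m \<le> length ns \<Longrightarrow> (\<Sum>a<block_offset ns m. f a) = (\<Sum>k<m. \<Sum>s<ns ! k. f (block_offset ns k + s))" for m
  proof (induction m)
    case (Suc m)
    have "(\<Sum>a<block_offset ns m + c. f a) = (\<Sum>a<block_offset ns m. f a) + (\<Sum>s<c. f (block_offset ns m + s))" for c
      by (induction c) (simp_all add: add.assoc)
    then show ?case using Suc by (simp add: block_offset_Suc)
  qed simp
  from this[of "length ns"] show ?thesis by (simp add: block_offset_length)
qed

text \<open>Used to sort the Jordan basis by blocks: bijections of the fibres are chosen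
  independently and glued along \<open>f\<close>.\<close>

lemma bij_betw_fibres:
  assumes "finite A" "finite B"
    and card: "\<And>k. card {a \<in> A. f a = k} = card {b \<in> B. g b = k}"
  obtains \<tau> where "bij_betw \<tau> A B" "\<And>a. a \<in> A \<Longrightarrow> g (\<tau> a) = f a"
proof -
  have "\<exists>h. bij_betw h {a \<in> A. f a = k} {b \<in> B. g b = k}" for k
    using card assms(1,2) by (intro finite_same_card_bij) auto
  then obtain h where h: "\<And>k. bij_betw (h k) {a \<in> A. f a = k} {b \<in> B. g b = k}" by metis
  define \<tau> where "\<tau> a = h (f a) a" for a
  have \<tau>: "\<tau> a \<in> B" "g (\<tau> a) = f a" if "a \<in> A" for a
    using bij_betwE[OF h[of "f a"]] that by (auto simp: \<tau>_def)
  have "bij_betw \<tau> A B"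
  proof (rule bij_betwI')
    fix x y assume xy: "x \<in> A" "y \<in> A"
    show "(\<tau> x = \<tau> y) = (x = y)"
    proof
      assume eq: "\<tau> x = \<tau> y"
      then have f: "f x = f y" using \<tau> xy by metis
      then show "x = y" using eq xy bij_betw_imp_inj_on[OF h[of "f x"]]
        unfolding \<tau>_def inj_on_def by auto
    qed simp
  next
    fix b assume b: "b \<in> B"
    then have "b \<in> h (g b) ` {a \<in> A. f a = g b}" using bij_betw_imp_surj_on[OF h[of "g b"]] by auto
    then obtain a where "a \<in> A" "f a = g b" "b = h (g b) a" by blast
    then show "\<exists>a\<in>A. b = \<tau> a" unfolding \<tau>_def by metis
  qed (use \<tau> in auto)
  then show ?thesis using \<tau> that by blast
qed

section \<open>Numbered occurrences of an eigenvalue and positions in Jordan chains\<close>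

lemma count_list_take_Suc:
  "k < length xs \<Longrightarrow> count_list (take (Suc k) xs) x = count_list (take k xs) x + (if xs ! k = x then 1 else 0)"
  by (simp add: take_Suc_conv_app_nth)

lemma count_list_take_mono: "i \<le> k \<Longrightarrow> count_list (take i xs) x \<le> count_list (take k xs) x"
proof (induction k rule: dec_induct)
  case (step k)
  then show ?case by (cases "k < length xs") (auto simp: count_list_take_Suc)
qed simp

lemma count_list_take_strict:
  "i < k \<Longrightarrow> i < length xs \<Longrightarrow> xs ! i = x \<Longrightarrow> count_list (take i xs) x < count_list (take k xs) x"
  using count_list_take_mono[of "Suc i" k xs x] by (simp add: count_list_take_Suc)

lemma ex_occurrence:
  "j < count_list xs x \<Longrightarrow> \<exists>k<length xs. xs ! k = x \<and> count_list (take k xs) x = j"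
proof (induction xs rule: rev_induct)
  case (snoc y ys)
  show ?case
  proof (cases "j < count_list ys x")
    case True
    then obtain k where "k < length ys" "ys ! k = x" "count_list (take k ys) x = j" using snoc by blast
    then show ?thesis by (intro exI[of _ k]) (auto simp: nth_append)
  next
    case False
    then show ?thesis using snoc(2) by (intro exI[of _ "length ys"]) (auto split: if_splits)
  qed
qed simp

text \<open>Forgets the recursive block structure: \<open>\<mu> a\<close> is the eigenvalue at index
  \<open>a\<close>, and \<open>pos a\<close> its place in the chain, counted from 0. The last item
  is the count of the conjugate partition: a chain reaches position \<open>j\<close> exactly if it
  is longer than \<open>j\<close>.\<close>

lemma jordan_matrix_positions:
  obtains \<mu> pos where
    "\<And>a b. a < sum_list (map fst n_as) \<Longrightarrow> b < sum_list (map fst n_as) \<Longrightarrow>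
      jordan_matrix n_as $$ (a, b) = (if a = b then \<mu> a else if b = Suc a \<and> pos b \<noteq> 0 then 1 else 0)"
    "\<And>b. b < sum_list (map fst n_as) \<Longrightarrow> pos b \<noteq> 0 \<Longrightarrow> \<exists>a. b = Suc a \<and> pos b = Suc (pos a) \<and> \<mu> b = \<mu> a"
    "\<And>x j. card {a. a < sum_list (map fst n_as) \<and> \<mu> a = x \<and> pos a = j} =
      length (filter (\<lambda>m. j < m) (chain_lengths n_as x))"
proof (induction n_as arbitrary: thesis)
  case Nil
  show ?case by (rule Nil) (auto simp: chain_lengths_def)
next
  case (Cons c n_as)
  obtain m y where c: "c = (m, y)" by force
  let ?N = "sum_list (map fst n_as)"
  show ?case
  proof (rule Cons(1))
    fix \<mu> :: "nat \<Rightarrow> complex" and pos :: "nat \<Rightarrow> nat"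
    assume 1: "\<And>a b. a < ?N \<Longrightarrow> b < ?N \<Longrightarrow>
        jordan_matrix n_as $$ (a, b) = (if a = b then \<mu> a else if b = Suc a \<and> pos b \<noteq> 0 then 1 else 0)"
      and 2: "\<And>b. b < ?N \<Longrightarrow> pos b \<noteq> 0 \<Longrightarrow> \<exists>a. b = Suc a \<and> pos b = Suc (pos a) \<and> \<mu> b = \<mu> a"
      and 3: "\<And>x j. card {a. a < ?N \<and> \<mu> a = x \<and> pos a = j} = length (filter (\<lambda>m. j < m) (chain_lengths n_as x))"
    define \<mu>' where "\<mu>' a = (if a < m then y else \<mu> (a - m))" for a
    define pos' where "pos' a = (if a < m then a else pos (a - m))" for a
    show thesis
    proof (rule Cons(2)[of \<mu>' pos'])
      fix a b assume ab: "a < sum_list (map fst (c # n_as))" "b < sum_list (map fst (c # n_as))"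
      \<comment> \<open>Index \<open>m\<close> starts a chain of the tail and has position 0 there;
        hence no superdiagonal 1 links the new chain to the tail.\<close>
      have p0: "b \<noteq> m" if pb: "pos (b - m) \<noteq> 0" "\<not> b < m"
      proof -
        have "b - m < ?N" using pb ab by (simp add: c)
        then obtain a' where "b - m = Suc a'" using 2[OF _ pb(1)] by blast
        then show ?thesis by simp
      qed
      show "jordan_matrix (c # n_as) $$ (a, b) = (if a = b then \<mu>' a else if b = Suc a \<and> pos' b \<noteq> 0 then 1 else 0)"
      proof -
        have ab': "a < m + ?N" "b < m + ?N" using ab by (simp_all add: c)
        then have J: "jordan_matrix (c # n_as) $$ (a, b) =
            (if a < m then if b < m then jordan_block m y $$ (a, b) else 0
             else if b < m then 0 else jordan_matrix n_as $$ (a - m, b - m))"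
          unfolding c jordan_matrix_Cons by (subst index_mat_four_block) (simp_all add: jordan_block_def)
        consider "a < m" "b < m" | "a < m" "\<not> b < m" | "\<not> a < m" "b < m" | "\<not> a < m" "\<not> b < m"
          by blast
        then show ?thesis
        proof cases
          case 2
          then have "b = Suc a \<Longrightarrow> b = m" by linarith
          moreover have "pos' b \<noteq> 0 \<Longrightarrow> b \<noteq> m" using 2 p0 by (simp add: pos'_def)
          ultimately have "\<not> (b = Suc a \<and> pos' b \<noteq> 0)" by blast
          with 2 J show ?thesis by auto
        next
          case 4
          then have "a - m < ?N" "b - m < ?N" using ab' by simp_all
          moreover have "a - m = b - m \<longleftrightarrow> a = b" "b - m = Suc (a - m) \<longleftrightarrow> b = Suc a" using 4 by auto
          ultimately have "jordan_matrix n_as $$ (a - m, b - m) =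
              (if a = b then \<mu> (a - m) else if b = Suc a \<and> pos (b - m) \<noteq> 0 then 1 else 0)"
            by (simp only: 1)
          with 4 J show ?thesis by (simp add: \<mu>'_def pos'_def)
        qed (auto simp: J \<mu>'_def pos'_def)
      qed
    next
      fix b assume b: "b < sum_list (map fst (c # n_as))" "pos' b \<noteq> 0"
      show "\<exists>a. b = Suc a \<and> pos' b = Suc (pos' a) \<and> \<mu>' b = \<mu>' a"
      proof (cases "b < m")
        case True
        then show ?thesis using b by (cases b) (auto simp: pos'_def \<mu>'_def)
      next
        case False
        then have "b - m < ?N" "pos (b - m) \<noteq> 0" using b by (auto simp: pos'_def c)
        from 2[OF this] obtain a where "b - m = Suc a" "pos (b - m) = Suc (pos a)" "\<mu> (b - m) = \<mu> a"
          by blast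
        then show ?thesis using False by (intro exI[of _ "a + m"]) (auto simp: pos'_def \<mu>'_def)
      qed
    next
      fix x j
      let ?A = "{a. a < m \<and> y = x \<and> a = j}" and ?B = "{a. a < ?N \<and> \<mu> a = x \<and> pos a = j}"
      have "{a. a < sum_list (map fst (c # n_as)) \<and> \<mu>' a = x \<and> pos' a = j} = ?A \<union> (\<lambda>a. a + m) ` ?B"
      proof (intro subset_antisym subsetI)
        fix a assume "a \<in> {a. a < sum_list (map fst (c # n_as)) \<and> \<mu>' a = x \<and> pos' a = j}"
        then show "a \<in> ?A \<union> (\<lambda>a. a + m) ` ?B"
          by (cases "a < m") (auto simp: \<mu>'_def pos'_def c intro!: image_eqI[of _ _ "a - m"])
      qed (auto simp: \<mu>'_def pos'_def c)
      moreover have "card (?A \<union> (\<lambda>a. a + m) ` ?B) = card ?A + card ?B"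
        by (subst card_Un_disjoint) (auto simp: card_image inj_on_def)
      moreover have "?A = (if y = x \<and> j < m then {j} else {})" by auto
      ultimately show "card {a. a < sum_list (map fst (c # n_as)) \<and> \<mu>' a = x \<and> pos' a = j} =
          length (filter (\<lambda>m. j < m) (chain_lengths (c # n_as) x))"
        using 3[of x j] by (simp add: chain_lengths_def c)
    qed
  qed
qed

text \<open>A chain of length 0 would list a number without contributing a root to the
  characteristic polynomial; with positive exponents the roots are exactly the listed
  numbers.\<close>

lemma spectrum_jordan_matrix:
  fixes n_as :: "(nat \<times> complex) list"
  assumes "0 \<notin> fst ` set n_as"
  shows "spectrum (jordan_matrix n_as) = snd ` set n_as"
proof -
  have "poly (char_poly (jordan_matrix n_as)) x = 0 \<longleftrightarrow> x \<in> snd ` set n_as" for x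
    using assms unfolding jordan_matrix_char_poly
    by (induction n_as) (auto simp: poly_mult poly_power)
  then show ?thesis
    unfolding spectrum_def using eigenvalue_root_char_poly[OF jordan_matrix_carrier, of n_as] by auto
qed

locale jordan_data =
  fixes n_as :: "(nat \<times> complex) list" and lam :: "complex list"
  assumes pos_lengths: "0 \<notin> fst ` set n_as" and seq: "eigenvalue_sequence n_as lam"
begin

definition "ns = chain_counts n_as lam"
definition "N = sum_list ns"
abbreviation "J \<equiv> jordan_matrix n_as"

lemma length_ns: "length ns = length lam"
  by (simp add: ns_def chain_counts_def)

sublocale flag N "block_of ns" "length lam" "(!) lam"
proof
  show "a < N \<Longrightarrow> block_of ns a < length lam" for a
    using block_of_bounds(1)[of a ns] by (simp add: N_def length_ns)
  show "a \<le> b \<Longrightarrow> b < N \<Longrightarrow> block_of ns a \<le> block_of ns b" for a b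
    using block_of_mono by (simp add: N_def)
qed

text \<open>The \<open>j\<close>-th occurrence of \<open>\<mu>\<close> in \<open>lam\<close> is the block of the \<open>j\<close>-th vectors of the Jordan
  chains for \<open>\<mu>\<close>; sorting the basis by blocks gives a generic triangular matrix.\<close>

lemma generic_representative:
  obtains \<rho> g g' where "generic \<rho>" "unit_pair g g'" "\<rho> = g * J * g'" "dim_row J = N"
proof -
  let ?N = "sum_list (map fst n_as)"
  obtain \<mu> pos where
    1: "\<And>a b. a < ?N \<Longrightarrow> b < ?N \<Longrightarrow> J $$ (a, b) = (if a = b then \<mu> a else if b = Suc a \<and> pos b \<noteq> 0 then 1 else 0)"
    and 2: "\<And>b. b < ?N \<Longrightarrow> pos b \<noteq> 0 \<Longrightarrow> \<exists>a. b = Suc a \<and> pos b = Suc (pos a) \<and> \<mu> b = \<mu> a"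
    and 3: "\<And>x j. card {a. a < ?N \<and> \<mu> a = x \<and> pos a = j} = length (filter (\<lambda>m. j < m) (chain_lengths n_as x))"
    using jordan_matrix_positions[of n_as] by blast
  let ?c = "\<lambda>k x. count_list (take k lam) x"
  have "\<exists>k<length lam. lam ! k = \<mu> a \<and> ?c k (\<mu> a) = pos a" if a: "a < ?N" for a
  proof -
    have "a \<in> {b. b < ?N \<and> \<mu> b = \<mu> a \<and> pos b = pos a}" using a by simp
    then have "card {b. b < ?N \<and> \<mu> b = \<mu> a \<and> pos b = pos a} \<noteq> 0" by auto
    then have "filter (\<lambda>m. pos a < m) (chain_lengths n_as (\<mu> a)) \<noteq> []" unfolding 3 by auto
    then obtain m where m: "m \<in> set (chain_lengths n_as (\<mu> a))" "pos a < m" by (auto simp: filter_empty_conv)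
    then have "\<mu> a \<in> set lam"
      using seq spectrum_jordan_matrix[OF pos_lengths] unfolding eigenvalue_sequence_def chain_lengths_def
      by force
    then have "count_list lam (\<mu> a) = Max (set (chain_lengths n_as (\<mu> a)))"
      using seq by (simp add: eigenvalue_sequence_def)
    moreover have "m \<le> Max (set (chain_lengths n_as (\<mu> a)))" using m(1) by (intro Max_ge) auto
    ultimately show ?thesis using m(2) by (intro ex_occurrence) simp
  qed
  then have "\<forall>a. \<exists>k. a < ?N \<longrightarrow> k < length lam \<and> lam ! k = \<mu> a \<and> ?c k (\<mu> a) = pos a" by blast
  \<comment> \<open>\<open>\<kappa> a\<close> is the block that receives the basis vector
    \<open>a\<close>: that occurrence of its eigenvalue in \<open>lam\<close> whose number, counted
    from 0, is the position of \<open>a\<close> in its chain.\<close>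
  from choice[OF this] obtain \<kappa> where \<kappa>: "\<And>a. a < ?N \<Longrightarrow> \<kappa> a < length lam"
    "\<And>a. a < ?N \<Longrightarrow> lam ! \<kappa> a = \<mu> a" "\<And>a. a < ?N \<Longrightarrow> ?c (\<kappa> a) (\<mu> a) = pos a" by blast
  have \<kappa>_less: "\<kappa> a < \<kappa> b" if "a < ?N" "b < ?N" "\<mu> a = \<mu> b" "pos a < pos b" for a b
    using count_list_take_mono[of "\<kappa> b" "\<kappa> a" lam "\<mu> a"] \<kappa>(3)[OF that(1)] \<kappa>(3)[OF that(2)] that by force
  have fib: "{a \<in> {..<?N}. \<kappa> a = k} = {a. a < ?N \<and> \<mu> a = lam ! k \<and> pos a = ?c k (lam ! k)}"
    if k: "k < length lam" for k
  proof (intro subset_antisym subsetI)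
    fix a assume "a \<in> {a. a < ?N \<and> \<mu> a = lam ! k \<and> pos a = ?c k (lam ! k)}"
    then have a: "a < ?N" "\<mu> a = lam ! k" "?c (\<kappa> a) (lam ! k) = ?c k (lam ! k)" "lam ! \<kappa> a = lam ! k"
      using \<kappa>[of a] by auto
    have "\<not> \<kappa> a < k" "\<not> k < \<kappa> a"
      using count_list_take_strict[of "\<kappa> a" k lam "lam ! k"] count_list_take_strict[of k "\<kappa> a" lam "lam ! k"]
        a(3,4) \<kappa>(1)[OF a(1)] k by auto
    then have "\<kappa> a = k" by simp
    then show "a \<in> {a \<in> {..<?N}. \<kappa> a = k}" using a by simp
  qed (use \<kappa> in auto)
  \<comment> \<open>The definition counts occurrences including the one at \<open>k\<close> and
    compares with \<open>\<le>\<close>; leaving out the last one turns this into a strict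
    inequality, matching positions counted from 0.\<close>
  have ns: "ns ! k = length (filter (\<lambda>m. ?c k (lam ! k) < m) (chain_lengths n_as (lam ! k)))" if "k < length lam" for k
    using that by (simp add: ns_def chain_counts_def count_list_take_Suc)
      (rule arg_cong[of _ _ length], rule filter_cong, auto)
  have card: "card {i \<in> {..<N}. block_of ns i = k} = card {a \<in> {..<?N}. \<kappa> a = k}" for k
  proof (cases "k < length lam")
    case True
    then show ?thesis using card_block[of k ns] fib[OF True] 3 ns[OF True] by (simp add: N_def length_ns)
  next
    case False
    then have "{i \<in> {..<N}. block_of ns i = k} = {}" "{a \<in> {..<?N}. \<kappa> a = k} = {}"
      using \<kappa>(1) bl_less by force+
    then show ?thesis by (simp only:)
  qed
  \<comment> \<open>The fibres of \<open>\<kappa>\<close> have the sizes of the blocks, so the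
    Jordan basis can be sorted by blocks; \<open>\<tau> i\<close> is the Jordan index placed at
    \<open>i\<close>.\<close>
  obtain \<tau> where \<tau>: "bij_betw \<tau> {..<N} {..<?N}" and \<kappa>\<tau>: "\<And>i. i \<in> {..<N} \<Longrightarrow> \<kappa> (\<tau> i) = block_of ns i"
    using bij_betw_fibres[of "{..<N}" "{..<?N}" "block_of ns" \<kappa>] card by auto
  have N: "?N = N" using bij_betw_same_card[OF \<tau>] by simp
  note 1 = 1[unfolded N] and 2 = 2[unfolded N] and \<kappa> = \<kappa>[unfolded N] and \<kappa>_less = \<kappa>_less[unfolded N] and \<tau> = \<tau>[unfolded N]
  have \<tau>_less: "\<tau> i < N" if "i < N" for i using bij_betwE[OF \<tau>] that by auto
  have \<tau>_eq: "\<tau> i = \<tau> j \<longleftrightarrow> i = j" if "i < N" "j < N" for i j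
    using bij_betw_imp_inj_on[OF \<tau>] that by (auto simp: inj_on_def)
  define \<sigma> where "\<sigma> = inv_into {..<N} \<tau>"
  have \<sigma>: "\<sigma> a < N \<and> \<tau> (\<sigma> a) = a" if "a < N" for a
  proof -
    have "a \<in> \<tau> ` {..<N}" using bij_betw_imp_surj_on[OF \<tau>] that by simp
    from inv_into_into[OF this] f_inv_into_f[OF this] show ?thesis by (simp add: \<sigma>_def)
  qed
  have \<kappa>\<tau>: "\<kappa> (\<tau> i) = block_of ns i" if "i < N" for i using \<kappa>\<tau> that by simp
  have \<kappa>_Suc: "\<kappa> a < \<kappa> (Suc a)" "\<mu> (Suc a) = \<mu> a" if "Suc a < N" "pos (Suc a) \<noteq> 0" for a
    using 2[OF that] \<kappa>_less[of a "Suc a"] that by auto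
  have J [simp]: "J \<in> R" using jordan_matrix_carrier[of n_as] N by simp
  define \<rho> where "\<rho> = mat N N (\<lambda>(i, j). J $$ (\<tau> i, \<tau> j))"
  define g where "g = mat N N (\<lambda>(i, a). if \<tau> i = a then 1 else 0 :: complex)"
  define g' where "g' = mat N N (\<lambda>(a, i). if \<tau> i = a then 1 else 0 :: complex)"
  have [simp]: "\<rho> \<in> R" "g \<in> R" "g' \<in> R" by (simp_all add: \<rho>_def g_def g'_def)
  have gX: "(g * X) $$ (i, j) = X $$ (\<tau> i, j)" if "X \<in> R" "i < N" "j < N" for X i j
  proof -
    have "(g * X) $$ (i, j) = (\<Sum>a<N. if a = \<tau> i then X $$ (\<tau> i, j) else 0)"
      unfolding mult_entry[OF \<open>g \<in> R\<close> that]
      by (rule sum.cong) (use that in \<open>auto simp: g_def\<close>)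
    then show ?thesis using \<tau>_less that by simp
  qed
  have Xg': "(X * g') $$ (i, j) = X $$ (i, \<tau> j)" if "X \<in> R" "i < N" "j < N" for X i j
  proof -
    have "(X * g') $$ (i, j) = (\<Sum>a<N. if a = \<tau> j then X $$ (i, \<tau> j) else 0)"
      unfolding mult_entry[OF that(1) \<open>g' \<in> R\<close> that(2,3)]
      by (rule sum.cong) (use that in \<open>auto simp: g'_def\<close>)
    then show ?thesis using \<tau>_less that by simp
  qed
  have gg': "unit_pair g g'"
    by (rule right_inverse_unit) (simp_all, rule add_eqI, simp_all add: gX g'_def \<tau>_less \<tau>_eq)
  have \<rho>: "\<rho> = g * J * g'"
    by (rule add_eqI) (simp_all add: mult_assoc gX Xg' \<rho>_def \<tau>_less)
  have \<rho>_entry: "\<rho> $$ (i, j) = (if i = j then \<mu> (\<tau> i) else if \<tau> j = Suc (\<tau> i) \<and> pos (\<tau> j) \<noteq> 0 then 1 else 0)"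
    if "i < N" "j < N" for i j
    using that \<tau>_less 1 \<tau>_eq by (simp add: \<rho>_def)
  have triangular: "triangular \<rho>"
    unfolding triangular_iff_entries
  proof (intro conjI allI impI)
    fix i j assume ij: "i < N" "j < N" "block_of ns j \<le> block_of ns i"
    have no: "\<not> (\<tau> j = Suc (\<tau> i) \<and> pos (\<tau> j) \<noteq> 0)"
    proof (intro notI, elim conjE)
      assume *: "\<tau> j = Suc (\<tau> i)" "pos (\<tau> j) \<noteq> 0"
      then have "\<kappa> (\<tau> i) < \<kappa> (\<tau> j)" using \<kappa>_Suc(1)[of "\<tau> i"] \<tau>_less[OF ij(2)] by simp
      then show False using \<kappa>\<tau>[OF ij(1)] \<kappa>\<tau>[OF ij(2)] ij(3) by simp
    qed
    have lam_\<mu>: "lam ! block_of ns i = \<mu> (\<tau> i)"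
      using \<kappa>(2)[OF \<tau>_less[OF ij(1)]] by (simp only: \<kappa>\<tau>[OF ij(1)])
    show "\<rho> $$ (i, j) = (if i = j then lam ! block_of ns i else 0)"
      unfolding \<rho>_entry[OF ij(1,2)] lam_\<mu> by (cases "i = j") (simp_all only: no if_True if_False simp_thms)
  qed simp
  \<comment> \<open>Kernel argument along the chains, starting from their far ends: a vector
    \<open>w\<close> annihilated by the shifted matrix in the blocks from \<open>k\<close> on
    vanishes after block \<open>k\<close>. If the eigenvalue at \<open>a\<close> is
    \<open>lam ! k\<close>, the equation at the predecessor of \<open>a\<close> gives
    \<open>w a = 0\<close>; otherwise the coefficient of \<open>w a\<close> is nonzero and the
    successor term vanishes by induction.\<close>
  have chain: "w a = 0"
    if k: "k < length lam" and w: "\<And>a. a < N \<Longrightarrow> k \<le> \<kappa> a \<Longrightarrow>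
        (\<mu> a - lam ! k) * w a + (if Suc a < N \<and> pos (Suc a) \<noteq> 0 then w (Suc a) else 0) = 0"
      and a: "a < N" "k < \<kappa> a" for k a and w :: "nat \<Rightarrow> complex"
    using a
  proof (induction "N - a" arbitrary: a rule: less_induct)
    case less
    show ?case
    proof (cases "\<mu> a = lam ! k")
      case True
      then have "pos a \<noteq> 0"
        using count_list_take_strict[of k "\<kappa> a" lam "lam ! k"] k less(3) \<kappa>(3)[OF less(2)] by simp
      then obtain b where b: "a = Suc b" "pos a = Suc (pos b)" "\<mu> a = \<mu> b" using 2[OF less(2)] by blast
      have bN: "b < N" using b less(2) by simp
      \<comment> \<open>Otherwise block \<open>k\<close> would be an occurrence of the eigenvalue
        strictly between those assigned to \<open>b\<close> and \<open>a\<close>, although their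
        positions are consecutive.\<close>
      have "k \<le> \<kappa> b"
      proof (rule ccontr)
        assume "\<not> k \<le> \<kappa> b"
        then have "\<kappa> b < k" by simp
        then have "?c (\<kappa> b) (\<mu> a) < ?c k (\<mu> a)" "?c k (\<mu> a) < ?c (\<kappa> a) (\<mu> a)"
          using count_list_take_strict[of "\<kappa> b" k lam "\<mu> a"] count_list_take_strict[of k "\<kappa> a" lam "\<mu> a"]
            \<kappa>(1,2)[OF bN] b(3) k True less(3) by simp_all
        then show False using \<kappa>(3)[OF less(2)] \<kappa>(3)[OF bN] b by simp
      qed
      then show ?thesis using w[OF bN] less(2) b True by simp
    next
      case False
      have "(if Suc a < N \<and> pos (Suc a) \<noteq> 0 then w (Suc a) else 0) = 0"
      proof (cases "Suc a < N \<and> pos (Suc a) \<noteq> 0")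
        case True
        then have "k < \<kappa> (Suc a)" using \<kappa>_Suc(1)[of a] less(3) by simp
        moreover have "N - Suc a < N - a" using True by linarith
        ultimately show ?thesis using less(1)[of "Suc a"] True by simp
      qed auto
      then have "(\<mu> a - lam ! k) * w a = 0" using w[OF less(2)] less(3) by simp
      then show ?thesis using False by simp
    qed
  qed
  have "generic \<rho>"
  proof (rule genericI[OF triangular])
    fix k assume k: "k < length lam"
    define B where "B = E k * sh \<rho> k"
    have [simp]: "B \<in> R" by (simp add: B_def)
    obtain u where u [simp]: "u \<in> R" and BuB: "B * u * B = B"
      using square_unit_regular[of B N] by (auto simp: unit_regular_def unit_pair_def)
    \<comment> \<open>The columns of \<open>X\<close> span the kernel of \<open>B\<close>. Once they
      are shown to vanish after block \<open>k\<close>, the matrix \<open>E (Suc k) * u\<close> is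
      the left inverse required.\<close>
    define X where "X = I - u * B"
    have [simp]: "X \<in> R" by (simp add: X_def)
    have "B * X = Z" using BuB by (simp add: X_def ring_simps)
    have "E (Suc k) * X = Z"
    proof (rule add_eqI)
      fix i c assume ic: "i < N" "c < N"
      \<comment> \<open>Column \<open>c\<close> of \<open>X\<close>, read in the original Jordan
        indices.\<close>
      define w where "w a = X $$ (\<sigma> a, c)" for a
      have \<sigma>\<tau>: "\<sigma> (\<tau> j) = j" if "j < N" for j using \<sigma>[of "\<tau> j"] \<tau>_less[OF that] \<tau>_eq that by blast
      have "w (\<tau> i) = 0" if i: "k < block_of ns i"
      proof (rule chain[OF k])
        fix a assume a: "a < N" "k \<le> \<kappa> a"
        let ?i = "\<sigma> a"
        have i: "?i < N" "\<tau> ?i = a" "block_of ns ?i = \<kappa> a" using \<sigma>[OF a(1)] \<kappa>\<tau>[of ?i] by auto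
        have "0 = (B * X) $$ (?i, c)" using \<open>B * X = Z\<close> i ic by simp
        also have "\<dots> = (sh \<rho> k * X) $$ (?i, c)"
          using i ic a by (simp add: B_def mult_assoc proj_mult_entry)
        also have "\<dots> = (\<rho> * X) $$ (?i, c) - lam ! k * X $$ (?i, c)"
          using i ic by (simp add: sh_mult entries)
        also have "(\<rho> * X) $$ (?i, c) = (\<Sum>j<N. \<rho> $$ (?i, j) * X $$ (j, c))"
          using i ic by (simp add: mult_entry)
        also have "\<dots> = (\<Sum>j<N. (if j = ?i then \<mu> a * X $$ (?i, c) else 0) +
            (if Suc a < N \<and> pos (Suc a) \<noteq> 0 then if j = \<sigma> (Suc a) then X $$ (j, c) else 0 else 0))"
        proof (rule sum.cong[OF refl])
          fix j assume "j \<in> {..<N}"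
          then have j: "j < N" by simp
          have "\<tau> j = Suc a \<longleftrightarrow> Suc a < N \<and> j = \<sigma> (Suc a)" using \<sigma>[of "Suc a"] \<sigma>\<tau>[OF j] \<tau>_less[OF j] by auto
          moreover have "j = ?i \<Longrightarrow> \<tau> j \<noteq> Suc a" using i by auto
          ultimately show "\<rho> $$ (?i, j) * X $$ (j, c) = (if j = ?i then \<mu> a * X $$ (?i, c) else 0) +
            (if Suc a < N \<and> pos (Suc a) \<noteq> 0 then if j = \<sigma> (Suc a) then X $$ (j, c) else 0 else 0)"
            using \<rho>_entry[OF i(1) j] i by auto
        qed
        also have "\<dots> = \<mu> a * X $$ (?i, c) + (if Suc a < N \<and> pos (Suc a) \<noteq> 0 then w (Suc a) else 0)"
          using i(1) \<sigma>[of "Suc a"]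
          by (cases "Suc a < N \<and> pos (Suc a) \<noteq> 0") (simp_all only: sum.distrib w_def if_True if_False sum.neutral_const, simp_all)
        finally show "(\<mu> a - lam ! k) * w a + (if Suc a < N \<and> pos (Suc a) \<noteq> 0 then w (Suc a) else 0) = 0"
          by (simp add: w_def algebra_simps)
      qed (use ic \<tau>_less i \<kappa>\<tau> in auto)
      then show "(E (Suc k) * X) $$ (i, c) = Z $$ (i, c)"
        using ic \<sigma>\<tau>[of i] by (simp add: proj_mult_entry w_def)
    qed simp_all
    then have "E (Suc k) - E (Suc k) * u * B = Z" by (simp add: X_def ring_simps)
    then have "E (Suc k) * u * B = E (Suc k)"
      using cancels(2)[of "E (Suc k) * u * B" "E (Suc k)"] cancels(2)[of "E (Suc k)" "E (Suc k) * u * B"] by simp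
    then show "\<exists>L\<in>R. L * (E k * sh \<rho> k) = E (Suc k)"
      unfolding B_def[symmetric] by (intro bexI[of _ "E (Suc k) * u"]) simp_all
  qed
  then show ?thesis using that[OF _ gg' \<rho>] N by simp
qed

end

section \<open>Algebras of functions and the Zariski topology\<close>

text \<open>Interpreted for polynomial functions, for regular functions, for functions
  differentiable at 0 and for polynomials in one variable; closure under matrix products,
  determinants and adjugates is thus obtained once for all four.\<close>

locale function_algebra =
  fixes F :: "('a \<Rightarrow> complex) set"
  assumes const: "(\<lambda>_. c) \<in> F"
    and add: "f \<in> F \<Longrightarrow> g \<in> F \<Longrightarrow> (\<lambda>x. f x + g x) \<in> F"
    and mult: "f \<in> F \<Longrightarrow> g \<in> F \<Longrightarrow> (\<lambda>x. f x * g x) \<in> F"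
begin

lemma diff: "f \<in> F \<Longrightarrow> g \<in> F \<Longrightarrow> (\<lambda>x. f x - g x) \<in> F"
  using add[OF _ mult[OF const[of "-1"]], of f g] by simp

lemma sum: "(\<And>i. i \<in> A \<Longrightarrow> f i \<in> F) \<Longrightarrow> (\<lambda>x. \<Sum>i\<in>A. f i x) \<in> F"
  by (induction A rule: infinite_finite_induct) (auto intro: const add)

lemma prod: "(\<And>i. i \<in> A \<Longrightarrow> f i \<in> F) \<Longrightarrow> (\<lambda>x. \<Prod>i\<in>A. f i x) \<in> F"
  by (induction A rule: infinite_finite_induct) (auto intro: const mult)

definition mats :: "nat \<Rightarrow> ('a \<Rightarrow> complex mat) set" where
  "mats n = {G. (\<forall>x. G x \<in> carrier_mat n n) \<and> (\<forall>a<n. \<forall>b<n. (\<lambda>x. G x $$ (a, b)) \<in> F)}"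

lemma matsI: "(\<And>x. G x \<in> carrier_mat n n) \<Longrightarrow> (\<And>a b. a < n \<Longrightarrow> b < n \<Longrightarrow> (\<lambda>x. G x $$ (a, b)) \<in> F) \<Longrightarrow> G \<in> mats n"
  by (simp add: mats_def)

lemma mats_entry: "G \<in> mats n \<Longrightarrow> a < n \<Longrightarrow> b < n \<Longrightarrow> (\<lambda>x. G x $$ (a, b)) \<in> F"
  and mats_carrier: "G \<in> mats n \<Longrightarrow> G x \<in> carrier_mat n n"
  by (simp_all add: mats_def)

lemma mats_const: "A \<in> carrier_mat n n \<Longrightarrow> (\<lambda>_. A) \<in> mats n"
  by (simp add: mats_def const)

lemma mats_add: assumes "G \<in> mats n" "H \<in> mats n" shows "(\<lambda>x. G x + H x) \<in> mats n"
proof (rule matsI)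
  fix a b assume ab: "a < n" "b < n"
  have "(G x + H x) $$ (a, b) = G x $$ (a, b) + H x $$ (a, b)" for x
    using mats_carrier[OF assms(2), of x] ab by simp
  then show "(\<lambda>x. (G x + H x) $$ (a, b)) \<in> F"
    using add[OF mats_entry[OF assms(1) ab] mats_entry[OF assms(2) ab]] by simp
qed (use assms mats_carrier in auto)

lemma mats_diff: assumes "G \<in> mats n" "H \<in> mats n" shows "(\<lambda>x. G x - H x) \<in> mats n"
proof (rule matsI)
  fix a b assume ab: "a < n" "b < n"
  have "(G x - H x) $$ (a, b) = G x $$ (a, b) - H x $$ (a, b)" for x
    using mats_carrier[OF assms(2), of x] ab by simp
  then show "(\<lambda>x. (G x - H x) $$ (a, b)) \<in> F"
    using diff[OF mats_entry[OF assms(1) ab] mats_entry[OF assms(2) ab]] by simp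
qed (use assms mats_carrier in \<open>auto intro: minus_carrier_mat\<close>)

lemma mats_smult: assumes "f \<in> F" "G \<in> mats n" shows "(\<lambda>x. f x \<cdot>\<^sub>m G x) \<in> mats n"
proof (rule matsI)
  fix a b assume ab: "a < n" "b < n"
  have "(f x \<cdot>\<^sub>m G x) $$ (a, b) = f x * G x $$ (a, b)" for x
    using mats_carrier[OF assms(2), of x] ab by simp
  then show "(\<lambda>x. (f x \<cdot>\<^sub>m G x) $$ (a, b)) \<in> F"
    using mult[OF assms(1) mats_entry[OF assms(2) ab]] by simp
qed (use mats_carrier[OF assms(2)] in auto)

lemma mats_mult: assumes "G \<in> mats n" "H \<in> mats n" shows "(\<lambda>x. G x * H x) \<in> mats n"
proof (rule matsI)
  fix a b assume ab: "a < n" "b < n"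
  have "(G x * H x) $$ (a, b) = (\<Sum>c<n. G x $$ (a, c) * H x $$ (c, b))" for x
    by (rule square.mult_entry[OF mats_carrier[OF assms(1)] mats_carrier[OF assms(2)] ab])
  then show "(\<lambda>x. (G x * H x) $$ (a, b)) \<in> F"
    using sum[of "{..<n}" "\<lambda>c x. G x $$ (a, c) * H x $$ (c, b)"] mult mats_entry assms ab by simp
qed (use assms mats_carrier in \<open>auto intro: mult_carrier_mat\<close>)

lemma det_mats: assumes "G \<in> mats n" shows "(\<lambda>x. det (G x)) \<in> F"
proof -
  have perm: "p i < n" if "p permutes {0..<n}" "i < n" for p i
    using permutes_in_image[OF that(1), of i] that(2) by simp
  have "(\<lambda>x. \<Sum>p \<in> {p. p permutes {0..<n}}. signof p * (\<Prod>i = 0..<n. G x $$ (i, p i))) \<in> F"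
    by (intro sum mult const prod mats_entry[OF assms]) (auto intro: perm)
  then show ?thesis using det_def'[OF mats_carrier[OF assms]] by simp
qed

lemma adj_mats: assumes "G \<in> mats n" shows "(\<lambda>x. adj_mat (G x)) \<in> mats n"
proof (rule matsI)
  fix a b assume ab: "a < n" "b < n"
  have dim: "dim_row (G x) = n" "dim_col (G x) = n" for x using mats_carrier[OF assms, of x] by auto
  have "(\<lambda>x. mat_delete (G x) b a) \<in> mats (n - 1)"
  proof (rule matsI)
    fix i j assume ij: "i < n - 1" "j < n - 1"
    have "mat_delete (G x) b a $$ (i, j) = G x $$ (if i < b then i else Suc i, if j < a then j else Suc j)" for x
      using ij by (simp add: mat_delete_def dim)
    moreover have "(if i < b then i else Suc i) < n" "(if j < a then j else Suc j) < n" using ij by auto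
    ultimately show "(\<lambda>x. mat_delete (G x) b a $$ (i, j)) \<in> F"
      using mats_entry[OF assms] by presburger
  qed (simp add: mat_delete_def dim)
  then have "(\<lambda>x. (- 1) ^ (b + a) * det (mat_delete (G x) b a)) \<in> F"
    by (intro mult const det_mats)
  then show "(\<lambda>x. adj_mat (G x) $$ (a, b)) \<in> F"
    using ab by (simp add: adj_mat_def dim cofactor_def)
qed (use adj_mat mats_carrier[OF assms] in blast)

end

lemma function_algebra_poly_funs: "function_algebra (poly_funs C)"
  by unfold_locales (auto intro: poly_funs.intros)

section \<open>Zariski open sets and regular functions\<close>

lemma zariski_open_Int:
  assumes "zariski_open C X V" "zariski_open C X W"
  shows "zariski_open C X (V \<inter> W)"
proof -
  obtain S where S: "S \<subseteq> poly_funs C" "V = {x \<in> X. \<exists>f\<in>S. f x \<noteq> 0}"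
    using assms(1) unfolding zariski_open_def by blast
  obtain T where T: "T \<subseteq> poly_funs C" "W = {x \<in> X. \<exists>f\<in>T. f x \<noteq> 0}"
    using assms(2) unfolding zariski_open_def by blast
  let ?P = "{\<lambda>x. f x * g x | f g. f \<in> S \<and> g \<in> T}"
  have "?P \<subseteq> poly_funs C" using S(1) T(1) poly_funs.mult by blast
  moreover have "V \<inter> W = {x \<in> X. \<exists>f\<in>?P. f x \<noteq> 0}"
  proof (intro subset_antisym subsetI)
    fix x assume "x \<in> V \<inter> W"
    then obtain f g where fg: "x \<in> X" "f \<in> S" "f x \<noteq> 0" "g \<in> T" "g x \<noteq> 0" unfolding S(2) T(2) by blast
    have P: "(\<lambda>x. f x * g x) \<in> ?P" using fg by (intro CollectI exI[of _ f] exI[of _ g]) simp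
    show "x \<in> {x \<in> X. \<exists>f\<in>?P. f x \<noteq> 0}"
      using fg by (intro CollectI conjI bexI[OF _ P]) simp_all
  next
    fix x assume "x \<in> {x \<in> X. \<exists>f\<in>?P. f x \<noteq> 0}"
    then obtain h where "x \<in> X" "h \<in> ?P" "h x \<noteq> 0" by blast
    then obtain f g where "f \<in> S" "g \<in> T" "f x * g x \<noteq> 0" by blast
    then have "f \<in> S" "g \<in> T" "f x \<noteq> 0" "g x \<noteq> 0" by auto
    then show "x \<in> V \<inter> W" unfolding S(2) T(2) using \<open>x \<in> X\<close> by blast
  qed
  ultimately show ?thesis unfolding zariski_open_def by (intro exI[of _ ?P] conjI)
qed

lemma zariski_open_self: "zariski_open C X X"
  unfolding zariski_open_def by (intro exI[of _ "{\<lambda>_. 1}"]) (auto intro: poly_funs.const)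

lemma zariski_open_INT:
  "(\<And>k. k < (m::nat) \<Longrightarrow> zariski_open C X (W k)) \<Longrightarrow> zariski_open C X {x \<in> X. \<forall>k<m. x \<in> W k}"
proof (induction m)
  case (Suc m)
  have "zariski_open C X ({x \<in> X. \<forall>k<m. x \<in> W k} \<inter> W m)"
    by (rule zariski_open_Int[OF Suc(1) Suc(2)]) (simp_all add: Suc(2))
  moreover have "{x \<in> X. \<forall>k<m. x \<in> W k} \<inter> W m = {x \<in> X. \<forall>k<Suc m. x \<in> W k}"
    using less_Suc_eq by auto
  ultimately show ?case by simp
qed (simp add: zariski_open_self)

lemma regular_onI:
  "zariski_open C X W \<Longrightarrow> x \<in> W \<Longrightarrow> a \<in> poly_funs C \<Longrightarrow> b \<in> poly_funs C \<Longrightarrow>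
   (\<And>y. y \<in> W \<Longrightarrow> b y \<noteq> 0 \<and> h y = a y / b y) \<Longrightarrow>
   \<exists>W. zariski_open C X W \<and> x \<in> W \<and> (\<exists>a\<in>poly_funs C. \<exists>b\<in>poly_funs C. \<forall>y\<in>W. b y \<noteq> 0 \<and> h y = a y / b y)"
  by blast

lemma regular_on_poly: "f \<in> poly_funs C \<Longrightarrow> regular_on C X f"
  unfolding regular_on_def
  by (intro ballI regular_onI[where a = f and b = "\<lambda>_. 1", OF zariski_open_self]) (auto intro: poly_funs.const)

lemma regular_on_cong:
  assumes "\<And>x. x \<in> X \<Longrightarrow> f x = g x" "regular_on C X f" shows "regular_on C X g"
  unfolding regular_on_def
proof
  fix x assume "x \<in> X"
  obtain V a b where V: "zariski_open C X V" "x \<in> V" "a \<in> poly_funs C" "b \<in> poly_funs C"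
    "\<And>y. y \<in> V \<Longrightarrow> b y \<noteq> 0 \<and> f y = a y / b y" using assms(2) \<open>x \<in> X\<close> unfolding regular_on_def by meson
  have "V \<subseteq> X" using V(1) by (auto simp: zariski_open_def)
  show "\<exists>W. zariski_open C X W \<and> x \<in> W \<and> (\<exists>a\<in>poly_funs C. \<exists>b\<in>poly_funs C. \<forall>y\<in>W. b y \<noteq> 0 \<and> g y = a y / b y)"
  proof (rule regular_onI[OF V(1-4)])
    fix y assume "y \<in> V"
    then show "b y \<noteq> 0 \<and> g y = a y / b y" using V(5)[of y] assms(1)[of y] \<open>V \<subseteq> X\<close> by auto
  qed
qed

text \<open>Common pattern of sum and product: on the intersection of the two neighbourhoods,
  \<open>b * d\<close> serves as a denominator for both operations.\<close>

lemma regular_on_binop: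
  assumes f: "regular_on C X f" and g: "regular_on C X g"
    and op: "\<And>a b c d. a \<in> poly_funs C \<Longrightarrow> b \<in> poly_funs C \<Longrightarrow> c \<in> poly_funs C \<Longrightarrow> d \<in> poly_funs C \<Longrightarrow>
      \<exists>e\<in>poly_funs C. \<forall>x. b x \<noteq> 0 \<longrightarrow> d x \<noteq> 0 \<longrightarrow> op (a x / b x) (c x / d x) = e x / (b x * d x)"
  shows "regular_on C X (\<lambda>x. op (f x) (g x))"
  unfolding regular_on_def
proof
  fix x assume "x \<in> X"
  obtain V a b where V: "zariski_open C X V" "x \<in> V" "a \<in> poly_funs C" "b \<in> poly_funs C"
    "\<And>y. y \<in> V \<Longrightarrow> b y \<noteq> 0 \<and> f y = a y / b y" using f \<open>x \<in> X\<close> unfolding regular_on_def by meson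
  obtain W c d where W: "zariski_open C X W" "x \<in> W" "c \<in> poly_funs C" "d \<in> poly_funs C"
    "\<And>y. y \<in> W \<Longrightarrow> d y \<noteq> 0 \<and> g y = c y / d y" using g \<open>x \<in> X\<close> unfolding regular_on_def by meson
  obtain e where e: "e \<in> poly_funs C" "\<And>x. b x \<noteq> 0 \<Longrightarrow> d x \<noteq> 0 \<Longrightarrow> op (a x / b x) (c x / d x) = e x / (b x * d x)"
    using op[OF V(3,4) W(3,4)] by blast
  show "\<exists>W. zariski_open C X W \<and> x \<in> W \<and> (\<exists>a\<in>poly_funs C. \<exists>b\<in>poly_funs C. \<forall>y\<in>W. b y \<noteq> 0 \<and> op (f y) (g y) = a y / b y)"
    by (rule regular_onI[OF zariski_open_Int[OF V(1) W(1)] _ e(1) poly_funs.mult[OF V(4) W(4)]])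
      (use V W e(2) in auto)
qed

lemma function_algebra_regular: "function_algebra {h. regular_on C X h}"
proof
  show "(\<lambda>_. c) \<in> {h. regular_on C X h}" for c by (auto intro: regular_on_poly poly_funs.const)
  fix f g assume "f \<in> {h. regular_on C X h}" "g \<in> {h. regular_on C X h}"
  then have fg: "regular_on C X f" "regular_on C X g" by auto
  have "regular_on C X (\<lambda>x. f x + g x)"
  proof (rule regular_on_binop[OF fg])
    fix a b c d assume *: "a \<in> poly_funs C" "b \<in> poly_funs C" "c \<in> poly_funs C" "d \<in> poly_funs C"
    show "\<exists>e\<in>poly_funs C. \<forall>x. b x \<noteq> 0 \<longrightarrow> d x \<noteq> 0 \<longrightarrow> a x / b x + c x / d x = e x / (b x * d x)"
      using * by (intro bexI[of _ "\<lambda>x. a x * d x + c x * b x"]) (auto simp: field_simps intro!: poly_funs.add poly_funs.mult)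
  qed
  moreover have "regular_on C X (\<lambda>x. f x * g x)"
  proof (rule regular_on_binop[OF fg])
    fix a b c d assume *: "a \<in> poly_funs C" "b \<in> poly_funs C" "c \<in> poly_funs C" "d \<in> poly_funs C"
    show "\<exists>e\<in>poly_funs C. \<forall>x. b x \<noteq> 0 \<longrightarrow> d x \<noteq> 0 \<longrightarrow> a x / b x * (c x / d x) = e x / (b x * d x)"
      using * by (intro bexI[of _ "\<lambda>x. a x * c x"]) (auto intro!: poly_funs.mult)
  qed
  ultimately show "(\<lambda>x. f x + g x) \<in> {h. regular_on C X h}" "(\<lambda>x. f x * g x) \<in> {h. regular_on C X h}" by auto
qed

lemma function_algebra_differentiable: "function_algebra {f. \<exists>d. (f has_field_derivative d) (at (0::complex))}"
  by unfold_locales (auto intro: DERIV_const DERIV_add DERIV_mult)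

lemma function_algebra_polynomial: "function_algebra (range (poly :: complex poly \<Rightarrow> complex \<Rightarrow> complex))"
proof
  show "(\<lambda>_. c) \<in> range (poly :: complex poly \<Rightarrow> complex \<Rightarrow> complex)" for c by (rule range_eqI[of _ _ "[:c:]"]) auto
  fix f g assume "f \<in> range (poly :: complex poly \<Rightarrow> complex \<Rightarrow> complex)" "g \<in> range (poly :: complex poly \<Rightarrow> complex \<Rightarrow> complex)"
  then obtain p q where "f = poly p" "g = poly q" by auto
  then show "(\<lambda>x. f x + g x) \<in> range poly" "(\<lambda>x. f x * g x) \<in> range poly"
    by (intro range_eqI[of _ _ "p + q"] range_eqI[of _ _ "p * q"] ext; simp)+
qed

section \<open>Inverses by Cramer's rule, and orbits\<close>

context square
begin

text \<open>The inverse is written with the adjugate so that its entries stay in any function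
  algebra containing the entries of \<open>A\<close> and the reciprocal of the determinant.\<close>

lemma det_unit: assumes "A \<in> R" "det A \<noteq> 0" shows "unit_pair A (inverse (det A) \<cdot>\<^sub>m adj_mat A)"
  using adj_mat[OF assms(1)] assms by (intro right_inverse_unit) (auto simp: ring_simps intro!: add_eqI)

lemma unit_det: assumes "unit_pair u v" shows "det u \<noteq> 0"
proof -
  have "det u * det v = det (u * v)"
    by (rule det_mult[symmetric, of _ n]) (use assms in \<open>auto simp: unit_pair_def\<close>)
  then show ?thesis using assms by (auto simp: unit_pair_def)
qed

lemma GL_iff: "u \<in> GL n \<longleftrightarrow> (\<exists>v. unit_pair u v)"
proof
  assume "u \<in> GL n"
  then obtain v where u: "u \<in> R" and v: "u * v = I" "v * u = 1\<^sub>m (dim_row v)"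
    by (auto simp: GL_def invertible_mat_def inverts_mat_def)
  have "dim_col v = n" using arg_cong[OF v(1), of dim_col] by simp
  moreover have "dim_row v = n" using arg_cong[OF v(2), of dim_col] u by simp
  ultimately have "v \<in> R" by auto
  then show "\<exists>v. unit_pair u v" using right_inverse_unit[OF u _ v(1)] by blast
next
  assume "\<exists>v. unit_pair u v"
  then show "u \<in> GL n" unfolding GL_def invertible_mat_def inverts_mat_def unit_pair_def by auto
qed

lemma unit_pair_unique: assumes "unit_pair u v" "unit_pair u w" shows "v = w"
proof -
  have "v * u * w = v * (u * w)" using assms by (intro mult_assoc) (simp_all add: unit_pair_def)
  then show ?thesis using assms by (simp add: unit_pair_def)
qed

lemma minv_eq: assumes "unit_pair u v" shows "minv u = v"
proof (cases "mat_inverse u")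
  case None
  have u: "u \<in> R" using assms by (simp add: unit_pair_def)
  have "u \<in> Units (ring_mat TYPE(complex) n ())"
    by (rule det_non_zero_imp_unit[OF u unit_det[OF assms]])
  moreover have "u \<notin> Units (ring_mat TYPE(complex) n ())"
    by (rule mat_inverse(1)[OF u None])
  ultimately show ?thesis by contradiction
next
  case (Some w)
  then have "unit_pair u w" using mat_inverse(2)[OF _ Some] assms by (auto simp: unit_pair_def)
  then show ?thesis using unit_pair_unique[OF assms] Some by simp
qed

lemma conj_by_eq: "unit_pair g v \<Longrightarrow> conj_by g A = g * A * v"
  by (simp add: conj_by_def minv_eq)

lemma orbit_iff: "J \<in> R \<Longrightarrow> A \<in> orbit J \<longleftrightarrow> (\<exists>g v. unit_pair g v \<and> A = g * J * v)"
proof -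
  assume "J \<in> R"
  then have dim: "dim_row J = n" by simp
  show ?thesis
  proof
    assume "A \<in> orbit J"
    then obtain g v where "A = conj_by g J" "unit_pair g v" unfolding orbit_def dim using GL_iff by blast
    then show "\<exists>g v. unit_pair g v \<and> A = g * J * v" using conj_by_eq by blast
  next
    assume "\<exists>g v. unit_pair g v \<and> A = g * J * v"
    then obtain g v where g: "unit_pair g v" "A = g * J * v" by blast
    then have "g \<in> GL n" "A = conj_by g J" using GL_iff conj_by_eq by auto
    then show "A \<in> orbit J" unfolding orbit_def dim by blast
  qed
qed

lemma unit_pair_sym: "unit_pair u v \<Longrightarrow> unit_pair v u"
  by (auto simp: unit_pair_def)

lemma conj_conj:
  assumes "unit_pair g g'" "unit_pair h h'" "A \<in> R" shows "h * (g * A * g') * h' = (h * g) * A * (g' * h')"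
  using assms by (simp add: unit_pair_def mult_assoc)

lemma orbit_conj: "J \<in> R \<Longrightarrow> A \<in> orbit J \<Longrightarrow> unit_pair h h' \<Longrightarrow> h * A * h' \<in> orbit J"
proof -
  assume J: "J \<in> R" and A: "A \<in> orbit J" and h: "unit_pair h h'"
  obtain g g' where g: "unit_pair g g'" "A = g * J * g'" using A orbit_iff[OF J] by blast
  have "unit_pair (h * g) (g' * h')" "h * A * h' = (h * g) * J * (g' * h')"
    using unit_pair_mult[OF h g(1)] conj_conj[OF g(1) h J] by (simp_all only: g(2))
  then show ?thesis unfolding orbit_iff[OF J] by blast
qed

end

section \<open>Block lower triangular matrices\<close>

context flag
begin

definition lower :: "complex mat \<Rightarrow> bool" where
  "lower A \<longleftrightarrow> A \<in> R \<and> (\<forall>a<n. \<forall>b<n. bl a < bl b \<longrightarrow> A $$ (a, b) = 0)"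

definition strict_lower :: "complex mat \<Rightarrow> bool" where
  "strict_lower A \<longleftrightarrow> A \<in> R \<and> (\<forall>a<n. \<forall>b<n. bl a \<le> bl b \<longrightarrow> A $$ (a, b) = 0)"

definition SU :: "complex mat \<Rightarrow> complex mat" where
  "SU A = mat n n (\<lambda>(a, b). if bl a < bl b then A $$ (a, b) else 0)"

lemma SU_closed [simp]: "SU A \<in> R" by (simp add: SU_def)

lemma SU_entry: "a < n \<Longrightarrow> b < n \<Longrightarrow> SU A $$ (a, b) = (if bl a < bl b then A $$ (a, b) else 0)"
  by (simp add: SU_def)

lemma SU_SU [simp]: "SU (SU A) = SU A"
  by (rule add_eqI) (auto simp: SU_entry)

lemma lower_iff: "lower A \<longleftrightarrow> A \<in> R \<and> (\<forall>k. D k * A * E k = Z)"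
proof (cases "A \<in> R")
  case True
  have "D k * A * E k = Z \<longleftrightarrow> (\<forall>a<n. \<forall>b<n. bl a < k \<and> k \<le> bl b \<longrightarrow> A $$ (a, b) = 0)" for k
  proof -
    have "D k * A * E k = Z \<longleftrightarrow> (\<forall>a<n. \<forall>b<n. (D k * A * E k) $$ (a, b) = 0)"
      using True by (auto intro!: add_eqI simp: entries)
    then show ?thesis using True by (auto simp: proj_mult_entry)
  qed
  then have "(\<forall>k. D k * A * E k = Z) \<longleftrightarrow> (\<forall>k. \<forall>a<n. \<forall>b<n. bl a < k \<and> k \<le> bl b \<longrightarrow> A $$ (a, b) = 0)" by simp
  also have "\<dots> \<longleftrightarrow> (\<forall>a<n. \<forall>b<n. bl a < bl b \<longrightarrow> A $$ (a, b) = 0)"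
    by (meson le_refl order.strict_trans2)
  finally show ?thesis using True unfolding lower_def by simp
qed (simp add: lower_def)

text \<open>An injective endomorphism of the span of the blocks from \<open>k\<close> on is onto, so
  the inverse preserves this span too; \<open>corner_inverse_commute\<close> takes the place of the
  dimension argument.\<close>

lemma lower_inverse:
  assumes u: "unit_pair u v" and "lower u" shows "lower v"
  unfolding lower_iff
proof (intro conjI allI)
  have [simp]: "u \<in> R" "v \<in> R" and uv: "u * v = I" "v * u = I" using u by (auto simp: unit_pair_def)
  show "v \<in> R" by simp
  fix k
  have uE: "E k * (u * E k) = u * E k"
    using split_left[of "u * E k" k] assms(2) by (simp add: lower_iff mult_assoc)
  define X where "X = E k * u * E k"
  define Y where "Y = E k * v * E k"
  have [simp]: "X \<in> R" "Y \<in> R" by (simp_all add: X_def Y_def)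
  have "Y * X = E k"
    by (simp add: X_def Y_def mult_assoc assoc_eq[OF DE_mult(2)] uE assoc_eq[OF uv(2)] DE_mult)
  then have XY: "X * Y = E k"
    by (rule corner_inverse_commute[rotated 6])
       (simp_all add: X_def Y_def mult_assoc DE_mult assoc_eq[OF DE_mult(2)])
  have uE': "E k * (u * (E k * W)) = u * (E k * W)" if "W \<in> R" for W
  proof -
    have "(E k * (u * E k)) * W = (u * E k) * W" by (simp only: uE)
    then show ?thesis using that by (simp add: mult_assoc)
  qed
  have "D k * v * E k = v * E k - E k * (v * E k)"
    using split_left[of "v * E k" k] by (intro eq_diffI) (simp_all add: mult_assoc)
  then have "u * (D k * v * E k) = E k - u * (E k * (v * E k))"
    by (simp add: ring_simps assoc_eq[OF uv(1)])
  also have "u * (E k * (v * E k)) = X * Y"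
    by (simp add: X_def Y_def mult_assoc assoc_eq[OF DE_mult(2)] uE')
  finally have "v * (u * (D k * v * E k)) = v * Z" by (simp add: XY)
  then show "D k * v * E k = Z" by (simp add: assoc_eq[OF uv(2)])
qed

end

section \<open>The parameter matrices\<close>

lemma offset_drop: "Suc k + l \<le> length ns \<Longrightarrow>
  block_offset ns (Suc k + l) = block_offset ns (Suc k) + block_offset (drop (Suc k) ns) l"
  by (simp only: block_offset_def take_add sum_list_append)

lemma block_of_drop:
  assumes "k < length ns" "c < sum_list (drop (Suc k) ns)"
  shows "block_of ns (block_offset ns (Suc k) + c) = Suc k + block_of (drop (Suc k) ns) c"
proof (rule block_of_eqI)
  let ?l = "block_of (drop (Suc k) ns) c"
  note b = block_of_bounds[OF assms(2)]
  have l: "Suc k + Suc ?l \<le> length ns" using b(1) assms(1) by simp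
  show "block_offset ns (Suc k + ?l) \<le> block_offset ns (Suc k) + c"
    using b(2) offset_drop[of k ?l ns] l by simp
  show "block_offset ns (Suc k) + c < block_offset ns (Suc (Suc k + ?l))"
    using b(3) offset_drop[OF l] by simp
qed

lemma sum_list_drop: "block_offset ns k + sum_list (drop k ns) = sum_list ns"
  unfolding block_offset_def by (metis append_take_drop_id sum_list_append)

section \<open>Parameters assembled into full matrices\<close>

context jordan_data
begin

abbreviation bl where "bl \<equiv> block_of ns"
abbreviation off where "off \<equiv> block_offset ns"

lemma sum_list_ns: "sum_list ns = N" by (simp add: N_def)

definition P_mat :: "params \<Rightarrow> complex mat" where
  "P_mat x = mat N N (\<lambda>(a, b). if bl a < bl b then fst x (bl a, bl b) $$ (a - off (bl a), b - off (bl b)) else 0)"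

text \<open>Since \<open>Q\<close> is affine in the parameters, the same function gives
  \<open>Q - I\<close> at a point and \<open>dQ\<close> on a tangent vector.\<close>

definition L_mat :: "params \<Rightarrow> complex mat" where
  "L_mat x = mat N N (\<lambda>(a, b). if bl b < bl a then snd x (bl a, bl b) $$ (a - off (bl a), b - off (bl b)) else 0)"

definition Lam :: "complex mat" where
  "Lam = mat N N (\<lambda>(a, b). if a = b then lam ! bl a else 0)"

lemma mats_closed [simp]: "P_mat x \<in> R" "L_mat x \<in> R" "Lam \<in> R" "Q_mat ns x \<in> R" "rho_mat ns lam x \<in> R"
  by (simp_all add: P_mat_def L_mat_def Lam_def Q_mat_def rho_mat_def block_mat_def sum_list_ns)

lemma SU_P [simp]: "SU (P_mat x) = P_mat x"
  by (rule add_eqI) (auto simp: SU_entry P_mat_def)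

lemma strict_lower_L: "strict_lower (L_mat x)"
  by (auto simp: strict_lower_def L_mat_def)

lemma bl_bounds:
  assumes "a < N"
  shows "bl a < length ns" "off (bl a) \<le> a" "a < off (Suc (bl a))" "a - off (bl a) < ns ! bl a"
  using block_of_bounds[of a ns] block_rest[of a ns] assms by (simp_all add: sum_list_ns)

lemma Q_mat_eq: "Q_mat ns x = I + L_mat x"
proof (rule add_eqI)
  fix a b assume ab: "a < N" "b < N"
  have eq: "bl a = bl b \<Longrightarrow> a - off (bl a) = b - off (bl b) \<longleftrightarrow> a = b"
    using bl_bounds[OF ab(1)] bl_bounds[OF ab(2)] by auto
  have "a = b \<Longrightarrow> bl a = bl b" by simp
  then show "Q_mat ns x $$ (a, b) = (I + L_mat x) $$ (a, b)"
    using ab eq bl_bounds[OF ab(1)] bl_bounds[OF ab(2)]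
    by (auto simp: Q_mat_def block_mat_def sum_list_ns L_mat_def)
qed simp_all

text \<open>Block row \<open>k\<close> of \<open>P_mat x\<close> vanishes up to block
  \<open>k\<close>, so in the product with \<open>Q\<close> it meets only the rows of
  \<open>Q\<close> after block \<open>k\<close>; its part right of the diagonal is therefore
  \<open>p_row\<close> times the lower corner.\<close>

lemma rho_mat_eq: "rho_mat ns lam x = Lam + SU (P_mat x * Q_mat ns x)"
proof (rule add_eqI)
  fix a b assume ab: "a < N" "b < N"
  define k where "k = bl a"
  define l where "l = bl b"
  have k: "k < length ns" "a - off k < ns ! k" and l: "l < length ns" "b - off l < ns ! l" "off l \<le> b"
    using bl_bounds[OF ab(1)] bl_bounds[OF ab(2)] by (simp_all add: k_def l_def)
  have lhs: "rho_mat ns lam x $$ (a, b) = (if k = l then (lam ! k) \<cdot>\<^sub>m 1\<^sub>m (ns ! k)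
     else if k < l then rho_block ns x k l else 0\<^sub>m (ns ! k) (ns ! l)) $$ (a - off k, b - off l)"
    using ab by (simp add: rho_mat_def block_mat_def sum_list_ns k_def l_def)
  have "rho_mat ns lam x $$ (a, b) = Lam $$ (a, b) + SU (P_mat x * Q_mat ns x) $$ (a, b)"
  proof (cases "k < l")
    case False
    have "k = l \<Longrightarrow> a - off k = b - off l \<longleftrightarrow> a = b" "a = b \<Longrightarrow> k = l"
      using bl_bounds[OF ab(1)] bl_bounds[OF ab(2)] by (auto simp: k_def l_def)
    then show ?thesis unfolding lhs
      using False k l ab by (auto simp: SU_entry Lam_def k_def[symmetric] l_def[symmetric])
  next
    case True
    \<comment> \<open>\<open>d\<close> is the first column to the right of block \<open>k\<close>;
      \<open>p_row\<close> and \<open>lower_corner\<close> count their columns from there.\<close>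
    define d where "d = off (Suc k)"
    let ?ds = "drop (Suc k) ns"
    have d: "d + sum_list ?ds = N" using sum_list_drop[of ns "Suc k"] by (simp add: d_def sum_list_ns)
    have dl: "d \<le> off l" unfolding d_def using block_offset_mono[of "Suc k" l ns] True by simp
    have "off l = d + block_offset ?ds (l - Suc k)"
      using offset_drop[of k "l - Suc k" ns] True l by (simp add: d_def)
    then have col: "block_offset ?ds (l - Suc k) + (b - off l) = b - d" using l by simp
    have db: "d \<le> b" "b - d < N - d" using dl l ab by auto
    define C where "C = lower_corner ns (Q_mat ns x) (length ns - Suc k)"
    have C: "C \<in> carrier_mat (N - d) (N - d)" "\<And>i j. i < N - d \<Longrightarrow> j < N - d \<Longrightarrow> C $$ (i, j) = Q_mat ns x $$ (d + i, d + j)"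
      using k(1) carrier_matD[OF mats_closed(4), of x] by (auto simp: C_def lower_corner_def Let_def d_def)
    have pr: "p_row ns x k \<in> carrier_mat (ns ! k) (N - d)" using d by (auto simp: p_row_def block_mat_def)
    have p: "p_row ns x k $$ (a - off k, c) = P_mat x $$ (a, d + c)" if c: "c < N - d" for c
    proof -
      have "a - off k < sum_list [ns ! k]" using k by simp
      from block_of_bounds(1)[OF this] have b0: "block_of [ns ! k] (a - off k) = 0" by simp
      have c': "c < sum_list ?ds" using c d by simp
      have bc: "bl (d + c) = Suc k + block_of ?ds c" using block_of_drop[OF k(1) c'] by (simp add: d_def)
      have "Suc k + block_of ?ds c \<le> length ns" using block_of_bounds(1)[OF c'] by simp
      then have oc: "off (bl (d + c)) = d + block_offset ?ds (block_of ?ds c)"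
        unfolding bc using offset_drop[of k "block_of ?ds c" ns] by (simp add: d_def)
      have "p_row ns x k $$ (a - off k, c) = fst x (k, bl (d + c)) $$ (a - off k, c - block_offset ?ds (block_of ?ds c))"
        using k c' by (simp add: p_row_def block_mat_def b0 bc)
      also have "\<dots> = P_mat x $$ (a, d + c)"
        using ab c bc oc by (simp add: P_mat_def k_def[symmetric])
      finally show ?thesis .
    qed
    have "rho_mat ns lam x $$ (a, b) = rho_row ns x k $$ (a - off k, b - d)"
      unfolding lhs using True k l by (simp add: rho_block_def col)
    also have "\<dots> = (\<Sum>c<N - d. p_row ns x k $$ (a - off k, c) * C $$ (c, b - d))"
      unfolding rho_row_def C_def[symmetric] using k db pr C(1)
      by (subst index_mult_mat(1)) (auto simp: scalar_prod_def lessThan_atLeast0 intro!: sum.cong)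
    also have "\<dots> = (\<Sum>c<N - d. P_mat x $$ (a, d + c) * Q_mat ns x $$ (d + c, b))"
      using db C(2) p by (intro sum.cong) auto
    also have "\<dots> = (\<Sum>c\<in>{d..<N}. P_mat x $$ (a, c) * Q_mat ns x $$ (c, b))"
      by (rule sum.reindex_bij_witness[of _ "\<lambda>c. c - d" "\<lambda>c. d + c"]) auto
    also have "\<dots> = (\<Sum>c<N. P_mat x $$ (a, c) * Q_mat ns x $$ (c, b))"
    proof (rule sum.mono_neutral_left)
      have "P_mat x $$ (a, c) = 0" if "c < N" "c < d" for c
      proof -
        have "\<not> Suc k \<le> bl c"
          using bl_bounds(2)[OF that(1)] that(2) block_offset_mono[of "Suc k" "bl c" ns] by (auto simp: d_def)
        then show ?thesis using that ab by (simp add: P_mat_def k_def)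
      qed
      then show "\<forall>i\<in>{..<N} - {d..<N}. P_mat x $$ (a, i) * Q_mat ns x $$ (i, b) = 0" by auto
    qed auto
    also have "\<dots> = SU (P_mat x * Q_mat ns x) $$ (a, b)"
      using ab True by (simp add: SU_entry mult_entry k_def l_def)
    finally show ?thesis using True ab by (auto simp: Lam_def k_def l_def)
  qed
  then show "rho_mat ns lam x $$ (a, b) = (Lam + SU (P_mat x * Q_mat ns x)) $$ (a, b)"
    using ab by (simp add: entries)
qed simp_all

lemma det_Q_mat: "det (Q_mat ns x) = 1"
proof -
  have e: "Q_mat ns x $$ (a, b) = (if a = b then 1 else 0)" if "a \<le> b" "b < N" for a b
    using that bl_mono[OF that] by (simp add: Q_mat_eq entries L_mat_def)
  have d: "dim_row (Q_mat ns x) = N" using carrier_matD(1)[OF mats_closed(4)] .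
  have "det (Q_mat ns x) = prod_list (diag_mat (Q_mat ns x))"
    by (rule det_lower_triangular[of N]) (simp_all add: e)
  also have "\<dots> = 1" by (rule prod_list_neutral) (auto simp: diag_mat_def d e)
  finally show ?thesis .
qed

text \<open>The adjugate is the inverse because the determinant is 1; this keeps its entries
  polynomial in the parameters.\<close>

definition Qi_mat :: "params \<Rightarrow> complex mat" where
  "Qi_mat x = adj_mat (Q_mat ns x)"

lemma Q_unit: "unit_pair (Q_mat ns x) (Qi_mat x)"
proof -
  have "(1 :: complex) \<cdot>\<^sub>m adj_mat (Q_mat ns x) = adj_mat (Q_mat ns x)" by (rule eq_matI) auto
  then show ?thesis using det_unit[of "Q_mat ns x"] by (simp add: det_Q_mat Qi_mat_def)
qed

lemma Qi_closed [simp]: "Qi_mat x \<in> R" using Q_unit by (simp add: unit_pair_def)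

lemma lower_Q: "lower (Q_mat ns x)"
  by (auto simp: lower_def Q_mat_eq entries L_mat_def)

lemma lower_Qi: "lower (Qi_mat x)"
  by (rule lower_inverse[OF Q_unit lower_Q])

lemma param_map_eq: "param_map ns lam x = Q_mat ns x * rho_mat ns lam x * Qi_mat x"
  unfolding param_map_def by (rule conj_by_eq[OF Q_unit])

lemma triangular_rho: "triangular (rho_mat ns lam x)"
  unfolding triangular_iff_entries by (auto simp: rho_mat_eq entries SU_entry Lam_def)

lemma triangular_eq: assumes "triangular \<rho>" shows "\<rho> = Lam + SU \<rho>"
  using triangular_closed[OF assms] by (intro add_eqI) (auto simp: entries SU_entry Lam_def triangular_entry[OF assms])

definition mk_params :: "complex mat \<Rightarrow> complex mat \<Rightarrow> params" where
  "mk_params P L =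
    (restrict (\<lambda>(j, i). mat (ns ! j) (ns ! i) (\<lambda>(s, t). P $$ (off j + s, off i + t))) (upper_pos ns),
     restrict (\<lambda>(i, j). mat (ns ! i) (ns ! j) (\<lambda>(t, s). L $$ (off i + t, off j + s))) (lower_pos ns))"

lemma mk_params_space: "mk_params P L \<in> param_space ns"
  unfolding mk_params_def param_space_def by (auto simp: PiE_def)

lemma off_less: "k < length ns \<Longrightarrow> s < ns ! k \<Longrightarrow> off k + s < N" "k < length ns \<Longrightarrow> s < ns ! k \<Longrightarrow> bl (off k + s) = k"
  using offset_less[of k ns s] block_of_offset[of k ns s] by (simp_all add: sum_list_ns)

lemma mk_params_mats:
  assumes "P \<in> R" "SU P = P" shows "P_mat (mk_params P L) = P"
    and "strict_lower L \<Longrightarrow> L_mat (mk_params P L) = L"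
proof -
  show "P_mat (mk_params P L) = P"
  proof (rule add_eqI)
    fix a b assume ab: "a < N" "b < N"
    have "P $$ (a, b) = (if bl a < bl b then P $$ (a, b) else 0)" using SU_entry[OF ab, of P] assms by simp
    then show "P_mat (mk_params P L) $$ (a, b) = P $$ (a, b)"
      using ab bl_bounds[OF ab(1)] bl_bounds[OF ab(2)] by (cases "bl a < bl b") (simp_all add: P_mat_def mk_params_def upper_pos_def)
  qed (simp_all add: assms)
  assume L: "strict_lower L"
  show "L_mat (mk_params P L) = L"
  proof (rule add_eqI)
    fix a b assume ab: "a < N" "b < N"
    have "L $$ (a, b) = (if bl b < bl a then L $$ (a, b) else 0)" using L ab by (auto simp: strict_lower_def)
    then show "L_mat (mk_params P L) $$ (a, b) = L $$ (a, b)"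
      using ab bl_bounds[OF ab(1)] bl_bounds[OF ab(2)] by (cases "bl b < bl a") (simp_all add: L_mat_def mk_params_def lower_pos_def)
  qed (use L in \<open>simp_all add: strict_lower_def\<close>)
qed

lemma coords_eq:
  assumes "j < i" "i < length ns" "s < ns ! j" "t < ns ! i"
  shows "p_coord j i s t x = P_mat x $$ (off j + s, off i + t)"
    and "q_coord i j t s x = L_mat x $$ (off i + t, off j + s)"
  using assms off_less[of i t] off_less[of j s] by (simp_all add: P_mat_def L_mat_def p_coord_def q_coord_def)

lemma params_eqI:
  assumes x: "x \<in> param_space ns" and y: "y \<in> param_space ns" and eq: "P_mat x = P_mat y" "L_mat x = L_mat y"
  shows "x = y"
proof (rule prod_eqI)
  have c: "p_coord j i s t x = p_coord j i s t y" "q_coord i j t s x = q_coord i j t s y"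
    if "j < i" "i < length ns" "s < ns ! j" "t < ns ! i" for i j s t
    using coords_eq[OF that] eq by simp_all
  show "fst x = fst y"
  proof
    fix e :: "nat \<times> nat"
    obtain j i where e: "e = (j, i)" by force
    show "fst x e = fst y e"
    proof (cases "e \<in> upper_pos ns")
      case True
      then have "fst x e \<in> carrier_mat (ns ! j) (ns ! i)" "fst y e \<in> carrier_mat (ns ! j) (ns ! i)"
        using x y unfolding param_space_def e by (auto simp: PiE_def Pi_def)
      then show ?thesis using c(1)[of j i] True by (intro eq_matI) (auto simp: e upper_pos_def p_coord_def)
    next
      case False
      then show ?thesis using x y unfolding param_space_def e by (auto simp: PiE_def extensional_def)
    qed
  qed
  show "snd x = snd y"
  proof
    fix e :: "nat \<times> nat"
    obtain i j where e: "e = (i, j)" by force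
    show "snd x e = snd y e"
    proof (cases "e \<in> lower_pos ns")
      case True
      then have "snd x e \<in> carrier_mat (ns ! i) (ns ! j)" "snd y e \<in> carrier_mat (ns ! i) (ns ! j)"
        using x y unfolding param_space_def e by (auto simp: PiE_def Pi_def)
      then show ?thesis using c(2)[of j i] True by (intro eq_matI) (auto simp: e lower_pos_def q_coord_def)
    next
      case False
      then show ?thesis using x y unfolding param_space_def e by (auto simp: PiE_def extensional_def)
    qed
  qed
qed

text \<open>Since \<open>B\<close> is lower, an entry of the product in block column
  \<open>l\<close> meets only columns of \<open>A\<close> in blocks from \<open>l\<close> on; for a
  row in a block before \<open>l\<close> the truncation of \<open>A\<close> changes nothing
  there.\<close>

lemma strict_upper_shift:
  assumes [simp]: "A \<in> R" and B: "lower B"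
  shows "SU (SU A * B) = SU (A * B)"
proof (rule add_eqI)
  have [simp]: "B \<in> R" using B by (simp add: lower_def)
  fix a b assume ab: "a < N" "b < N"
  have "(\<Sum>c<N. SU A $$ (a, c) * B $$ (c, b)) = (\<Sum>c<N. A $$ (a, c) * B $$ (c, b))" if "bl a < bl b"
    using B ab that by (intro sum.cong) (auto simp: SU_entry lower_def not_less)
  then show "SU (SU A * B) $$ (a, b) = SU (A * B) $$ (a, b)"
    using ab by (simp add: SU_entry mult_entry)
qed simp_all

text \<open>Recovers \<open>p\<close> from \<open>\<rho>\<close> at fixed \<open>q\<close>: by
  \<open>strict_upper_shift\<close> the truncation inside \<open>\<rho>\<close> becomes invisible
  after multiplication by the lower matrix \<open>Qi_mat x\<close>, which cancels
  \<open>Q\<close>.\<close>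

lemma P_mat_from_rho: "P_mat x = SU (SU (rho_mat ns lam x) * Qi_mat x)"
proof -
  have Q: "Q_mat ns x * Qi_mat x = I" using Q_unit by (simp add: unit_pair_def)
  have "SU (rho_mat ns lam x) = SU (P_mat x * Q_mat ns x)"
    by (rule add_eqI) (auto simp: SU_entry rho_mat_eq entries Lam_def)
  then have "SU (SU (rho_mat ns lam x) * Qi_mat x) = SU (P_mat x * Q_mat ns x * Qi_mat x)"
    using strict_upper_shift[OF _ lower_Qi] by simp
  also have "\<dots> = P_mat x" by (simp add: mult_assoc Q)
  finally show ?thesis by simp
qed

lemma param_of_rho:
  assumes L: "strict_lower L" and \<rho>: "triangular \<rho>"
  obtains x where "x \<in> param_space ns" "Q_mat ns x = I + L" "rho_mat ns lam x = \<rho>"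
proof -
  have [simp]: "L \<in> R" "\<rho> \<in> R" using L \<rho> by (simp_all add: strict_lower_def)
  \<comment> \<open>The inverse of \<open>I + L\<close> does not involve \<open>P\<close>, so it may
    be computed from parameters with \<open>P = Z\<close> before the right \<open>P\<close> is
    known.\<close>
  define Qi where "Qi = Qi_mat (mk_params Z L)"
  define x where "x = mk_params (SU (SU \<rho> * Qi)) L"
  have [simp]: "Qi \<in> R" by (simp add: Qi_def)
  have "SU Z = Z" by (rule add_eqI) (auto simp: SU_entry)
  then have L0: "L_mat (mk_params Z L) = L" using mk_params_mats(2)[OF _ _ L] by simp
  have x: "P_mat x = SU (SU \<rho> * Qi)" "L_mat x = L" unfolding x_def
    by (rule mk_params_mats; simp add: L)+
  have QL: "Q_mat ns x = I + L" by (simp add: Q_mat_eq x)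
  have Qi: "Qi_mat x = Qi" by (simp add: Qi_def Qi_mat_def Q_mat_eq x L0)
  have QiQ: "Qi * Q_mat ns x = I" using Q_unit[of x] by (simp add: unit_pair_def Qi)
  have "SU (P_mat x * Q_mat ns x) = SU (SU \<rho> * Qi * Q_mat ns x)"
    unfolding x(1) by (rule strict_upper_shift[OF _ lower_Q]) simp
  also have "\<dots> = SU \<rho>" by (simp add: mult_assoc QiQ)
  finally have "rho_mat ns lam x = \<rho>" using triangular_eq[OF \<rho>] by (simp add: rho_mat_eq)
  then show ?thesis using that[OF _ QL] mk_params_space by (simp add: x_def)
qed

end

section \<open>Points of the orbit in the big cell\<close>

context jordan_data
begin

declare pp.simps(2) [simp del]

lemma J_closed [simp]: "J \<in> R" and dim_J: "dim_row J = N"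
proof -
  show "dim_row J = N" using generic_representative by blast
  then show "J \<in> R" using jordan_matrix_carrier[of n_as] by simp
qed

lemma orbit_closed: "A \<in> orbit J \<Longrightarrow> A \<in> R"
  unfolding orbit_iff[OF J_closed] by (auto simp: unit_pair_def)

lemma generic_in_orbit: obtains \<rho> where "generic \<rho>" "\<rho> \<in> orbit J"
proof -
  obtain \<rho> g g' where "generic \<rho>" "unit_pair g g'" "\<rho> = g * J * g'" by (rule generic_representative)
  then show ?thesis using that orbit_iff[OF J_closed] by blast
qed

lemma orbit_conjugate:
  assumes "A \<in> orbit J" "B \<in> orbit J" obtains h h' where "unit_pair h h'" "A = h * B * h'"
proof -
  obtain g g' where g: "unit_pair g g'" "A = g * J * g'" using assms(1) orbit_iff[OF J_closed] by blast
  obtain k k' where k: "unit_pair k k'" "B = k * J * k'" using assms(2) orbit_iff[OF J_closed] by blast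
  have [simp]: "k \<in> R" "k' \<in> R" and kk: "k' * k = I" using k(1) by (auto simp: unit_pair_def)
  have "k' * B * k = J" by (simp add: k(2) mult_assoc kk assoc_eq[OF kk])
  then have "A = (g * k') * B * (k * g')"
    using conj_conj[OF unit_pair_sym[OF k(1)] g(1) orbit_closed[OF assms(2)]] g(2) by simp
  then show ?thesis using that[OF unit_pair_mult[OF g(1) unit_pair_sym[OF k(1)]]] by simp
qed

text \<open>Genericity singles out one conjugacy class among the triangular matrices:
  \<open>generic_similar\<close> gives one direction, \<open>generic_conjugate\<close> against a
  generic representative in the orbit the other.\<close>

lemma triangular_orbit_iff: assumes "triangular \<rho>" shows "\<rho> \<in> orbit J \<longleftrightarrow> generic \<rho>"
proof -
  obtain \<rho>0 where \<rho>0: "generic \<rho>0" "\<rho>0 \<in> orbit J" by (rule generic_in_orbit)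
  show ?thesis
  proof
    assume "\<rho> \<in> orbit J"
    then obtain h h' where "unit_pair h h'" "\<rho> = h * \<rho>0 * h'" using orbit_conjugate \<rho>0(2) by blast
    then show "generic \<rho>" using generic_similar[OF \<rho>0(1) assms] by blast
  next
    assume "generic \<rho>"
    then obtain h h' where h: "unit_pair h h'" "h * \<rho>0 = \<rho> * h" using generic_conjugate[OF _ \<rho>0(1)] by blast
    then have [simp]: "h \<in> R" "h' \<in> R" "\<rho> \<in> R" and "h * h' = I" using assms by (auto simp: unit_pair_def)
    then have "h * \<rho>0 * h' = \<rho>" by (simp add: h(2) mult_assoc)
    then show "\<rho> \<in> orbit J" using orbit_conj[OF J_closed \<rho>0(2) h(1)] by simp
  qed
qed

text \<open>Its determinant tests \<open>pp A k\<close> for injectivity on the span of the blocks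
  from \<open>k\<close> on: the multiplier \<open>C\<close> plays the role of the choice of a minor,
  and \<open>D k\<close> fills up the complementary corner.\<close>

definition cell_mat :: "complex mat \<Rightarrow> nat \<Rightarrow> complex mat \<Rightarrow> complex mat" where
  "cell_mat A k C = E k * C * pp A k * E k + D k"

text \<open>Expresses that the kernel of \<open>pp A k\<close> meets the span of the blocks from
  \<open>k\<close> on only in 0. Written as a nonvanishing determinant for some \<open>C\<close>,
  this is visibly a Zariski open condition.\<close>

definition cell :: "complex mat \<Rightarrow> nat \<Rightarrow> bool" where
  "cell A k \<longleftrightarrow> (\<exists>C\<in>R. det (cell_mat A k C) \<noteq> 0)"

text \<open>The inverse of the cell matrix turns \<open>C\<close> into a true left inverse; for a
  true left inverse \<open>C\<close>, the cell matrix is the identity.\<close>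

lemma cell_iff: assumes [simp]: "A \<in> R" shows "cell A k \<longleftrightarrow> (\<exists>C\<in>R. C * pp A k * E k = E k)"
proof
  assume "cell A k"
  then obtain C where [simp]: "C \<in> R" and d: "det (cell_mat A k C) \<noteq> 0" by (auto simp: cell_def)
  define B where "B = cell_mat A k C"
  have [simp]: "B \<in> R" by (simp add: B_def cell_mat_def)
  obtain V where V: "unit_pair B V" using det_unit[OF \<open>B \<in> R\<close>] d[folded B_def] by blast
  then have [simp]: "V \<in> R" and VB: "V * B = I" by (auto simp: unit_pair_def)
  have "B * E k = E k * C * pp A k * E k"
    by (simp add: B_def cell_mat_def ring_simps DE_mult)
  then have "(V * E k * C) * pp A k * E k = V * B * E k" by (simp add: mult_assoc)
  then show "\<exists>C\<in>R. C * pp A k * E k = E k" by (intro bexI[of _ "V * E k * C"]) (simp_all add: VB)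
next
  assume "\<exists>C\<in>R. C * pp A k * E k = E k"
  then obtain C where [simp]: "C \<in> R" and C: "C * pp A k * E k = E k" by blast
  have "E k * C * pp A k * E k = E k * (C * pp A k * E k)" by (simp add: mult_assoc)
  also have "\<dots> = E k" unfolding C by (simp add: DE_mult)
  finally have "cell_mat A k C = I"
    unfolding cell_mat_def using DE(1)[of k] comm_add_mat[of "E k" N N "D k"] by simp
  then show "cell A k" unfolding cell_def by (intro bexI[of _ C]) simp_all
qed

lemma generic_iff_cell: assumes "triangular \<rho>" shows "generic \<rho> \<longleftrightarrow> (\<forall>k<Suc (length lam). cell \<rho> k)"
proof -
  have "C * pp \<rho> k * E k = C * pp \<rho> k" if "k \<le> length lam" "C \<in> R" for C k
    using triangular_pp(2)[OF assms that(1)] that assms by (simp add: mult_assoc)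
  then show ?thesis
    unfolding generic_def using assms cell_iff[OF triangular_closed[OF assms]] by (simp add: less_Suc_eq_le)
qed

section \<open>The parameter domain and the big cell\<close>

definition param_dom :: "params set" where
  "param_dom = {x \<in> param_space ns. param_map ns lam x \<in> orbit J}"

definition big_cell :: "complex mat set" where
  "big_cell = {A \<in> orbit J. \<forall>k<Suc (length lam). cell A k}"

lemma param_map_orbit_iff: "param_map ns lam x \<in> orbit J \<longleftrightarrow> generic (rho_mat ns lam x)"
proof -
  let ?Q = "Q_mat ns x" and ?Qi = "Qi_mat x" and ?r = "rho_mat ns lam x"
  have Q: "?Qi * ?Q = I" using Q_unit by (simp add: unit_pair_def)
  have "?Qi * param_map ns lam x * ?Q = ?r"
    by (simp add: param_map_eq mult_assoc Q assoc_eq[OF Q])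
  then have "param_map ns lam x \<in> orbit J \<Longrightarrow> ?r \<in> orbit J"
    using orbit_conj[OF J_closed _ unit_pair_sym[OF Q_unit]] by metis
  moreover have "?r \<in> orbit J \<Longrightarrow> param_map ns lam x \<in> orbit J"
    using orbit_conj[OF J_closed _ Q_unit] by (simp add: param_map_eq)
  ultimately show ?thesis using triangular_orbit_iff[OF triangular_rho] by blast
qed

lemma param_dom_cells: "param_dom = {x \<in> param_space ns. \<forall>k<Suc (length lam). cell (rho_mat ns lam x) k}"
  by (simp add: param_dom_def param_map_orbit_iff generic_iff_cell[OF triangular_rho])

lemma lower_E: assumes "lower B" shows "E k * (B * E k) = B * E k"
proof -
  have [simp]: "B \<in> R" and "D k * B * E k = Z" using assms by (simp_all add: lower_iff)
  then have "D k * (B * E k) = Z" by (simp add: mult_assoc)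
  then show ?thesis using split_left[of "B * E k" k] by simp
qed

lemma lower_E_mult: assumes "lower B" and [simp]: "X \<in> R" shows "E k * (B * (E k * X)) = B * (E k * X)"
proof -
  have [simp]: "B \<in> R" using assms by (simp add: lower_def)
  have "(E k * (B * E k)) * X = (B * E k) * X" by (simp only: lower_E[OF assms(1)])
  then show ?thesis by (simp add: mult_assoc)
qed

text \<open>\<open>Q\<close> and its inverse preserve the span of the blocks from \<open>k\<close>
  on, so a left inverse \<open>C\<close> for \<open>\<rho>\<close> is transported to the left
  inverse \<open>E k * Q * C * Qi\<close> for \<open>A\<close>.\<close>

lemma param_map_big_cell: assumes "x \<in> param_dom" shows "param_map ns lam x \<in> big_cell"
proof -
  let ?Q = "Q_mat ns x" and ?Qi = "Qi_mat x" and ?r = "rho_mat ns lam x"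
  have A: "param_map ns lam x \<in> orbit J" using assms by (simp add: param_dom_def)
  have QQ: "?Q * ?Qi = I" "?Qi * ?Q = I" using Q_unit by (simp_all add: unit_pair_def)
  have "cell (param_map ns lam x) k" if "k < Suc (length lam)" for k
  proof -
    have "cell ?r k" using assms that by (simp add: param_dom_cells)
    then obtain C where [simp]: "C \<in> R" and C: "C * pp ?r k * E k = E k" using cell_iff[of ?r] by auto
    have P: "pp ?r k * E k = pp ?r k" using triangular_pp(2)[OF triangular_rho] that by simp
    have C: "C * pp ?r k = E k" using C by (simp add: mult_assoc P)
    have PA: "pp (param_map ns lam x) k = ?Q * pp ?r k * ?Qi"
      unfolding param_map_eq by (rule pp_conj[OF Q_unit]) simp
    have "E k * ?Q * C * ?Qi * pp (param_map ns lam x) k * E k = E k * (?Q * (E k * (?Qi * E k)))"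
      by (simp add: PA mult_assoc assoc_eq[OF QQ(2)] assoc_eq[OF C])
    also have "\<dots> = E k" by (simp add: lower_E[OF lower_Qi] assoc_eq[OF QQ(1)] DE_mult)
    finally have "(E k * ?Q * C * ?Qi) * pp (param_map ns lam x) k * E k = E k" .
    moreover have "E k * ?Q * C * ?Qi \<in> R" by simp
    ultimately show ?thesis unfolding cell_iff[OF orbit_closed[OF A]] by blast
  qed
  then show ?thesis using A by (simp add: big_cell_def)
qed

text \<open>Block column \<open>k\<close> of \<open>Q\<close> lies in the kernel of \<open>pp A (Suc k)\<close> and has known first blocks;
  this determines it by Cramer's rule.\<close>

lemma Q_column:
  fixes x
  assumes k: "k < length lam" and [simp]: "C \<in> R"
  defines "A \<equiv> param_map ns lam x"
  shows "cell_mat A (Suc k) C * (Q_mat ns x * S k) =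
    (D (Suc k) - E (Suc k) * C * pp A (Suc k) * D (Suc k)) * S k"
proof -
  let ?Q = "Q_mat ns x" and ?Qi = "Qi_mat x" and ?r = "rho_mat ns lam x"
  let ?P = "pp A (Suc k)" and ?E = "E (Suc k)" and ?D = "D (Suc k)"
  have QQ: "?Qi * ?Q = I" using Q_unit by (simp add: unit_pair_def)
  have [simp]: "A \<in> R" by (simp add: A_def param_map_eq)
  have "?D * L_mat x * S k = Z"
    using strict_lower_L[of x] by (intro add_eqI) (auto simp: proj_mult_entry strict_lower_def entries)
  then have DQ: "?D * (?Q * S k) = S k" by (simp add: Q_mat_eq ring_simps DE_mult)
  have PA: "?P = ?Q * pp ?r (Suc k) * ?Qi"
    unfolding A_def param_map_eq by (rule pp_conj[OF Q_unit]) simp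
  have "?P * (?Q * S k) = ?Q * (pp ?r (Suc k) * ?D) * S k"
    by (simp add: PA mult_assoc QQ assoc_eq[OF QQ] DE_mult)
  also have "\<dots> = Z" using triangular_pp(1)[OF triangular_rho, of "Suc k" x] k by simp
  finally have PQ: "?P * (?Q * S k) = Z" .
  define V where "V = ?Q * S k"
  define W where "W = ?E * C * ?P"
  have [simp]: "V \<in> R" "W \<in> R" by (simp_all add: V_def W_def)
  have "W * V = Z" using PQ by (simp add: V_def W_def mult_assoc)
  then have "W * (?D * V) + W * (?E * V) = Z"
    using split_left[of V "Suc k"] by (simp flip: distribs)
  then have "W * (?E * V) = Z - W * S k"
    using DQ by (intro eq_diffI) (simp_all add: V_def comm_add_mat[of "W * (?E * (?Q * S k))" N N])
  then have "cell_mat A (Suc k) C * V = S k - W * S k"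
    using DQ unfolding cell_mat_def W_def[symmetric]
    by (simp add: ring_simps V_def[symmetric]) (rule add_eqI, simp_all add: entries)
  also have "\<dots> = (?D - W * ?D) * S k" by (simp add: ring_simps DE_mult)
  finally show ?thesis by (simp only: V_def W_def)
qed

text \<open>The level is \<open>Suc (bl b)\<close> because block column \<open>bl b\<close> lies in
  the kernel of the product of the first \<open>Suc (bl b)\<close> shifts. With \<open>C\<close>
  fixed, the adjugate makes the entry a quotient of polynomials in \<open>A\<close>.\<close>

lemma Q_column_entry:
  assumes "A \<in> big_cell" "a < N" "b < N" "x \<in> param_dom" "param_map ns lam x = A" "C \<in> R"
    and d: "det (cell_mat A (Suc (bl b)) C) \<noteq> 0"
  shows "Q_mat ns x $$ (a, b) = (adj_mat (cell_mat A (Suc (bl b)) C) *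
    (D (Suc (bl b)) - E (Suc (bl b)) * C * pp A (Suc (bl b)) * D (Suc (bl b)))) $$ (a, b) / det (cell_mat A (Suc (bl b)) C)"
proof -
  let ?k = "bl b"
  let ?B = "cell_mat A (Suc ?k) C" and ?Y = "D (Suc ?k) - E (Suc ?k) * C * pp A (Suc ?k) * D (Suc ?k)"
  have [simp]: "A \<in> R" using assms(1) orbit_closed by (auto simp: big_cell_def)
  have [simp]: "?B \<in> R" "?Y \<in> R" using assms(6) by (simp_all add: cell_mat_def)
  have adj: "adj_mat ?B \<in> R" "adj_mat ?B * ?B = det ?B \<cdot>\<^sub>m I" using adj_mat[of ?B N] by simp_all
  have "?B * (Q_mat ns x * S ?k) = ?Y * S ?k"
    using Q_column[OF bl_less[OF assms(3)] assms(6), of x] assms(5) by simp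
  then have "adj_mat ?B * (?B * (Q_mat ns x * S ?k)) = adj_mat ?B * ?Y * S ?k"
    by (simp only: mult_assoc adj(1) \<open>?Y \<in> R\<close> proj_closed)
  then have eq: "det ?B \<cdot>\<^sub>m (Q_mat ns x * S ?k) = adj_mat ?B * ?Y * S ?k"
    by (simp add: assoc_eq[OF adj(2) adj(1)] ring_simps(6) distribs(5))
  have "det ?B * Q_mat ns x $$ (a, b) = (det ?B \<cdot>\<^sub>m (Q_mat ns x * S ?k)) $$ (a, b)"
    using assms(2,3) by (simp add: entries proj_mult_entry)
  also have "\<dots> = (adj_mat ?B * ?Y) $$ (a, b)"
    unfolding eq using assms(2,3) adj(1) by (simp add: proj_mult_entry)
  finally show ?thesis using d by (simp add: field_simps)
qed

lemma param_map_inj: assumes "x \<in> param_dom" "y \<in> param_dom" "param_map ns lam x = param_map ns lam y" shows "x = y"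
proof -
  define A where "A = param_map ns lam x"
  have A: "A \<in> big_cell" using param_map_big_cell[OF assms(1)] by (simp add: A_def)
  have Q: "Q_mat ns x = Q_mat ns y"
  proof (rule add_eqI)
    fix a b assume ab: "a < N" "b < N"
    have "cell A (Suc (bl b))" using A bl_less[OF ab(2)] by (simp add: big_cell_def)
    then obtain C where "C \<in> R" "det (cell_mat A (Suc (bl b)) C) \<noteq> 0" by (auto simp: cell_def)
    from Q_column_entry[OF A ab assms(1) _ this] Q_column_entry[OF A ab assms(2) _ this]
    show "Q_mat ns x $$ (a, b) = Q_mat ns y $$ (a, b)" using assms(3) by (simp add: A_def)
  qed simp_all
  have L: "L_mat x = L_mat y"
  proof -
    have "L_mat z = Q_mat ns z - I" for z by (rule add_eqI) (simp_all add: Q_mat_eq entries)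
    then show ?thesis using Q by simp
  qed
  have Qi: "Qi_mat x = Qi_mat y" by (simp add: Qi_mat_def Q)
  have r: "rho_mat ns lam z = Qi_mat z * param_map ns lam z * Q_mat ns z" for z
  proof -
    have QQ: "Qi_mat z * Q_mat ns z = I" using Q_unit by (simp add: unit_pair_def)
    show ?thesis by (simp add: param_map_eq mult_assoc QQ assoc_eq[OF QQ])
  qed
  have "rho_mat ns lam x = rho_mat ns lam y" unfolding r by (simp only: Q Qi assms(3))
  then have "P_mat x = P_mat y" unfolding P_mat_from_rho by (simp only: Qi)
  then show ?thesis using params_eqI[OF _ _ _ L] assms(1,2) by (simp add: param_dom_def)
qed

text \<open>Being conjugate to a generic matrix, \<open>A\<close> has a kernel of
  \<open>pp A k\<close> as large as the first \<open>k\<close> blocks; being transversal to the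
  remaining blocks, that kernel is a graph over the first ones. The columns of \<open>K\<close>
  parameterize this graph.\<close>

lemma kernel_normal_form:
  assumes A: "A \<in> orbit J" and k: "k \<le> length lam" and "cell A k"
  obtains K where "K \<in> R" "pp A k * K = Z" "D k * K = D k"
proof -
  obtain \<rho> where \<rho>: "generic \<rho>" "\<rho> \<in> orbit J" by (rule generic_in_orbit)
  obtain g g' where g: "unit_pair g g'" "A = g * \<rho> * g'" using orbit_conjugate[OF A \<rho>(2)] by blast
  have [simp]: "A \<in> R" "\<rho> \<in> R" "g \<in> R" "g' \<in> R" and gg: "g' * g = I" "g * g' = I"
    using g(1) orbit_closed[OF A] orbit_closed[OF \<rho>(2)] by (auto simp: unit_pair_def)
  obtain C where [simp]: "C \<in> R" and C: "C * pp A k * E k = E k" using assms(3) cell_iff[of A] by auto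
  have P: "pp \<rho> k * E k = pp \<rho> k" using triangular_pp(2)[of \<rho> k] \<rho>(1) k by (simp add: generic_def)
  have PA: "pp A k = g * pp \<rho> k * g'" using pp_conj[OF g(1)] by (simp add: g(2))
  define X where "X = E k * C * g * pp \<rho> k"
  define Y where "Y = E k * g' * E k"
  have [simp]: "X \<in> R" "Y \<in> R" by (simp_all add: X_def Y_def)
  have XE: "E k * X = X" "X * E k = X" by (simp_all add: X_def mult_assoc P assoc_eq[OF DE_mult(2)])
  have "X * Y = E k * (C * (g * pp \<rho> k * g') * E k)"
    by (simp add: X_def Y_def mult_assoc assoc_eq[OF P])
  also have "\<dots> = E k" unfolding PA[symmetric] C by (simp add: DE_mult)
  finally have YX: "Y * X = E k"
    by (rule corner_inverse_commute[rotated 6])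
      (simp_all add: XE Y_def mult_assoc DE_mult assoc_eq[OF DE_mult(2)])
  have DX: "D k * X = Z" by (rule mult_zeroI[of _ "D k" "E k"]) (simp_all add: DE_mult XE)
  \<comment> \<open>\<open>g'\<close> carries the kernel of \<open>pp A k\<close> onto the first
    \<open>k\<close> blocks. Subtracting \<open>X * (g' * D k)\<close> makes
    \<open>E k * (g' * K)\<close> vanish and alters only rows in the blocks from \<open>k\<close>
    on.\<close>
  define K where "K = D k - X * (g' * D k)"
  have "E k * (g' * X) = Y * X" by (simp add: Y_def mult_assoc XE)
  then have gX: "E k * (g' * (X * W)) = E k * W" if "W \<in> R" for W
    using that YX mult_assoc[of "E k" "g' * X" W] by (simp add: mult_assoc)
  have "pp A k * K = g * ((pp \<rho> k * E k) * (g' * K))" unfolding P by (simp add: PA mult_assoc K_def)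
  also have "\<dots> = g * (pp \<rho> k * (E k * (g' * K)))" by (simp add: K_def mult_assoc)
  also have "E k * (g' * K) = Z" by (simp add: K_def ring_simps gX)
  finally have "pp A k * K = Z" by simp
  moreover have "D k * K = D k" by (simp add: K_def ring_simps DE_mult assoc_eq[OF DX])
  ultimately show ?thesis using that[of K] by (simp add: K_def)
qed

text \<open>The block columns of \<open>Q\<close> are read off the normalised kernels. Triangularity
  of \<open>Qi * A * Q\<close> holds because \<open>A - lam k\<close> maps the kernel of
  \<open>pp A (Suc k)\<close> into that of \<open>pp A k\<close>.\<close>

lemma big_cell_param_map: assumes "A \<in> big_cell" obtains x where "x \<in> param_dom" "param_map ns lam x = A"
proof -
  have A: "A \<in> orbit J" and cell: "\<And>k. k \<le> length lam \<Longrightarrow> cell A k" using assms by (auto simp: big_cell_def)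
  have [simp]: "A \<in> R" by (rule orbit_closed[OF A])
  have "\<exists>V. V \<in> R \<and> pp A (Suc k) * V = Z \<and> D (Suc k) * V = S k \<and> V * S k = V" if k: "k < length lam" for k
  proof -
    have "Suc k \<le> length lam" using k by simp
    from kernel_normal_form[OF A this cell[OF this]] obtain K
      where K: "K \<in> R" "pp A (Suc k) * K = Z" "D (Suc k) * K = D (Suc k)" by blast
    show ?thesis
      by (intro exI[of _ "K * S k"])
        (simp add: K(1) mult_assoc assoc_eq[OF K(2)] assoc_eq[OF K(3)] DE_mult)
  qed
  then have "\<forall>k. \<exists>V. k < length lam \<longrightarrow> V \<in> R \<and> pp A (Suc k) * V = Z \<and> D (Suc k) * V = S k \<and> V * S k = V" by blast
  from choice[OF this] obtain V where V: "\<And>k. k < length lam \<Longrightarrow> V k \<in> R"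
    "\<And>k. k < length lam \<Longrightarrow> pp A (Suc k) * V k = Z" "\<And>k. k < length lam \<Longrightarrow> D (Suc k) * V k = S k"
    "\<And>k. k < length lam \<Longrightarrow> V k * S k = V k" by blast
  \<comment> \<open>By \<open>D (Suc k) * V k = S k\<close>, block column \<open>k\<close> has the
    identity on the diagonal and zeros above it; subtracting the identity leaves a strictly lower
    matrix.\<close>
  define L where "L = mat N N (\<lambda>(a, b). V (bl b) $$ (a, b) - (if a = b then 1 else 0))"
  have [simp]: "L \<in> R" by (simp add: L_def)
  have "strict_lower L"
    unfolding strict_lower_def
  proof (intro conjI allI impI)
    fix a b assume ab: "a < N" "b < N" "bl a \<le> bl b"
    have k: "bl b < length lam" using bl_less[OF ab(2)] .
    have "V (bl b) $$ (a, b) = (D (Suc (bl b)) * V (bl b)) $$ (a, b)" using ab V(1)[OF k] by (simp add: proj_mult_entry)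
    then show "L $$ (a, b) = 0" using ab V(3)[OF k] by (auto simp: L_def proj_entry)
  qed simp
  note SL = this
  have "SU Z = Z" by (rule add_eqI) (auto simp: SU_entry)
  then have "L_mat (mk_params Z L) = L" using mk_params_mats(2)[OF _ _ SL] by simp
  then have "Q_mat ns (mk_params Z L) = I + L" by (simp add: Q_mat_eq)
  then obtain Q Qi where Q_def: "Q = I + L" and QQ: "unit_pair Q Qi" and low: "lower Q"
    using Q_unit[of "mk_params Z L"] lower_Q[of "mk_params Z L"] by simp
  have [simp]: "Q \<in> R" "Qi \<in> R" and qq: "Q * Qi = I" "Qi * Q = I" using QQ by (auto simp: unit_pair_def)
  have QS: "Q * S k = V k" if k: "k < length lam" for k
  proof (rule add_eqI)
    fix a b assume ab: "a < N" "b < N"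
    have "V k $$ (a, b) = (V k * S k) $$ (a, b)" using V(4)[OF k] by simp
    then show "(Q * S k) $$ (a, b) = V k $$ (a, b)"
      using ab V(1)[OF k] by (auto simp: Q_def proj_mult_entry entries L_def)
  qed (simp_all add: V(1)[OF k])
  have PQ: "k \<le> length lam \<Longrightarrow> pp A k * (Q * D k) = Z" for k
  proof (induction k)
    case (Suc k)
    have "pp A (Suc k) * (Q * D k) = sh A k * (pp A k * (Q * D k))"
      using pp_commute[of A k k] by (simp add: pp.simps(2) mult_assoc)
    then have "pp A (Suc k) * (Q * D k) = Z" using Suc by simp
    moreover have "pp A (Suc k) * (Q * S k) = Z" using QS[of k] V(2)[of k] Suc(2) by simp
    ultimately show ?case unfolding DE(3)[symmetric] by (simp add: ring_simps)
  qed (simp add: proj_bounds)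
  \<comment> \<open>The kernel of \<open>pp A k\<close> is no larger than \<open>Q\<close> times the
    first \<open>k\<close> blocks: the remaining component \<open>T\<close> of a kernel vector lies
    both in the kernel and in the span of the blocks from \<open>k\<close> on, hence vanishes by the
    cell condition.\<close>
  have kill: "E k * (Qi * W) = Z" if k: "k \<le> length lam" and [simp]: "W \<in> R" and PW: "pp A k * W = Z" for k W
  proof -
    obtain C where [simp]: "C \<in> R" and C: "C * pp A k * E k = E k" using cell[OF k] cell_iff[of A] by auto
    define T where "T = Q * (E k * (Qi * W))"
    have [simp]: "T \<in> R" by (simp add: T_def)
    have "W = Q * ((D k + E k) * (Qi * W))" by (simp add: DE assoc_eq[OF qq(1)])
    also have "\<dots> = Q * D k * (Qi * W) + T" unfolding T_def by (simp add: ring_simps del: DE)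
    finally have "pp A k * W = pp A k * (Q * D k * (Qi * W) + T)" by (rule arg_cong)
    also have "\<dots> = pp A k * (Q * D k) * (Qi * W) + pp A k * T" by (simp add: ring_simps)
    finally have "pp A k * W = pp A k * (Q * D k) * (Qi * W) + pp A k * T" .
    then have PT: "pp A k * T = Z" using PW PQ[OF k] by simp
    have ET: "E k * T = T" unfolding T_def by (rule lower_E_mult[OF low]) simp
    have "T = C * pp A k * E k * T" unfolding C by (simp add: ET)
    also have "\<dots> = Z" by (simp add: mult_assoc ET PT)
    finally have "Qi * T = Z" by simp
    then show ?thesis by (simp add: T_def assoc_eq[OF qq(2)])
  qed
  define \<rho> where "\<rho> = Qi * A * Q"
  have [simp]: "\<rho> \<in> R" by (simp add: \<rho>_def)
  have "triangular \<rho>"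
    unfolding triangular_def
  proof (intro conjI allI impI)
    fix k assume k: "k < length lam"
    have "pp A k * (sh A k * (Q * D (Suc k))) = pp A (Suc k) * (Q * D (Suc k))"
      by (simp add: mult_assoc pp.simps(2))
    also have "\<dots> = Z" using PQ[of "Suc k"] k by simp
    finally have "E k * (Qi * (sh A k * (Q * D (Suc k)))) = Z" using kill[of k] k by simp
    then show "E k * sh \<rho> k * D (Suc k) = Z"
      unfolding \<rho>_def sh_conj[OF unit_pair_sym[OF QQ] \<open>A \<in> R\<close>] by (simp add: mult_assoc)
  qed simp
  from param_of_rho[OF SL this] obtain x where x: "x \<in> param_space ns" "Q_mat ns x = Q" "rho_mat ns lam x = \<rho>"
    unfolding Q_def by blast
  have "Qi_mat x = Qi" using unit_pair_unique[OF _ QQ] Q_unit[of x] x(2) by simp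
  then have "param_map ns lam x = A"
    by (simp add: param_map_eq x \<rho>_def mult_assoc qq assoc_eq[OF qq(1)])
  then show ?thesis using that x(1) A by (simp add: param_dom_def)
qed

lemma param_dom_nonempty: "param_dom \<noteq> {}" and big_cell_nonempty: "big_cell \<noteq> {}"
proof -
  obtain \<rho> where \<rho>: "generic \<rho>" "\<rho> \<in> orbit J" by (rule generic_in_orbit)
  have "strict_lower Z" by (simp add: strict_lower_def)
  moreover have "triangular \<rho>" using \<rho>(1) by (simp add: generic_def)
  ultimately obtain x where "x \<in> param_space ns" "rho_mat ns lam x = \<rho>" by (rule param_of_rho)
  then have "x \<in> param_dom" using \<rho> by (simp add: param_dom_def param_map_orbit_iff)
  then show "param_dom \<noteq> {}" "big_cell \<noteq> {}" using param_map_big_cell by blast+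
qed

end

section \<open>Birationality\<close>

context jordan_data
begin

section \<open>Polynomial dependence and openness\<close>

lemma pp_mats:
  assumes "function_algebra \<F>" and G: "G \<in> function_algebra.mats \<F> N"
  shows "(\<lambda>x. pp (G x) k) \<in> function_algebra.mats \<F> N"
proof -
  interpret function_algebra \<F> by fact
  show ?thesis
  proof (induction k)
    case (Suc k)
    have "(\<lambda>x. G x - lam ! k \<cdot>\<^sub>m I) \<in> mats N" by (rule mats_diff[OF G mats_const]) simp
    then show ?case using mats_mult[OF Suc] by (simp add: pp.simps(2) sh_def)
  qed (simp add: mats_const)
qed

lemma cell_mat_mats:
  assumes "function_algebra \<F>" "G \<in> function_algebra.mats \<F> N" "C \<in> R"
  shows "(\<lambda>x. cell_mat (G x) k C) \<in> function_algebra.mats \<F> N"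
proof -
  interpret function_algebra \<F> by fact
  show ?thesis unfolding cell_mat_def
    by (intro mats_add mats_mult mats_const pp_mats assms(1,2)) (simp_all add: assms(3))
qed

lemma cells_open:
  assumes "G \<in> function_algebra.mats (poly_funs Cs) N"
  shows "zariski_open Cs X {x \<in> X. cell (G x) k}"
  unfolding zariski_open_def
proof (intro exI conjI)
  interpret function_algebra "poly_funs Cs" by (rule function_algebra_poly_funs)
  let ?S = "(\<lambda>C x. det (cell_mat (G x) k C)) ` R"
  show "?S \<subseteq> poly_funs Cs"
    using det_mats[OF cell_mat_mats[OF function_algebra_poly_funs assms]] by blast
  show "{x \<in> X. cell (G x) k} = {x \<in> X. \<exists>f\<in>?S. f x \<noteq> 0}" by (simp add: cell_def)
qed

lemma P_mats: "P_mat \<in> function_algebra.mats (poly_funs (param_coords ns)) N"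
  and L_mats: "L_mat \<in> function_algebra.mats (poly_funs (param_coords ns)) N"
proof -
  interpret function_algebra "poly_funs (param_coords ns)" by (rule function_algebra_poly_funs)
  have c: "p_coord (bl a) (bl b) (a - off (bl a)) (b - off (bl b)) \<in> poly_funs (param_coords ns)"
    "q_coord (bl b) (bl a) (b - off (bl b)) (a - off (bl a)) \<in> poly_funs (param_coords ns)"
    if "a < N" "b < N" "bl a < bl b" for a b
    using that bl_bounds[of a] bl_bounds[of b] by (intro poly_funs.coord; unfold param_coords_def; blast)+
  show "P_mat \<in> mats N"
  proof (rule matsI)
    fix a b assume ab: "a < N" "b < N"
    then have "(\<lambda>x. P_mat x $$ (a, b)) =
        (if bl a < bl b then p_coord (bl a) (bl b) (a - off (bl a)) (b - off (bl b)) else (\<lambda>_. 0))"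
      by (auto simp: P_mat_def p_coord_def)
    then show "(\<lambda>x. P_mat x $$ (a, b)) \<in> poly_funs (param_coords ns)" using c(1)[OF ab] const by simp
  qed simp
  show "L_mat \<in> mats N"
  proof (rule matsI)
    fix a b assume ab: "a < N" "b < N"
    then have "(\<lambda>x. L_mat x $$ (a, b)) =
        (if bl b < bl a then q_coord (bl a) (bl b) (a - off (bl a)) (b - off (bl b)) else (\<lambda>_. 0))"
      by (auto simp: L_mat_def q_coord_def)
    then show "(\<lambda>x. L_mat x $$ (a, b)) \<in> poly_funs (param_coords ns)" using c(2)[OF ab(2,1)] const by simp
  qed simp
qed

lemma SU_mats:
  assumes "function_algebra \<F>" and G: "G \<in> function_algebra.mats \<F> N"
  shows "(\<lambda>x. SU (G x)) \<in> function_algebra.mats \<F> N"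
proof -
  interpret function_algebra \<F> by fact
  show ?thesis
  proof (rule matsI)
    fix a b assume ab: "a < N" "b < N"
    then show "(\<lambda>x. SU (G x) $$ (a, b)) \<in> \<F>"
      using mats_entry[OF G ab] const[of 0] by (cases "bl a < bl b") (simp_all add: SU_entry)
  qed simp
qed

text \<open>Stated along a map \<open>G\<close> into the parameters and for any function algebra:
  the identity map with polynomial functions gives openness and regularity, a line with functions
  differentiable at 0 gives velocities.\<close>

lemma param_matrix_mats:
  fixes G :: "'a \<Rightarrow> params"
  assumes F: "function_algebra \<F>" and P: "(\<lambda>x. P_mat (G x)) \<in> function_algebra.mats \<F> N"
    and L: "(\<lambda>x. L_mat (G x)) \<in> function_algebra.mats \<F> N"
  shows "(\<lambda>x. Q_mat ns (G x)) \<in> function_algebra.mats \<F> N"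
    "(\<lambda>x. rho_mat ns lam (G x)) \<in> function_algebra.mats \<F> N"
    "(\<lambda>x. Qi_mat (G x)) \<in> function_algebra.mats \<F> N"
    "(\<lambda>x. param_map ns lam (G x)) \<in> function_algebra.mats \<F> N"
proof -
  interpret function_algebra \<F> by fact
  show Q: "(\<lambda>x. Q_mat ns (G x)) \<in> mats N"
    unfolding Q_mat_eq by (intro mats_add mats_const L) simp
  show r: "(\<lambda>x. rho_mat ns lam (G x)) \<in> mats N"
    unfolding rho_mat_eq by (intro mats_add mats_const SU_mats F mats_mult P Q) simp
  show Qi: "(\<lambda>x. Qi_mat (G x)) \<in> mats N"
    unfolding Qi_mat_def by (intro adj_mats Q)
  show "(\<lambda>x. param_map ns lam (G x)) \<in> mats N"
    unfolding param_map_eq by (intro mats_mult Q r Qi)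
qed

lemmas param_poly_mats = param_matrix_mats[of _ "\<lambda>x. x", OF function_algebra_poly_funs P_mats L_mats]

lemma param_dom_open: "zariski_open (param_coords ns) (param_space ns) param_dom"
proof -
  have "zariski_open (param_coords ns) (param_space ns)
      {x \<in> param_space ns. \<forall>k<Suc (length lam). x \<in> {x \<in> param_space ns. cell (rho_mat ns lam x) k}}"
    by (intro zariski_open_INT cells_open param_poly_mats)
  also have "{x \<in> param_space ns. \<forall>k<Suc (length lam). x \<in> {x \<in> param_space ns. cell (rho_mat ns lam x) k}} = param_dom"
    by (auto simp: param_dom_cells)
  finally show ?thesis .
qed

text \<open>\<open>mats\<close> demands one size at every argument, whereas the type of matrices
  contains all sizes; truncation is total and is the identity on the orbit.\<close>

definition pad :: "complex mat \<Rightarrow> complex mat" where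
  "pad A = mat N N (\<lambda>(a, b). A $$ (a, b))"

lemma pad_closed [simp]: "pad A \<in> R" by (simp add: pad_def)

lemma pad_id: "A \<in> R \<Longrightarrow> pad A = A"
  by (rule add_eqI) (simp_all add: pad_def)

lemma pad_mats: "pad \<in> function_algebra.mats (poly_funs (entry_coords N)) N"
proof -
  interpret function_algebra "poly_funs (entry_coords N)" by (rule function_algebra_poly_funs)
  show ?thesis
    by (rule matsI) (auto simp: pad_def entry_coords_def intro!: poly_funs.coord)
qed

lemma big_cell_open: "zariski_open (entry_coords N) (orbit J) big_cell"
proof -
  have "zariski_open (entry_coords N) (orbit J)
      {A \<in> orbit J. \<forall>k<Suc (length lam). A \<in> {A \<in> orbit J. cell (pad A) k}}"
    by (intro zariski_open_INT cells_open pad_mats)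
  also have "{A \<in> orbit J. \<forall>k<Suc (length lam). A \<in> {A \<in> orbit J. cell (pad A) k}} = big_cell"
    using pad_id[OF orbit_closed] by (auto simp: big_cell_def)
  finally show ?thesis .
qed

text \<open>Irreducibility: restrict to a line \<open>g + t (h - g)\<close> in the general linear group; multiplied by a
  power of the determinant, a polynomial function on the orbit becomes a polynomial in \<open>t\<close>.\<close>

lemma orbit_irreducible:
  assumes "f1 \<in> poly_funs (entry_coords N)" "f2 \<in> poly_funs (entry_coords N)"
    and "A1 \<in> orbit J" "f1 A1 \<noteq> 0" "A2 \<in> orbit J" "f2 A2 \<noteq> 0"
  obtains A where "A \<in> orbit J" "f1 A \<noteq> 0" "f2 A \<noteq> 0"
proof -
  let ?F = "range (poly :: complex poly \<Rightarrow> complex \<Rightarrow> complex)"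
  interpret function_algebra ?F by (rule function_algebra_polynomial)
  obtain g1 v1 where g1: "unit_pair g1 v1" "A1 = g1 * J * v1" using assms(3) orbit_iff[OF J_closed] by blast
  obtain g2 v2 where g2: "unit_pair g2 v2" "A2 = g2 * J * v2" using assms(5) orbit_iff[OF J_closed] by blast
  have [simp]: "g1 \<in> R" "g2 \<in> R" using g1 g2 by (auto simp: unit_pair_def)
  define g where "g t = g1 + t \<cdot>\<^sub>m (g2 - g1)" for t
  have gR [simp]: "g t \<in> R" for t by (simp add: g_def)
  have id: "(\<lambda>t. t) \<in> ?F" by (rule range_eqI[of _ _ "[:0, 1:]"]) auto
  have g: "g \<in> mats N" unfolding g_def by (intro mats_add mats_const mats_smult id) simp_all
  have "(\<lambda>t. det (g t)) \<in> ?F" by (rule det_mats[OF g])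
  then obtain d where d: "\<And>t. det (g t) = poly d t" by (auto simp: fun_eq_iff)
  define A where "A t = g t * J * (inverse (det (g t)) \<cdot>\<^sub>m adj_mat (g t))" for t
  have AR: "A t \<in> R" for t using adj_mat(1)[OF gR] by (simp add: A_def)
  have A_orbit: "A t \<in> orbit J" if "poly d t \<noteq> 0" for t
    unfolding orbit_iff[OF J_closed] A_def using det_unit[OF gR, of t] that d by auto
  have eq: "\<exists>p k. \<forall>t. poly d t \<noteq> 0 \<longrightarrow> f (A t) * poly d t ^ k = poly p t"
    if "f \<in> poly_funs (entry_coords N)" for f
    using that
  proof induction
    case (const z)
    show ?case by (intro exI[of _ "[:z:]"] exI[of _ 0]) simp
  next
    case (coord c)
    then obtain a b where ab: "a < N" "b < N" "c = (\<lambda>A. A $$ (a, b))" by (auto simp: entry_coords_def)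
    have "(\<lambda>t. (g t * J * adj_mat (g t)) $$ (a, b)) \<in> ?F"
      by (intro mats_entry[OF _ ab(1,2)] mats_mult adj_mats g mats_const) simp
    then obtain p where p: "\<And>t. (g t * J * adj_mat (g t)) $$ (a, b) = poly p t" by (auto simp: fun_eq_iff)
    have "c (A t) * poly d t ^ 1 = poly p t" if "poly d t \<noteq> 0" for t
      using that ab adj_mat(1)[OF gR] by (simp add: A_def distribs entries p d field_simps)
    then show ?case by blast
  next
    case (add f h)
    then obtain p k q l where pq: "\<And>t. poly d t \<noteq> 0 \<Longrightarrow> f (A t) * poly d t ^ k = poly p t"
      "\<And>t. poly d t \<noteq> 0 \<Longrightarrow> h (A t) * poly d t ^ l = poly q t" by blast
    have "(f (A t) + h (A t)) * poly d t ^ (k + l) = poly (p * d ^ l + q * d ^ k) t" if "poly d t \<noteq> 0" for t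
      using pq[OF that] by (simp add: algebra_simps power_add flip: pq)
    then show ?case by blast
  next
    case (mult f h)
    then obtain p k q l where pq: "\<And>t. poly d t \<noteq> 0 \<Longrightarrow> f (A t) * poly d t ^ k = poly p t"
      "\<And>t. poly d t \<noteq> 0 \<Longrightarrow> h (A t) * poly d t ^ l = poly q t" by blast
    have "f (A t) * h (A t) * poly d t ^ (k + l) = poly (p * q) t" if "poly d t \<noteq> 0" for t
      using pq[OF that] by (simp add: algebra_simps power_add flip: pq)
    then show ?case by blast
  qed
  obtain p1 k1 where p1: "\<And>t. poly d t \<noteq> 0 \<Longrightarrow> f1 (A t) * poly d t ^ k1 = poly p1 t" using eq[OF assms(1)] by blast
  obtain p2 k2 where p2: "\<And>t. poly d t \<noteq> 0 \<Longrightarrow> f2 (A t) * poly d t ^ k2 = poly p2 t" using eq[OF assms(2)] by blast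
  have at: "A t = h * J * v \<and> poly d t \<noteq> 0" if "g t = h" "unit_pair h v" for t h v
    using that unit_det[OF that(2)] unit_pair_unique[OF that(2)] det_unit[OF gR, of t] d[of t] by (simp add: A_def)
  have "g 0 = g1" "g 1 = g2" unfolding g_def by (rule add_eqI; simp add: entries)+
  then have "A 0 = A1" "poly d 0 \<noteq> 0" "A 1 = A2" "poly d 1 \<noteq> 0"
    using at g1 g2 by metis+
  \<comment> \<open>The values at \<open>t = 0\<close> and \<open>t = 1\<close> show that none of
    the three polynomials vanishes identically, so some \<open>t\<close> avoids the roots of all of
    them.\<close>
  then have "p1 \<noteq> 0" "p2 \<noteq> 0" "d \<noteq> 0" using p1[of 0] p2[of 1] assms(4,6) by auto
  then have "finite {t. poly (p1 * p2 * d) t = 0}" by (intro poly_roots_finite) simp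
  then obtain t where "poly (p1 * p2 * d) t \<noteq> 0"
    using ex_new_if_finite[OF infinite_UNIV_char_0] by blast
  then have "poly d t \<noteq> 0" "f1 (A t) \<noteq> 0" "f2 (A t) \<noteq> 0" using p1[of t] p2[of t] by auto
  then show ?thesis using that A_orbit by blast
qed

lemma big_cell_dense: "zariski_dense (entry_coords N) (orbit J) big_cell"
  unfolding zariski_dense_def
proof (intro allI impI, elim conjE)
  fix W assume W: "zariski_open (entry_coords N) (orbit J) W" "W \<noteq> {}"
  then obtain S1 where S1: "S1 \<subseteq> poly_funs (entry_coords N)" "W = {x \<in> orbit J. \<exists>f\<in>S1. f x \<noteq> 0}"
    unfolding zariski_open_def by blast
  obtain S2 where S2: "S2 \<subseteq> poly_funs (entry_coords N)" "big_cell = {x \<in> orbit J. \<exists>f\<in>S2. f x \<noteq> 0}"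
    using big_cell_open unfolding zariski_open_def by blast
  obtain A1 f1 where 1: "A1 \<in> orbit J" "f1 \<in> S1" "f1 A1 \<noteq> 0" using W(2) S1(2) by blast
  obtain A2 f2 where 2: "A2 \<in> orbit J" "f2 \<in> S2" "f2 A2 \<noteq> 0" using big_cell_nonempty S2(2) by blast
  have "f1 \<in> poly_funs (entry_coords N)" "f2 \<in> poly_funs (entry_coords N)" using 1 2 S1 S2 by blast+
  then obtain A where "A \<in> orbit J" "f1 A \<noteq> 0" "f2 A \<noteq> 0" using orbit_irreducible 1 2 by metis
  then show "W \<inter> big_cell \<noteq> {}" unfolding S1(2) S2(2) using 1(2) 2(2) by blast
qed

section \<open>Regularity of the inverse map\<close>

definition param_inv :: "complex mat \<Rightarrow> params" where
  "param_inv = inv_into param_dom (param_map ns lam)"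

lemma param_inv:
  "A \<in> big_cell \<Longrightarrow> param_inv A \<in> param_dom" "A \<in> big_cell \<Longrightarrow> param_map ns lam (param_inv A) = A"
  "x \<in> param_dom \<Longrightarrow> param_inv (param_map ns lam x) = x"
proof -
  have img: "A \<in> param_map ns lam ` param_dom" if "A \<in> big_cell" for A
    using big_cell_param_map[OF that] by blast
  show "A \<in> big_cell \<Longrightarrow> param_inv A \<in> param_dom" "A \<in> big_cell \<Longrightarrow> param_map ns lam (param_inv A) = A"
    unfolding param_inv_def using inv_into_into[OF img] f_inv_into_f[OF img] by blast+
  show "x \<in> param_dom \<Longrightarrow> param_inv (param_map ns lam x) = x"
    unfolding param_inv_def by (rule inv_into_f_f) (auto intro: inj_onI param_map_inj)
qed

lemma param_map_regular:
  assumes "X \<subseteq> param_dom" "param_map ns lam ` X \<subseteq> Y"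
  shows "regular_map (param_coords ns) X (entry_coords N) Y (param_map ns lam)"
  unfolding regular_map_def
proof (intro conjI assms(2) ballI)
  interpret function_algebra "poly_funs (param_coords ns)" by (rule function_algebra_poly_funs)
  fix c assume "c \<in> entry_coords N"
  then obtain a b where ab: "a < N" "b < N" "c = (\<lambda>A. A $$ (a, b))" by (auto simp: entry_coords_def)
  show "regular_on (param_coords ns) X (\<lambda>x. c (param_map ns lam x))"
    unfolding ab(3) by (intro regular_on_poly mats_entry[OF param_poly_mats(4) ab(1,2)])
qed

text \<open>\<open>C\<close> is chosen at the point \<open>A0\<close> and kept fixed on the
  neighbourhood where its determinant stays nonzero; there Cramer's formula is a quotient of
  polynomials.\<close>

lemma Q_regular:
  assumes ab: "a < N" "b < N"
  shows "regular_on (entry_coords N) big_cell (\<lambda>A. Q_mat ns (param_inv A) $$ (a, b))"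
  unfolding regular_on_def
proof
  interpret function_algebra "poly_funs (entry_coords N)" by (rule function_algebra_poly_funs)
  fix A0 assume A0: "A0 \<in> big_cell"
  let ?k = "Suc (bl b)"
  have "cell A0 ?k" using A0 bl_less[OF ab(2)] by (simp add: big_cell_def)
  then obtain C where C: "C \<in> R" "det (cell_mat A0 ?k C) \<noteq> 0" by (auto simp: cell_def)
  let ?B = "\<lambda>A. cell_mat (pad A) ?k C"
  let ?Y = "\<lambda>A. D ?k - E ?k * C * pp (pad A) ?k * D ?k"
  have B: "?B \<in> mats N" by (rule cell_mat_mats[OF function_algebra_poly_funs pad_mats C(1)])
  have Y: "?Y \<in> mats N"
    by (intro mats_diff mats_mult mats_const pp_mats function_algebra_poly_funs pad_mats) (simp_all add: C)
  have pad: "pad A = A" if "A \<in> big_cell" for A using that orbit_closed pad_id by (auto simp: big_cell_def)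
  show "\<exists>W. zariski_open (entry_coords N) big_cell W \<and> A0 \<in> W \<and> (\<exists>u\<in>poly_funs (entry_coords N).
      \<exists>v\<in>poly_funs (entry_coords N). \<forall>A\<in>W. v A \<noteq> 0 \<and> Q_mat ns (param_inv A) $$ (a, b) = u A / v A)"
  proof (rule regular_onI[where W = "{A \<in> big_cell. det (?B A) \<noteq> 0}"])
    show "zariski_open (entry_coords N) big_cell {A \<in> big_cell. det (?B A) \<noteq> 0}"
      unfolding zariski_open_def by (intro exI[of _ "{\<lambda>A. det (?B A)}"]) (use det_mats[OF B] in auto)
    show "A0 \<in> {A \<in> big_cell. det (?B A) \<noteq> 0}" using A0 C pad by simp
    show "(\<lambda>A. (adj_mat (?B A) * ?Y A) $$ (a, b)) \<in> poly_funs (entry_coords N)"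
      by (intro mats_entry[OF _ ab] mats_mult adj_mats B Y)
    show "(\<lambda>A. det (?B A)) \<in> poly_funs (entry_coords N)" by (rule det_mats[OF B])
    fix A assume "A \<in> {A \<in> big_cell. det (?B A) \<noteq> 0}"
    then have A: "A \<in> big_cell" "det (?B A) \<noteq> 0" by auto
    then show "det (?B A) \<noteq> 0 \<and> Q_mat ns (param_inv A) $$ (a, b) = (adj_mat (?B A) * ?Y A) $$ (a, b) / det (?B A)"
      using Q_column_entry[OF A(1) ab param_inv(1,2)[OF A(1)] C(1)] pad[OF A(1)] by simp
  qed
qed

text \<open>Only \<open>Q\<close> needs denominators: its inverse is an adjugate,
  \<open>\<rho>\<close> is \<open>Qi * A * Q\<close>, and \<open>P\<close> follows by
  \<open>P_mat_from_rho\<close>, so all remaining coordinates are polynomial in \<open>A\<close> and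
  the entries of \<open>Q\<close>.\<close>

lemma param_inv_regular: "regular_map (entry_coords N) big_cell (param_coords ns) param_dom param_inv"
  unfolding regular_map_def
proof (intro conjI ballI)
  show "param_inv ` big_cell \<subseteq> param_dom" using param_inv(1) by blast
  let ?F = "{h. regular_on (entry_coords N) big_cell h}"
  interpret function_algebra ?F by (rule function_algebra_regular)
  have Q: "(\<lambda>A. Q_mat ns (param_inv A)) \<in> mats N" by (rule matsI) (simp_all add: Q_regular)
  have L: "(\<lambda>A. L_mat (param_inv A)) \<in> mats N"
  proof -
    have "L_mat x = Q_mat ns x - I" for x by (rule add_eqI) (simp_all add: Q_mat_eq entries)
    then show ?thesis using mats_diff[OF Q mats_const[of I]] by simp
  qed
  have Qi: "(\<lambda>A. Qi_mat (param_inv A)) \<in> mats N" unfolding Qi_mat_def by (rule adj_mats[OF Q])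
  have pad: "pad \<in> mats N"
    by (rule matsI) (use function_algebra.mats_entry[OF function_algebra_poly_funs pad_mats] in \<open>auto intro: regular_on_poly\<close>)
  define P where "P A = SU (SU (Qi_mat (param_inv A) * pad A * Q_mat ns (param_inv A)) * Qi_mat (param_inv A))" for A
  have P: "P \<in> mats N" unfolding P_def by (intro SU_mats function_algebra_regular mats_mult Q Qi pad)
  have P_eq: "P A = P_mat (param_inv A)" if A: "A \<in> big_cell" for A
  proof -
    let ?x = "param_inv A"
    have QQ: "Qi_mat ?x * Q_mat ns ?x = I" using Q_unit by (simp add: unit_pair_def)
    have "pad A = Q_mat ns ?x * rho_mat ns lam ?x * Qi_mat ?x"
      using param_inv(2)[OF A] A orbit_closed pad_id by (auto simp: big_cell_def param_map_eq)
    then have "Qi_mat ?x * pad A * Q_mat ns ?x = rho_mat ns lam ?x"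
      by (simp add: mult_assoc QQ assoc_eq[OF QQ])
    then show ?thesis unfolding P_def using P_mat_from_rho by simp
  qed
  fix c assume "c \<in> param_coords ns"
  then consider (p) j i s t where "c = p_coord j i s t" "j < i" "i < length ns" "s < ns ! j" "t < ns ! i"
    | (q) j i s t where "c = q_coord i j t s" "j < i" "i < length ns" "s < ns ! j" "t < ns ! i"
    unfolding param_coords_def by blast
  then show "regular_on (entry_coords N) big_cell (\<lambda>A. c (param_inv A))"
  proof cases
    case p
    then have "off j + s < N" "off i + t < N" using off_less(1) by auto
    from mats_entry[OF P this] have "regular_on (entry_coords N) big_cell (\<lambda>A. P A $$ (off j + s, off i + t))" by simp
    then show ?thesis by (rule regular_on_cong[rotated]) (simp add: p coords_eq P_eq)
  next
    case q
    then have "off i + t < N" "off j + s < N" using off_less(1) by auto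
    from mats_entry[OF L this] show ?thesis by (simp add: q coords_eq)
  qed
qed

theorem param_map_birational:
  "birational_map (param_coords ns) param_dom (entry_coords N) (orbit J) (param_map ns lam)"
  unfolding birational_map_def
proof (intro conjI exI ballI)
  show "regular_map (param_coords ns) param_dom (entry_coords N) (orbit J) (param_map ns lam)"
    by (rule param_map_regular) (auto simp: param_dom_def)
  \<comment> \<open>The whole parameter domain serves as its own dense open subset; only the target
    is shrunk, to the big cell.\<close>
  show "zariski_open (param_coords ns) param_dom param_dom" by (rule zariski_open_self)
  show "zariski_dense (param_coords ns) param_dom param_dom"
    unfolding zariski_dense_def zariski_open_def by blast
  show "zariski_open (entry_coords N) (orbit J) big_cell" by (rule big_cell_open)
  show "zariski_dense (entry_coords N) (orbit J) big_cell" by (rule big_cell_dense)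
  show "regular_map (param_coords ns) param_dom (entry_coords N) big_cell (param_map ns lam)"
    by (rule param_map_regular) (use param_map_big_cell in auto)
  show "regular_map (entry_coords N) big_cell (param_coords ns) param_dom param_inv" by (rule param_inv_regular)
qed (use param_inv in auto)

end

section \<open>Curves and traces\<close>

context square
begin

lemma trace_eq: "A \<in> R \<Longrightarrow> mat_trace A = (\<Sum>i<n. A $$ (i, i))"
  by (simp add: mat_trace_def)

lemma trace_add: "A \<in> R \<Longrightarrow> B \<in> R \<Longrightarrow> mat_trace (A + B) = mat_trace A + mat_trace B"
  and trace_diff: "A \<in> R \<Longrightarrow> B \<in> R \<Longrightarrow> mat_trace (A - B) = mat_trace A - mat_trace B"
  by (simp_all add: trace_eq entries sum.distrib sum_subtractf)

lemma trace_comm: "A \<in> R \<Longrightarrow> B \<in> R \<Longrightarrow> mat_trace (A * B) = mat_trace (B * A)"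
  by (simp add: trace_eq mult_entry mult.commute) (rule sum.swap)

lemma trace_conj: "unit_pair g h \<Longrightarrow> A \<in> R \<Longrightarrow> mat_trace (g * A * h) = mat_trace A"
  using trace_comm[of "g * A" h] by (simp add: unit_pair_def flip: mult_assoc)

lemma trace_commutator:
  assumes [simp]: "A \<in> R" "X \<in> R" "Y \<in> R"
  shows "mat_trace (A * (X * Y - Y * X)) = mat_trace (X * (Y * A - A * Y))"
    and "mat_trace (A * (X * Y - Y * X)) = - mat_trace (Y * (X * A - A * X))"
proof -
  have 1: "mat_trace (A * (X * Y)) = mat_trace (X * (Y * A))"
    using trace_comm[of A "X * Y"] by (simp add: mult_assoc)
  have 2: "mat_trace (A * (Y * X)) = mat_trace (X * (A * Y))"
    using trace_comm[of "A * Y" X] by (simp add: mult_assoc)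
  have 3: "mat_trace (A * (X * Y)) = mat_trace (Y * (A * X))"
    using trace_comm[of "A * X" Y] by (simp add: mult_assoc)
  have 4: "mat_trace (A * (Y * X)) = mat_trace (Y * (X * A))"
    using trace_comm[of A "Y * X"] by (simp add: mult_assoc)
  show "mat_trace (A * (X * Y - Y * X)) = mat_trace (X * (Y * A - A * Y))"
    by (simp add: ring_simps trace_diff 1 2)
  show "mat_trace (A * (X * Y - Y * X)) = - mat_trace (Y * (X * A - A * X))"
    by (simp add: ring_simps trace_diff 3 4)
qed

section \<open>Derivatives of matrix curves and tangent vectors of the orbit\<close>

lemma deriv0_unique: "has_mat_deriv0 n F A \<Longrightarrow> has_mat_deriv0 n F B \<Longrightarrow> A = B"
  unfolding has_mat_deriv0_def by (intro add_eqI) (blast intro: DERIV_unique)+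

lemma deriv0_cong:
  assumes "\<forall>\<^sub>F t in nhds 0. \<forall>a<n. \<forall>b<n. F t $$ (a, b) = G t $$ (a, b)" "has_mat_deriv0 n F A"
  shows "has_mat_deriv0 n G A"
  unfolding has_mat_deriv0_def
proof (intro conjI allI impI)
  show "A \<in> R" using assms(2) by (simp add: has_mat_deriv0_def)
  fix a b assume ab: "a < n" "b < n"
  have "\<forall>\<^sub>F t in nhds 0. F t $$ (a, b) = G t $$ (a, b)"
    using assms(1) by (rule eventually_mono) (use ab in auto)
  note ev = this
  have "((\<lambda>t. F t $$ (a, b)) has_field_derivative A $$ (a, b)) (at 0)"
    using assms(2) ab by (simp add: has_mat_deriv0_def)
  then show "((\<lambda>t. G t $$ (a, b)) has_field_derivative A $$ (a, b)) (at 0)"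
    by (rule DERIV_cong_ev[OF refl ev refl, THEN iffD1])
qed

lemma deriv0_const: "A \<in> R \<Longrightarrow> has_mat_deriv0 n (\<lambda>_. A) Z"
  by (simp add: has_mat_deriv0_def)

lemma deriv0_add:
  assumes "has_mat_deriv0 n F A" "has_mat_deriv0 n G B" "\<And>t. F t \<in> R" "\<And>t. G t \<in> R"
  shows "has_mat_deriv0 n (\<lambda>t. F t + G t) (A + B)"
  using assms unfolding has_mat_deriv0_def by (auto simp: entries intro: DERIV_add)

lemma deriv0_mult:
  assumes "has_mat_deriv0 n F A" "has_mat_deriv0 n G B" and R: "\<And>t. F t \<in> R" "\<And>t. G t \<in> R"
  shows "has_mat_deriv0 n (\<lambda>t. F t * G t) (A * G 0 + F 0 * B)"
  unfolding has_mat_deriv0_def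
proof (intro conjI allI impI)
  have [simp]: "A \<in> R" "B \<in> R" using assms by (auto simp: has_mat_deriv0_def)
  show "A * G 0 + F 0 * B \<in> R" using R by simp
  fix a b assume ab: "a < n" "b < n"
  have "((\<lambda>t. \<Sum>c<n. F t $$ (a, c) * G t $$ (c, b)) has_field_derivative
      (\<Sum>c<n. F 0 $$ (a, c) * B $$ (c, b) + A $$ (a, c) * G 0 $$ (c, b))) (at 0)"
    using assms ab by (intro DERIV_sum DERIV_mult') (auto simp: has_mat_deriv0_def)
  then show "((\<lambda>t. (F t * G t) $$ (a, b)) has_field_derivative (A * G 0 + F 0 * B) $$ (a, b)) (at 0)"
    using R ab by (simp add: mult_entry entries sum.distrib add.commute)
qed

lemma deriv0_line: "A \<in> R \<Longrightarrow> B \<in> R \<Longrightarrow> has_mat_deriv0 n (\<lambda>t. A + t \<cdot>\<^sub>m B) B"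
  unfolding has_mat_deriv0_def by (auto simp: entries intro!: derivative_eq_intros)

lemma deriv0_exists:
  assumes "F \<in> function_algebra.mats {f. \<exists>d. (f has_field_derivative d) (at (0::complex))} n"
  obtains A where "has_mat_deriv0 n F A"
proof -
  interpret function_algebra "{f. \<exists>d. (f has_field_derivative d) (at (0::complex))}" by (rule function_algebra_differentiable)
  have "\<forall>e. \<exists>d. fst e < n \<longrightarrow> snd e < n \<longrightarrow> ((\<lambda>t. F t $$ e) has_field_derivative d) (at 0)"
    using mats_entry[OF assms] by auto
  from choice[OF this] obtain d where d: "\<And>a b. a < n \<Longrightarrow> b < n \<Longrightarrow> ((\<lambda>t. F t $$ (a, b)) has_field_derivative d (a, b)) (at 0)"
    by fastforce
  then show ?thesis using that[of "mat n n d"] by (auto simp: has_mat_deriv0_def)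
qed

text \<open>Differentiating \<open>A(t) g(t) = g(t) J\<close> yields the velocity without a
  derivative of the inverse of \<open>g(t)\<close>.\<close>

lemma orbit_curve_velocity:
  assumes J [simp]: "J \<in> R" and c: "orbit_curve J A g g' \<xi>" and h: "unit_pair (g 0) h"
  shows "g' \<in> R" "A = g 0 * J * h" "\<xi> = (g' * h) * A - A * (g' * h)"
proof -
  have dim: "dim_row J = n" by (rule carrier_matD(1)[OF J])
  have ev: "\<forall>\<^sub>F t in nhds 0. g t \<in> GL n" and dg: "has_mat_deriv0 n g g'" and A0: "conj_by (g 0) J = A"
    and d\<xi>: "has_mat_deriv0 n (\<lambda>t. conj_by (g t) J) \<xi>"
    using c unfolding orbit_curve_def dim by auto
  have [simp]: "g 0 \<in> R" "h \<in> R" and gh: "g 0 * h = I" "h * g 0 = I" using h by (auto simp: unit_pair_def)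
  show g' [simp]: "g' \<in> R" using dg by (simp add: has_mat_deriv0_def)
  have [simp]: "\<xi> \<in> R" using d\<xi> by (simp add: has_mat_deriv0_def)
  show A: "A = g 0 * J * h" using A0 conj_by_eq[OF h] by simp
  have [simp]: "A \<in> R" by (simp add: A)
  \<comment> \<open>Away from 0 the curve may take values of any size, while the product rule is
    stated for a fixed size; truncation leaves the germ at 0 unchanged.\<close>
  define p where "p X = mat n n (\<lambda>(a, b). X $$ (a, b))" for X :: "complex mat"
  have pR [simp]: "p X \<in> R" for X by (simp add: p_def)
  have p: "X \<in> R \<Longrightarrow> p X = X" for X by (rule add_eqI) (simp_all add: p_def)
  have 1: "has_mat_deriv0 n (\<lambda>t. p (g t)) g'"
    by (rule deriv0_cong[OF _ dg]) (simp add: p_def)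
  have 2: "has_mat_deriv0 n (\<lambda>t. p (conj_by (g t) J)) \<xi>"
    by (rule deriv0_cong[OF _ d\<xi>]) (simp add: p_def)
  have "has_mat_deriv0 n (\<lambda>t. p (conj_by (g t) J) * p (g t)) (\<xi> * g 0 + A * g')"
    using deriv0_mult[OF 2 1] by (simp add: A0 p)
  moreover have "has_mat_deriv0 n (\<lambda>t. p (conj_by (g t) J) * p (g t)) (g' * J + g 0 * Z)"
  proof (rule deriv0_cong)
    show "has_mat_deriv0 n (\<lambda>t. p (g t) * J) (g' * J + g 0 * Z)"
      using deriv0_mult[OF 1 deriv0_const[OF J]] by (simp add: p)
    show "\<forall>\<^sub>F t in nhds 0. \<forall>a<n. \<forall>b<n. (p (g t) * J) $$ (a, b) = (p (conj_by (g t) J) * p (g t)) $$ (a, b)"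
      using ev
    proof (rule eventually_mono)
      fix t assume "g t \<in> GL n"
      then obtain v where v: "unit_pair (g t) v" using GL_iff by blast
      then have [simp]: "g t \<in> R" "v \<in> R" and vg: "v * g t = I" by (auto simp: unit_pair_def)
      show "\<forall>a<n. \<forall>b<n. (p (g t) * J) $$ (a, b) = (p (conj_by (g t) J) * p (g t)) $$ (a, b)"
        by (simp add: conj_by_eq[OF v] p mult_assoc vg)
    qed
  qed
  ultimately have "\<xi> * g 0 + A * g' = g' * J" by (auto dest: deriv0_unique)
  then have "\<xi> * g 0 = g' * J - A * g'" by (rule eq_diffI) simp_all
  then have "\<xi> * g 0 * h = (g' * J - A * g') * h" by simp
  moreover have "g' * J * h = g' * h * A" by (simp add: A mult_assoc assoc_eq[OF gh(2)])
  ultimately show "\<xi> = (g' * h) * A - A * (g' * h)"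
    by (simp add: ring_simps gh)
qed

text \<open>Every commutator \<open>[Y, A]\<close> is tangent to the orbit. In the proof
  \<open>B\<close> is written with the adjugate and defined for all \<open>t\<close>; it agrees with
  the conjugate near 0, where \<open>I + t Y\<close> is invertible, and its velocity is read off
  \<open>B k = k A\<close>.\<close>

lemma ex_orbit_curve:
  assumes J [simp]: "J \<in> R" and g: "unit_pair g h" and A: "A = g * J * h" and [simp]: "Y \<in> R"
  shows "orbit_curve J A (\<lambda>t. (I + t \<cdot>\<^sub>m Y) * g) (Y * g) (Y * A - A * Y)"
proof -
  let ?F = "{f. \<exists>d. (f has_field_derivative d) (at (0::complex))}"
  interpret function_algebra ?F by (rule function_algebra_differentiable)
  have dim: "dim_row J = n" by (rule carrier_matD(1)[OF J])
  have [simp]: "g \<in> R" "h \<in> R" and gh: "g * h = I" "h * g = I" using g by (auto simp: unit_pair_def)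
  have [simp]: "A \<in> R" by (simp add: A)
  define k where "k t = I + t \<cdot>\<^sub>m Y" for t :: complex
  have kR [simp]: "k t \<in> R" for t by (simp add: k_def)
  have k0: "k 0 = I" unfolding k_def by (rule add_eqI) (simp_all add: entries)
  have id: "(\<lambda>t. t) \<in> ?F" by (auto intro: DERIV_ident)
  have k: "k \<in> mats n" unfolding k_def by (intro mats_add mats_const mats_smult id) simp_all
  have det: "(\<lambda>t. det (k t)) \<in> ?F" by (rule det_mats[OF k])
  then have "isCont (\<lambda>t. det (k t)) 0" using DERIV_isCont by blast
  then have "((\<lambda>t. det (k t)) \<longlongrightarrow> 1) (at 0)" by (simp add: isCont_def k0)
  then have "\<forall>\<^sub>F t in at 0. det (k t) \<noteq> 0" by (rule tendsto_imp_eventually_ne) simp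
  then have ev: "\<forall>\<^sub>F t in nhds 0. det (k t) \<noteq> 0"
    unfolding eventually_at_filter by (rule eventually_mono) (use k0 in force)
  obtain d where d: "((\<lambda>t. det (k t)) has_field_derivative d) (at 0)" using det by blast
  have "(\<lambda>t. inverse (det (k t))) \<in> ?F" using DERIV_inverse'[OF d] k0 by auto
  then have ki: "(\<lambda>t. inverse (det (k t)) \<cdot>\<^sub>m adj_mat (k t)) \<in> mats n"
    by (intro mats_smult adj_mats k)
  define B where "B t = k t * A * (inverse (det (k t)) \<cdot>\<^sub>m adj_mat (k t))" for t
  have B: "B \<in> mats n" unfolding B_def by (intro mats_mult k mats_const ki) simp
  then have BR [simp]: "B t \<in> R" for t by (rule mats_carrier)
  have conj: "(k t * g) \<in> GL n \<and> conj_by (k t * g) J = B t \<and> B t * k t = k t * A" if "det (k t) \<noteq> 0" for t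
  proof -
    let ?v = "inverse (det (k t)) \<cdot>\<^sub>m adj_mat (k t)"
    have v: "unit_pair (k t) ?v" using det_unit[OF kR that] .
    then have [simp]: "?v \<in> R" and vk: "?v * k t = I" by (auto simp: unit_pair_def)
    have u: "unit_pair (k t * g) (h * ?v)" by (rule unit_pair_mult[OF v g])
    have "conj_by (k t * g) J = B t" unfolding conj_by_eq[OF u] B_def A by (simp only: mult_assoc closed kR \<open>g \<in> R\<close> \<open>h \<in> R\<close> J \<open>?v \<in> R\<close>)
    moreover have "B t * k t = k t * A" unfolding B_def by (simp only: mult_assoc closed kR \<open>A \<in> R\<close> \<open>?v \<in> R\<close> vk units)
    ultimately show ?thesis using u GL_iff by blast
  qed
  obtain B' where B': "has_mat_deriv0 n B B'" using deriv0_exists[OF B] by blast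
  then have [simp]: "B' \<in> R" by (simp add: has_mat_deriv0_def)
  have B0: "B 0 = A" using conj[of 0] by (simp add: k0)
  have dk: "has_mat_deriv0 n k Y" unfolding k_def by (rule deriv0_line) simp_all
  have "has_mat_deriv0 n (\<lambda>t. B t * k t) (B' + A * Y)"
    using deriv0_mult[OF B' dk BR kR] by (simp add: k0 B0)
  moreover have "has_mat_deriv0 n (\<lambda>t. B t * k t) (Y * A + I * Z)"
  proof (rule deriv0_cong)
    show "has_mat_deriv0 n (\<lambda>t. k t * A) (Y * A + I * Z)"
      using deriv0_mult[OF dk deriv0_const[OF \<open>A \<in> R\<close>] kR] by (simp add: k0)
    show "\<forall>\<^sub>F t in nhds 0. \<forall>a<n. \<forall>b<n. (k t * A) $$ (a, b) = (B t * k t) $$ (a, b)"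
      using ev by (rule eventually_mono) (use conj in simp)
  qed
  ultimately have "B' + A * Y = Y * A" by (auto dest: deriv0_unique)
  then have B'_eq: "B' = Y * A - A * Y" by (rule eq_diffI) simp_all
  show ?thesis
    unfolding orbit_curve_def dim k_def[symmetric]
  proof (intro conjI)
    show "\<forall>\<^sub>F t in nhds 0. k t * g \<in> GL n" using ev by (rule eventually_mono) (use conj in blast)
    show "has_mat_deriv0 n (\<lambda>t. k t * g) (Y * g)"
      using deriv0_mult[OF dk deriv0_const[OF \<open>g \<in> R\<close>] kR] by (simp add: k0)
    show "conj_by (k 0 * g) J = A" using conj[of 0] B0 by (simp add: k0)
    show "has_mat_deriv0 n (\<lambda>t. conj_by (k t * g) J) (Y * A - A * Y)"
    proof (rule deriv0_cong)
      show "has_mat_deriv0 n B (Y * A - A * Y)" using B' by (simp add: B'_eq)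
      show "\<forall>\<^sub>F t in nhds 0. \<forall>a<n. \<forall>b<n. B t $$ (a, b) = conj_by (k t * g) J $$ (a, b)"
        using ev by (rule eventually_mono) (use conj in simp)
    qed
  qed
qed

text \<open>Cyclicity gives \<open>tr (A [X, Y]) = tr (X [Y, A]) = - tr (Y [X, A])\<close>, so the
  value depends on \<open>X\<close> and \<open>Y\<close> only through the tangent vectors
  \<open>[X, A]\<close> and \<open>[Y, A]\<close>; this is the independence of the chosen
  curves.\<close>

lemma kks_form_iff:
  assumes J [simp]: "J \<in> R" and A: "A \<in> orbit J" and [simp]: "X \<in> R" "Y \<in> R"
  shows "kks_form J A (X * A - A * X) (Y * A - A * Y) w \<longleftrightarrow> w = mat_trace (A * (X * Y - Y * X))"
proof -
  have val: "mat_trace (J * commutator (h * X') (h * Y')) = mat_trace (A * ((X' * h) * (Y' * h) - (Y' * h) * (X' * h)))"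
    if g: "unit_pair g h" "A = g * J * h" and [simp]: "X' \<in> R" "Y' \<in> R" for g h X' Y'
  proof -
    have [simp]: "g \<in> R" "h \<in> R" and gh: "h * g = I" using g(1) by (auto simp: unit_pair_def)
    have "A * ((X' * h) * (Y' * h) - (Y' * h) * (X' * h)) = g * (J * commutator (h * X') (h * Y')) * h"
      by (simp add: g(2) commutator_def ring_simps)
    then show ?thesis using trace_conj[OF g(1)] by (simp add: commutator_def)
  qed
  obtain g0 h0 where g0: "unit_pair g0 h0" "A = g0 * J * h0" using A orbit_iff[OF J] by blast
  have [simp]: "A \<in> R" using g0 by (auto simp: unit_pair_def)
  show ?thesis
  proof
    assume "kks_form J A (X * A - A * X) (Y * A - A * Y) w"
    then obtain g1 g1' g2 g2' where c: "orbit_curve J A g1 g1' (X * A - A * X)" "orbit_curve J A g2 g2' (Y * A - A * Y)"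
      and eq: "g1 0 = g2 0" and w: "w = mat_trace (J * commutator (minv (g1 0) * g1') (minv (g1 0) * g2'))"
      unfolding kks_form_def by blast
    have "g1 0 \<in> GL n" using c(1) eventually_nhds_x_imp_x J unfolding orbit_curve_def by (metis carrier_matD(1))
    then obtain h where h: "unit_pair (g1 0) h" using GL_iff by blast
    then have [simp]: "h \<in> R" by (simp add: unit_pair_def)
    note 1 = orbit_curve_velocity[OF J c(1) h]
    note 2 = orbit_curve_velocity[OF J c(2) h[unfolded eq]]
    have [simp]: "g1' \<in> R" "g2' \<in> R" using 1 2 by simp_all
    have "w = mat_trace (A * ((g1' * h) * (g2' * h) - (g2' * h) * (g1' * h)))"
      unfolding w minv_eq[OF h] by (rule val[OF h 1(2)]) simp_all
    also have "\<dots> = mat_trace ((g1' * h) * (Y * A - A * Y))"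
      unfolding 2(3) by (rule trace_commutator) simp_all
    also have "\<dots> = mat_trace (A * ((g1' * h) * Y - Y * (g1' * h)))"
      by (rule trace_commutator(1)[symmetric]) simp_all
    also have "\<dots> = - mat_trace (Y * (X * A - A * X))"
      unfolding 1(3) by (rule trace_commutator(2)) simp_all
    also have "\<dots> = mat_trace (A * (X * Y - Y * X))"
      by (rule trace_commutator(2)[symmetric]) simp_all
    finally show "w = mat_trace (A * (X * Y - Y * X))" .
  next
    assume w: "w = mat_trace (A * (X * Y - Y * X))"
    have [simp]: "g0 \<in> R" "h0 \<in> R" and gh: "g0 * h0 = I" using g0(1) by (auto simp: unit_pair_def)
    have z: "(I + 0 \<cdot>\<^sub>m V) * g0 = g0" if "V \<in> R" for V
    proof -
      have "I + 0 \<cdot>\<^sub>m V = I" using that by (intro add_eqI) (simp_all add: entries)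
      then show ?thesis by simp
    qed
    have "mat_trace (J * commutator (h0 * (X * g0)) (h0 * (Y * g0))) = w"
      unfolding w by (subst val[OF g0]) (simp_all add: mult_assoc gh)
    then show "kks_form J A (X * A - A * X) (Y * A - A * Y) w"
      unfolding kks_form_def
      using ex_orbit_curve[OF J g0, of X] ex_orbit_curve[OF J g0, of Y] z[of X] z[of Y] minv_eq[OF g0(1)]
      by (intro exI[of _ "\<lambda>t. (I + t \<cdot>\<^sub>m X) * g0"] exI[of _ "X * g0"] exI[of _ "\<lambda>t. (I + t \<cdot>\<^sub>m Y) * g0"] exI[of _ "Y * g0"])
        simp
  qed
qed

end

section \<open>Traces of products of block triangular matrices\<close>

context flag
begin

lemma strict_lower_closed: "strict_lower A \<Longrightarrow> A \<in> R" by (simp add: strict_lower_def)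

text \<open>The part of \<open>A\<close> dropped by \<open>SU\<close> is block lower, and its
  product with a strictly lower matrix has zero diagonal.\<close>

lemma trace_SU: assumes [simp]: "A \<in> R" and B: "strict_lower B" shows "mat_trace (SU A * B) = mat_trace (A * B)"
proof -
  have [simp]: "B \<in> R" using B by (rule strict_lower_closed)
  have "(SU A * B) $$ (a, a) = (A * B) $$ (a, a)" if "a < n" for a
    using that B unfolding mult_entry[OF SU_closed \<open>B \<in> R\<close> that that] mult_entry[OF \<open>A \<in> R\<close> \<open>B \<in> R\<close> that that]
    by (intro sum.cong) (auto simp: SU_entry strict_lower_def not_less)
  then show ?thesis by (simp add: trace_eq)
qed

lemma strict_lower_mult: assumes A: "lower A" and B: "strict_lower B" shows "strict_lower (A * B)"
  unfolding strict_lower_def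
proof (intro conjI allI impI)
  have [simp]: "A \<in> R" "B \<in> R" using A B by (auto simp: lower_def strict_lower_def)
  show "A * B \<in> R" by simp
  fix a b assume ab: "a < n" "b < n" "bl a \<le> bl b"
  have "A $$ (a, c) * B $$ (c, b) = 0" if "c < n" for c
    using A B ab that by (cases "bl a < bl c") (auto simp: lower_def strict_lower_def)
  then show "(A * B) $$ (a, b) = 0"
    unfolding mult_entry[OF \<open>A \<in> R\<close> \<open>B \<in> R\<close> ab(1,2)] by (intro sum.neutral) blast
qed

lemma strict_lower_lower: "strict_lower A \<Longrightarrow> lower A" by (auto simp: strict_lower_def lower_def)

text \<open>An upper times a strictly upper matrix has zero diagonal. This removes the term of the
  symplectic form that is bilinear in the two upper corrections \<open>z\<close> and
  \<open>z'\<close>.\<close>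

lemma trace_upper_SU:
  assumes [simp]: "Y \<in> R" and Y: "\<And>j. E j * Y * D j = Z" and "A \<in> R" shows "mat_trace (Y * SU A) = 0"
proof -
  have "Y $$ (a, c) * SU A $$ (c, a) = 0" if "a < n" "c < n" for a c
  proof (cases "bl c < bl a")
    case True
    have "Y $$ (a, c) = (E (bl a) * Y * D (bl a)) $$ (a, c)" using that True by (simp add: proj_mult_entry)
    then show ?thesis using Y that by (simp add: entries)
  qed (simp add: that SU_entry)
  then have "(Y * SU A) $$ (a, a) = 0" if "a < n" for a
    unfolding mult_entry[OF assms(1) SU_closed that that] using that by (intro sum.neutral) blast
  then show ?thesis by (simp add: trace_eq)
qed

end

section \<open>Darboux coordinates\<close>

context jordan_data
begin

lemma trace_PL:
  "mat_trace (P_mat Y * L_mat X) =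
    (\<Sum>i<length ns. \<Sum>j<i. \<Sum>s<ns ! j. \<Sum>t<ns ! i. q_coord i j t s X * p_coord j i s t Y)"
proof -
  let ?f = "\<lambda>i j s t. P_mat Y $$ (off j + s, off i + t) * L_mat X $$ (off i + t, off j + s)"
  have "mat_trace (P_mat Y * L_mat X) = (\<Sum>a<N. \<Sum>b<N. P_mat Y $$ (a, b) * L_mat X $$ (b, a))"
    by (simp add: trace_eq mult_entry)
  also have "\<dots> = (\<Sum>b<N. \<Sum>a<N. P_mat Y $$ (a, b) * L_mat X $$ (b, a))"
    by (rule sum.swap)
  also have "\<dots> = (\<Sum>i<length ns. \<Sum>t<ns ! i. \<Sum>j<length ns. \<Sum>s<ns ! j. ?f i j s t)"
    by (simp only: sum_blocks flip: sum_list_ns)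
  also have "\<dots> = (\<Sum>i<length ns. \<Sum>j<length ns. \<Sum>s<ns ! j. \<Sum>t<ns ! i. ?f i j s t)"
  proof (rule sum.cong[OF refl])
    fix i
    have "(\<Sum>t<ns ! i. \<Sum>j<length ns. \<Sum>s<ns ! j. ?f i j s t) = (\<Sum>j<length ns. \<Sum>t<ns ! i. \<Sum>s<ns ! j. ?f i j s t)"
      by (rule sum.swap)
    also have "\<dots> = (\<Sum>j<length ns. \<Sum>s<ns ! j. \<Sum>t<ns ! i. ?f i j s t)"
      by (rule sum.cong[OF refl], rule sum.swap)
    finally show "(\<Sum>t<ns ! i. \<Sum>j<length ns. \<Sum>s<ns ! j. ?f i j s t) = (\<Sum>j<length ns. \<Sum>s<ns ! j. \<Sum>t<ns ! i. ?f i j s t)" .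
  qed
  also have "\<dots> = (\<Sum>i<length ns. \<Sum>j<i. \<Sum>s<ns ! j. \<Sum>t<ns ! i. ?f i j s t)"
  proof (rule sum.cong[OF refl])
    fix i assume i: "i \<in> {..<length ns}"
    show "(\<Sum>j<length ns. \<Sum>s<ns ! j. \<Sum>t<ns ! i. ?f i j s t) = (\<Sum>j<i. \<Sum>s<ns ! j. \<Sum>t<ns ! i. ?f i j s t)"
    proof (rule sum.mono_neutral_right)
      show "\<forall>j\<in>{..<length ns} - {..<i}. (\<Sum>s<ns ! j. \<Sum>t<ns ! i. ?f i j s t) = 0"
      proof
        fix j assume j: "j \<in> {..<length ns} - {..<i}"
        have "P_mat Y $$ (off j + s, off i + t) = 0" if "s < ns ! j" "t < ns ! i" for s t
          using off_less[of j s] off_less[of i t] i j that by (simp add: P_mat_def)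
        then show "(\<Sum>s<ns ! j. \<Sum>t<ns ! i. ?f i j s t) = 0" by (intro sum.neutral ballI) simp
      qed
    qed (use i in auto)
  qed
  also have "\<dots> = (\<Sum>i<length ns. \<Sum>j<i. \<Sum>s<ns ! j. \<Sum>t<ns ! i. q_coord i j t s X * p_coord j i s t Y)"
    by (intro sum.cong refl) (simp add: coords_eq mult.commute)
  finally show ?thesis .
qed

lemma canonical_form_trace:
  "canonical_form ns X Y = mat_trace (P_mat Y * L_mat X) - mat_trace (P_mat X * L_mat Y)"
  unfolding trace_PL canonical_form_def wedge_def by (simp add: sum_subtractf)

lemma param_line_mats:
  assumes x: "x \<in> param_space ns" and X: "X \<in> param_space ns"
  shows "P_mat (param_line ns x X t) = P_mat x + t \<cdot>\<^sub>m P_mat X"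
    and "L_mat (param_line ns x X t) = L_mat x + t \<cdot>\<^sub>m L_mat X"
proof -
  have P: "(fst x (j, i) + t \<cdot>\<^sub>m fst X (j, i)) $$ (s, u) = fst x (j, i) $$ (s, u) + t * fst X (j, i) $$ (s, u)"
    if "(j, i) \<in> upper_pos ns" "s < ns ! j" "u < ns ! i" for j i s u
  proof -
    have "fst X (j, i) \<in> carrier_mat (ns ! j) (ns ! i)"
      using X that(1) unfolding param_space_def by (auto simp: PiE_def Pi_def)
    then show ?thesis using that by auto
  qed
  have L: "(snd x (i, j) + t \<cdot>\<^sub>m snd X (i, j)) $$ (u, s) = snd x (i, j) $$ (u, s) + t * snd X (i, j) $$ (u, s)"
    if "(i, j) \<in> lower_pos ns" "s < ns ! j" "u < ns ! i" for j i s u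
  proof -
    have "snd X (i, j) \<in> carrier_mat (ns ! i) (ns ! j)"
      using X that(1) unfolding param_space_def by (auto simp: PiE_def Pi_def)
    then show ?thesis using that by auto
  qed
  show "P_mat (param_line ns x X t) = P_mat x + t \<cdot>\<^sub>m P_mat X"
  proof (rule add_eqI)
    fix a b assume ab: "a < N" "b < N"
    then show "P_mat (param_line ns x X t) $$ (a, b) = (P_mat x + t \<cdot>\<^sub>m P_mat X) $$ (a, b)"
      using P[of "bl a" "bl b" "a - off (bl a)" "b - off (bl b)"] bl_bounds[OF ab(1)] bl_bounds[OF ab(2)]
      by (simp add: P_mat_def param_line_def upper_pos_def)
  qed simp_all
  show "L_mat (param_line ns x X t) = L_mat x + t \<cdot>\<^sub>m L_mat X"
  proof (rule add_eqI)
    fix a b assume ab: "a < N" "b < N"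
    then show "L_mat (param_line ns x X t) $$ (a, b) = (L_mat x + t \<cdot>\<^sub>m L_mat X) $$ (a, b)"
      using L[of "bl a" "bl b" "b - off (bl b)" "a - off (bl a)"] bl_bounds[OF ab(1)] bl_bounds[OF ab(2)]
      by (simp add: L_mat_def param_line_def lower_pos_def)
  qed simp_all
qed

lemma param_map_closed [simp]: "param_map ns lam x \<in> R"
  by (simp add: param_map_eq)

text \<open>The derivative of \<open>\<rho>\<close> at \<open>x\<close> in direction
  \<open>X\<close>: the product rule for \<open>P Q\<close>, with \<open>L_mat X\<close> as the
  derivative of \<open>Q\<close>.\<close>

definition rho_dot :: "params \<Rightarrow> params \<Rightarrow> complex mat" where
  "rho_dot x X = SU (P_mat X * Q_mat ns x + P_mat x * L_mat X)"

lemma rho_dot_closed [simp]: "rho_dot x X \<in> R" by (simp add: rho_dot_def)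

text \<open>Obtained by differentiating \<open>A Q = Q \<rho>\<close>, so that no derivative of the
  inverse of \<open>Q\<close> is computed. In the bracket, \<open>Qi_mat x * L_mat X\<close>
  accounts for the motion of \<open>Q\<close> and \<open>\<zeta>\<close> for that of
  \<open>\<rho>\<close>.\<close>

lemma param_velocity:
  assumes x: "x \<in> param_space ns" and X: "X \<in> param_space ns" and \<zeta> [simp]: "\<zeta> \<in> R"
    and eq: "\<zeta> * rho_mat ns lam x - rho_mat ns lam x * \<zeta> = rho_dot x X"
  defines "A \<equiv> param_map ns lam x"
    and "V \<equiv> Q_mat ns x * (Qi_mat x * L_mat X + \<zeta>) * Qi_mat x"
  shows "has_mat_deriv0 N (\<lambda>t. param_map ns lam (param_line ns x X t)) (V * A - A * V)"
proof -
  let ?F = "{f. \<exists>d. (f has_field_derivative d) (at (0::complex))}"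
  interpret function_algebra ?F by (rule function_algebra_differentiable)
  let ?x = "param_line ns x X"
  let ?Q = "Q_mat ns x" and ?Qi = "Qi_mat x" and ?r = "rho_mat ns lam x"
  have QQ: "?Q * ?Qi = I" "?Qi * ?Q = I" using Q_unit by (simp_all add: unit_pair_def)
  note line = param_line_mats[OF x X]
  have zero: "B + 0 \<cdot>\<^sub>m C = B" if "B \<in> R" "C \<in> R" for B C
    using that by (intro add_eqI) (simp_all add: entries)
  have id: "(\<lambda>t. t) \<in> ?F" by (auto intro: DERIV_ident)
  have P: "(\<lambda>t. P_mat (?x t)) \<in> mats N" and L: "(\<lambda>t. L_mat (?x t)) \<in> mats N"
    unfolding line by (intro mats_add mats_const mats_smult id; simp)+
  note M = param_matrix_mats[OF function_algebra_differentiable P L]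
  obtain \<xi> where \<xi>: "has_mat_deriv0 N (\<lambda>t. param_map ns lam (?x t)) \<xi>" using deriv0_exists[OF M(4)] by blast
  have [simp]: "\<xi> \<in> R" using \<xi> by (simp add: has_mat_deriv0_def)
  have [simp]: "A \<in> R" "V \<in> R" by (simp_all add: A_def V_def param_map_eq)
  have Q_line: "Q_mat ns (?x t) = ?Q + t \<cdot>\<^sub>m L_mat X" for t
    unfolding Q_mat_eq line by (rule add_eqI) (simp_all add: entries)
  have dQ: "has_mat_deriv0 N (\<lambda>t. Q_mat ns (?x t)) (L_mat X)" unfolding Q_line by (rule deriv0_line) simp_all
  have dP: "has_mat_deriv0 N (\<lambda>t. P_mat (?x t)) (P_mat X)" unfolding line by (rule deriv0_line) simp_all
  have Q0: "Q_mat ns (?x 0) = ?Q" unfolding Q_line by (rule zero) simp_all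
  have P0: "P_mat (?x 0) = P_mat x" unfolding line by (rule zero) simp_all
  have "Qi_mat (?x 0) = ?Qi" by (simp add: Qi_mat_def Q0)
  moreover have r0: "rho_mat ns lam (?x 0) = ?r" by (simp add: rho_mat_eq P0 Q0)
  ultimately have A0: "param_map ns lam (?x 0) = A" by (simp add: param_map_eq Q0 A_def)
  have dSU: "has_mat_deriv0 N (\<lambda>t. SU (G t)) (SU G')" if "has_mat_deriv0 N G G'" for G G'
    unfolding has_mat_deriv0_def
  proof (intro conjI allI impI)
    fix a b assume "a < N" "b < N"
    then show "((\<lambda>t. SU (G t) $$ (a, b)) has_field_derivative SU G' $$ (a, b)) (at 0)"
      using that by (cases "bl a < bl b") (simp_all add: SU_entry has_mat_deriv0_def)
  qed simp
  have dPQ: "has_mat_deriv0 N (\<lambda>t. P_mat (?x t) * Q_mat ns (?x t)) (P_mat X * ?Q + P_mat x * L_mat X)"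
    using deriv0_mult[OF dP dQ] by (simp add: P0 Q0)
  have "has_mat_deriv0 N (\<lambda>t. Lam + SU (P_mat (?x t) * Q_mat ns (?x t))) (Z + rho_dot x X)"
    unfolding rho_dot_def by (rule deriv0_add[OF deriv0_const dSU[OF dPQ]]) simp_all
  then have dr: "has_mat_deriv0 N (\<lambda>t. rho_mat ns lam (?x t)) (rho_dot x X)" by (simp add: rho_mat_eq)
  have "has_mat_deriv0 N (\<lambda>t. param_map ns lam (?x t) * Q_mat ns (?x t)) (\<xi> * ?Q + A * L_mat X)"
    using deriv0_mult[OF \<xi> dQ] by (simp add: Q0 A0)
  moreover have "param_map ns lam y * Q_mat ns y = Q_mat ns y * rho_mat ns lam y" for y
  proof -
    have "Qi_mat y * Q_mat ns y = I" using Q_unit by (simp add: unit_pair_def)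
    then show ?thesis by (simp add: param_map_eq mult_assoc)
  qed
  ultimately have "has_mat_deriv0 N (\<lambda>t. Q_mat ns (?x t) * rho_mat ns lam (?x t)) (\<xi> * ?Q + A * L_mat X)" by simp
  moreover have "has_mat_deriv0 N (\<lambda>t. Q_mat ns (?x t) * rho_mat ns lam (?x t)) (L_mat X * ?r + ?Q * rho_dot x X)"
    using deriv0_mult[OF dQ dr] by (simp add: Q0 r0)
  ultimately have "\<xi> * ?Q + A * L_mat X = L_mat X * ?r + ?Q * rho_dot x X" by (rule deriv0_unique)
  then have "\<xi> * ?Q = L_mat X * ?r + ?Q * rho_dot x X - A * L_mat X" by (rule eq_diffI) simp_all
  then have "\<xi> * ?Q * ?Qi = (L_mat X * ?r + ?Q * rho_dot x X - A * L_mat X) * ?Qi" by simp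
  then have 1: "\<xi> = (L_mat X * ?r + ?Q * rho_dot x X - A * L_mat X) * ?Qi" by (simp add: mult_assoc QQ)
  have "\<xi> = V * A - A * V"
    unfolding 1 eq[symmetric]
    by (simp add: V_def A_def param_map_eq ring_simps assoc_eq[OF QQ(1)] assoc_eq[OF QQ(2)])
      (rule add_eqI, simp_all add: entries)
  then show ?thesis using \<xi> by simp
qed

text \<open>With \<open>u = Q\<^sup>-\<^sup>1 dQ\<close> and \<open>z\<close> upper solving \<open>[z, \<rho>] = d\<rho>\<close>, the tangent vector is \<open>[Q (u + z) Q\<^sup>-\<^sup>1, A]\<close>.
  In the value of the form the terms quadratic in \<open>u\<close> cancel, because \<open>tr (SU B * u) = tr (B * u)\<close>
  for strictly lower \<open>u\<close> and \<open>P Q u = P dQ\<close>.\<close>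

lemma darboux: "darboux_on J ns (param_map ns lam) param_dom"
  unfolding darboux_on_def dim_J
proof (intro ballI)
  fix x X Y assume x: "x \<in> param_dom" and X: "X \<in> param_space ns" and Y: "Y \<in> param_space ns"
  let ?Q = "Q_mat ns x" and ?Qi = "Qi_mat x" and ?r = "rho_mat ns lam x" and ?P = "P_mat x"
  let ?A = "param_map ns lam x"
  have xs: "x \<in> param_space ns" and A: "?A \<in> orbit J" using x by (simp_all add: param_dom_def)
  have generic: "generic ?r" using A param_map_orbit_iff by simp
  have QQ: "?Q * ?Qi = I" "?Qi * ?Q = I" using Q_unit by (simp_all add: unit_pair_def)
  have strict: "E j * rho_dot x V * D (Suc j) = Z" for V j
    unfolding rho_dot_def by (rule add_eqI) (auto simp: proj_mult_entry SU_entry entries)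
  obtain z where z [simp]: "z \<in> R" and zu: "\<And>j. E j * z * D j = Z" and zr: "z * ?r - ?r * z = rho_dot x X"
    using commutator_solvable[OF generic rho_dot_closed strict] by metis
  obtain z' where z' [simp]: "z' \<in> R" and zu': "\<And>j. E j * z' * D j = Z" and zr': "z' * ?r - ?r * z' = rho_dot x Y"
    using commutator_solvable[OF generic rho_dot_closed strict] by metis
  define u where "u = ?Qi * L_mat X"
  define u' where "u' = ?Qi * L_mat Y"
  have [simp]: "u \<in> R" "u' \<in> R" by (simp_all add: u_def u'_def)
  have su: "strict_lower u" "strict_lower u'"
    unfolding u_def u'_def by (rule strict_lower_mult[OF lower_Qi strict_lower_L])+
  define V where "V = ?Q * (u + z) * ?Qi"
  define W where "W = ?Q * (u' + z') * ?Qi"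
  have [simp]: "V \<in> R" "W \<in> R" by (simp_all add: V_def W_def)
  have dV: "has_mat_deriv0 N (\<lambda>t. param_map ns lam (param_line ns x X t)) (V * ?A - ?A * V)"
    unfolding V_def u_def by (rule param_velocity[OF xs X z zr])
  have dW: "has_mat_deriv0 N (\<lambda>t. param_map ns lam (param_line ns x Y t)) (W * ?A - ?A * W)"
    unfolding W_def u'_def by (rule param_velocity[OF xs Y z' zr'])
  have "mat_trace (?A * (V * W - W * V)) = canonical_form ns X Y"
  proof -
    let ?T = "\<lambda>a b. mat_trace (?r * (a * b - b * a))"
    have "?A * (V * W - W * V) = ?Q * (?r * ((u + z) * (u' + z') - (u' + z') * (u + z))) * ?Qi"
      unfolding param_map_eq V_def W_def
      by (simp add: mult_assoc distribs(3,4) assoc_eq[OF QQ(2)])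
    then have "mat_trace (?A * (V * W - W * V)) = ?T (u + z) (u' + z')"
      using trace_conj[OF Q_unit] by simp
    also have "\<dots> = ?T u u' + ?T u z' + ?T z u' + ?T z z'"
    proof -
      have "?r * ((u + z) * (u' + z') - (u' + z') * (u + z)) =
          ?r * (u * u' - u' * u) + ?r * (u * z' - z' * u) + ?r * (z * u' - u' * z) + ?r * (z * z' - z' * z)"
        by (simp add: ring_simps) (rule add_eqI, simp_all add: entries)
      then show ?thesis by (simp add: trace_add)
    qed
    finally have 1: "mat_trace (?A * (V * W - W * V)) = ?T u u' + ?T u z' + ?T z u' + ?T z z'" .
    have 2: "?T u z' = mat_trace (u * rho_dot x Y)" by (subst trace_commutator(1)) (simp_all add: zr')
    have "?T z z' = mat_trace (z * rho_dot x Y)" by (subst trace_commutator(1)) (simp_all add: zr')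
    also have "\<dots> = 0" unfolding rho_dot_def by (rule trace_upper_SU[OF z zu]) simp
    finally have 3: "?T z z' = 0" .
    have 4: "?T z u' = - mat_trace (u' * rho_dot x X)" by (subst trace_commutator(2)) (simp_all add: zr)
    have rd: "mat_trace (v * rho_dot x B) = mat_trace (P_mat B * ?Q * v) + mat_trace (?P * L_mat B * v)"
      if v: "strict_lower v" for v B
    proof -
      have [simp]: "v \<in> R" using v by (rule strict_lower_closed)
      have "mat_trace (v * rho_dot x B) = mat_trace (rho_dot x B * v)" by (rule trace_comm) simp_all
      also have "\<dots> = mat_trace ((P_mat B * ?Q + ?P * L_mat B) * v)"
        unfolding rho_dot_def by (rule trace_SU[OF _ v]) simp
      finally show ?thesis by (simp add: distribs trace_add)
    qed
    have PLu: "P_mat B * ?Q * u = P_mat B * L_mat X" "P_mat B * ?Q * u' = P_mat B * L_mat Y" for B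
      by (simp_all add: u_def u'_def mult_assoc assoc_eq[OF QQ(1)])
    \<comment> \<open>Only the truncated product contributes, since \<open>Lam\<close> is diagonal
      and \<open>v * v'\<close> strictly lower.\<close>
    have Luu: "mat_trace (?r * (v * v')) = mat_trace (?P * ?Q * (v * v'))"
      if v: "strict_lower v" "strict_lower v'" for v v'
    proof -
      have [simp]: "v \<in> R" "v' \<in> R" using v by (auto intro: strict_lower_closed)
      have s: "strict_lower (v * v')" by (rule strict_lower_mult[OF strict_lower_lower[OF v(1)] v(2)])
      have "(Lam * (v * v')) $$ (a, a) = 0" if "a < N" for a
        using that s by (subst mult_entry) (auto simp: Lam_def strict_lower_def intro!: sum.neutral)
      then have "mat_trace (Lam * (v * v')) = 0" by (simp add: trace_eq)
      then show ?thesis using trace_SU[OF _ s, of "?P * ?Q"] by (simp add: rho_mat_eq distribs trace_add)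
    qed
    have "?T u u' = mat_trace (?P * ?Q * (u * u')) - mat_trace (?P * ?Q * (u' * u))"
      by (simp add: distribs trace_diff Luu su)
    also have "?P * ?Q * (u * u') = ?P * L_mat X * u'"
      using PLu(1)[of x] by (simp flip: mult_assoc)
    also have "?P * ?Q * (u' * u) = ?P * L_mat Y * u"
      using PLu(2)[of x] by (simp flip: mult_assoc)
    finally have T: "?T u u' = mat_trace (?P * L_mat X * u') - mat_trace (?P * L_mat Y * u)" .
    \<comment> \<open>The two traces in \<open>T\<close> cancel against the second summands of
      \<open>rd\<close>; the first summands are the two traces of the canonical form.\<close>
    show ?thesis
      unfolding 1 2 3 4 T rd[OF su(1)] rd[OF su(2)] PLu canonical_form_trace by simp
  qed
  then have "kks_form J ?A (V * ?A - ?A * V) (W * ?A - ?A * W) w \<longleftrightarrow> w = canonical_form ns X Y" for w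
    using kks_form_iff[OF J_closed A, of V W w] by simp
  then show "\<exists>\<xi> \<eta>. has_mat_deriv0 N (\<lambda>t. param_map ns lam (param_line ns x X t)) \<xi> \<and>
      has_mat_deriv0 N (\<lambda>t. param_map ns lam (param_line ns x Y t)) \<eta> \<and>
      (\<forall>w. kks_form J ?A \<xi> \<eta> w \<longleftrightarrow> w = canonical_form ns X Y)"
    using dV dW by blast
qed

end

theorem theorem4:
  fixes n_as :: "(nat \<times> complex) list" and lam :: "complex list"
  assumes "0 \<notin> fst ` set n_as"
    and "eigenvalue_sequence n_as lam"
  defines "J \<equiv> jordan_matrix n_as"
    and "ns \<equiv> chain_counts n_as lam"
  defines "U \<equiv> {x \<in> param_space ns. param_map ns lam x \<in> orbit J}"
  shows "zariski_open (param_coords ns) (param_space ns) U \<and> U \<noteq> {} \<and>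
    birational_map (param_coords ns) U (entry_coords (dim_row J)) (orbit J) (param_map ns lam) \<and>
    darboux_on J ns (param_map ns lam) U"
proof -
  interpret jd: jordan_data n_as lam using assms(1,2) by unfold_locales
  have ns: "ns = jd.ns" by (simp add: ns_def jd.ns_def)
  have U: "U = jd.param_dom" by (simp add: U_def jd.param_dom_def ns J_def)
  show ?thesis
    unfolding U J_def ns jd.dim_J
    using jd.param_dom_open jd.param_dom_nonempty jd.param_map_birational jd.darboux by blast
qed

end
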